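(* Let $n\ge3$ and $k\ge1$ be integers. The function on $(-\infty,\pi)$ given by $$\Theta\mapsto\begin{cases}\lambda_k(\Theta)\,\sinh^2(\Theta), & \Theta\in(-\infty,0),\\ \lambda_k(\mathbb{B}^n), & \Theta=0,\\ \lambda_k(\Theta)\,\sin^2(\Theta), & \Theta\in(0,\pi),\end{cases}$$ is strictly decreasing, tends to $\infty$ as $\Theta\to-\infty$, and tends to $0$ as $\Theta\to\pi$.
   Context: For $0<\Theta<\pi$, $C(\Theta)$ denotes the spherical cap of aperture $\Theta$ in the unit sphere $\mathbb{S}^n$ (curvature $1$), i.e. the open geodesic ball of radius $\Theta$ about the north pole. For $\Theta<0$, $C(\Theta)$ denotes an open geodesic ball of radius $|\Theta|$ in hyperbolic space $\mathbb{H}^n$ (curvature $-1$). $\lambda_k(\Theta)$ is the $k$-th Dirichlet eigenvalue (in increasing order, counted with multiplicity) of minus the Laplace--Beltrami operator on $C(\Theta)$ (of $\mathbb{S}^n$ if $\Theta>0$, of $\mathbb{H}^n$ if $\Theta<0$). $\mathbb{B}^n$ is the Euclidean unit ball in $\mathbb{R}^n$ and $\lambda_k(\mathbb{B}^n)$ is the $k$-th Dirichlet eigenvalue of the Euclidean Laplacian on it. *)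

theory Defs
  imports "HOL-Analysis.Analysis"
begin

section \<open>Smooth functions on Euclidean space\<close>

definition partial_deriv :: "'n::finite \<Rightarrow> (real^'n \<Rightarrow> real) \<Rightarrow> real^'n \<Rightarrow> real" where
  "partial_deriv i f x = frechet_derivative f (at x) (axis i 1)"

definition coord_grad :: "(real^'n::finite \<Rightarrow> real) \<Rightarrow> real^'n \<Rightarrow> real^'n" where
  "coord_grad f x = (\<chi> i. partial_deriv i f x)"

fun cont_diff :: "nat \<Rightarrow> (real^'n::finite \<Rightarrow> real) \<Rightarrow> bool" where
  "cont_diff 0 f \<longleftrightarrow> continuous_on UNIV f"
| "cont_diff (Suc m) f \<longleftrightarrow>
     (\<forall>x. f differentiable (at x)) \<and> (\<forall>i. cont_diff m (partial_deriv i f))"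

definition test_functions :: "(real^'n::finite) set \<Rightarrow> (real^'n \<Rightarrow> real) set" where
  "test_functions \<Omega> =
     {\<phi>. (\<forall>m. cont_diff m \<phi>) \<and> compact (closure {x. \<phi> x \<noteq> 0}) \<and> closure {x. \<phi> x \<noteq> 0} \<subseteq> \<Omega>}"


section \<open>The Dirichlet Laplacian of a Riemannian metric in a coordinate domain\<close>

text \<open>
  A Riemannian metric on an open set \<open>\<Omega>\<close> of coordinates is given by its matrix
  \<open>G x = (g\<^sub>i\<^sub>j x)\<close>. Only its values on \<open>\<Omega>\<close> matter.
\<close>

definition metric_volume ::
  "(real^'n::finite \<Rightarrow> real^'n^'n) \<Rightarrow> (real^'n) set \<Rightarrow> (real^'n) measure" where
  "metric_volume G \<Omega> = density lborel (\<lambda>x. indicator \<Omega> x * ennreal (sqrt (det (G x))))"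

text \<open>\<open>\<Delta>\<^sub>g f = |g|\<^bsup>-1/2\<^esup> \<Sum>\<^sub>i \<partial>\<^sub>i (|g|\<^bsup>1/2\<^esup> \<Sum>\<^sub>j g\<^bsup>ij\<^esup> \<partial>\<^sub>j f)\<close>\<close>

definition laplace_beltrami ::
  "(real^'n::finite \<Rightarrow> real^'n^'n) \<Rightarrow> (real^'n \<Rightarrow> real) \<Rightarrow> real^'n \<Rightarrow> real" where
  "laplace_beltrami G f x =
     (1 / sqrt (det (G x))) *
     (\<Sum>i\<in>UNIV. partial_deriv i
        (\<lambda>y. sqrt (det (G y)) * (matrix_inv (G y) *v coord_grad f y) $ i) x)"

definition grad_norm_sq ::
  "(real^'n::finite \<Rightarrow> real^'n^'n) \<Rightarrow> (real^'n \<Rightarrow> real) \<Rightarrow> real^'n \<Rightarrow> real" where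
  "grad_norm_sq G f x = coord_grad f x \<bullet> (matrix_inv (G x) *v coord_grad f x)"

text \<open>
  The Sobolev space \<open>H\<^sub>0\<^sup>1\<close>: the completion, realised inside \<open>L\<^sup>2\<close>, of the
  test functions in the \<open>H\<^sup>1\<close> norm. Elements are representatives; they are
  identified when they agree almost everywhere.
\<close>

definition sobolev_H10 ::
  "(real^'n::finite \<Rightarrow> real^'n^'n) \<Rightarrow> (real^'n) set \<Rightarrow> (real^'n \<Rightarrow> real) set" where
  "sobolev_H10 G \<Omega> =
     {u. u \<in> borel_measurable (metric_volume G \<Omega>) \<and>
         integrable (metric_volume G \<Omega>) (\<lambda>x. (u x)\<^sup>2) \<and>
         (\<exists>\<phi> :: nat \<Rightarrow> real^'n \<Rightarrow> real.
            (\<forall>m. \<phi> m \<in> test_functions \<Omega>) \<and>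
            (\<lambda>m. LINT x|metric_volume G \<Omega>. (\<phi> m x - u x)\<^sup>2) \<longlonglongrightarrow> 0 \<and>
            (\<forall>\<epsilon>>0. \<exists>M. \<forall>m\<ge>M. \<forall>l\<ge>M.
               (LINT x|metric_volume G \<Omega>. grad_norm_sq G (\<lambda>y. \<phi> m y - \<phi> l y) x) < \<epsilon>))}"

text \<open>
  The kernel of \<open>-\<Delta> - \<mu>\<close> for the (self-adjoint) Dirichlet Laplacian, whose domain
  consists of the \<open>u\<close> in \<open>H\<^sub>0\<^sup>1\<close> with distributional Laplacian in \<open>L\<^sup>2\<close>: the
  equation \<open>-\<Delta> u = \<mu> u\<close> is required in the sense of distributions on \<open>\<Omega>\<close>.
\<close>

definition dirichlet_eigenspace ::
  "(real^'n::finite \<Rightarrow> real^'n^'n) \<Rightarrow> (real^'n) set \<Rightarrow> real \<Rightarrow> (real^'n \<Rightarrow> real) set" where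
  "dirichlet_eigenspace G \<Omega> \<mu> =
     {u \<in> sobolev_H10 G \<Omega>. \<forall>\<phi>\<in>test_functions \<Omega>.
        (LINT x|metric_volume G \<Omega>. u x * - laplace_beltrami G \<phi> x) =
        (LINT x|metric_volume G \<Omega>. \<mu> * u x * \<phi> x)}"

definition lin_indep_ae :: "'b measure \<Rightarrow> nat \<Rightarrow> (nat \<Rightarrow> 'b \<Rightarrow> real) \<Rightarrow> bool" where
  "lin_indep_ae M m u \<longleftrightarrow>
     (\<forall>c :: nat \<Rightarrow> real. (AE x in M. (\<Sum>i<m. c i * u i x) = 0) \<longrightarrow> (\<forall>i<m. c i = 0))"

text \<open>\<open>V\<close>, modulo equality almost everywhere, has dimension \<open>m\<close>.\<close>

definition has_dim_ae :: "'b measure \<Rightarrow> ('b \<Rightarrow> real) set \<Rightarrow> nat \<Rightarrow> bool" where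
  "has_dim_ae M V m \<longleftrightarrow>
     (\<exists>u. (\<forall>i<m. u i \<in> V) \<and> lin_indep_ae M m u) \<and>
     \<not> (\<exists>u. (\<forall>i<Suc m. u i \<in> V) \<and> lin_indep_ae M (Suc m) u)"

lemma lin_indep_ae_mono:
  assumes "lin_indep_ae M m u" "m' \<le> m"
  shows "lin_indep_ae M m' u"
  unfolding lin_indep_ae_def
proof (intro allI impI)
  fix c :: "nat \<Rightarrow> real" and i
  assume ae: "AE x in M. (\<Sum>i<m'. c i * u i x) = 0" and i: "i < m'"
  let ?c = "\<lambda>i. if i < m' then c i else 0"
  have "(\<Sum>i<m. ?c i * u i x) = (\<Sum>i<m'. c i * u i x)" for x
    using assms(2) by (intro sum.mono_neutral_cong_right) auto
  then have "AE x in M. (\<Sum>i<m. ?c i * u i x) = 0"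
    using ae by simp
  then have "\<forall>i<m. ?c i = 0"
    using assms(1)[unfolded lin_indep_ae_def, THEN spec, of ?c] by simp
  then have "?c i = 0"
    using i assms(2) less_le_trans by blast
  then show "c i = 0"
    using i by simp
qed

lemma has_dim_ae_unique:
  assumes "has_dim_ae M V m" "has_dim_ae M V m'"
  shows "m = m'"
proof -
  have "\<not> a < b" if a: "has_dim_ae M V a" and b: "has_dim_ae M V b" for a b
  proof
    assume "a < b"
    obtain u where u: "\<forall>i<b. u i \<in> V" "lin_indep_ae M b u"
      using b unfolding has_dim_ae_def by blast
    have "lin_indep_ae M (Suc a) u" "\<forall>i<Suc a. u i \<in> V"
      using u \<open>a < b\<close> lin_indep_ae_mono[OF u(2), of "Suc a"] by auto
    then show False
      using a unfolding has_dim_ae_def by blast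
  qed
  from this[OF assms] this[OF assms(2,1)] show ?thesis by simp
qed

text \<open>
  \<open>ev\<close> lists all Dirichlet eigenvalues in increasing order, each repeated according to its
  multiplicity (a number which is not an eigenvalue has multiplicity 0). At most one sequence
  has this property.
\<close>

definition lists_dirichlet_spectrum ::
  "(real^'n::finite \<Rightarrow> real^'n^'n) \<Rightarrow> (real^'n) set \<Rightarrow> (nat \<Rightarrow> real) \<Rightarrow> bool" where
  "lists_dirichlet_spectrum G \<Omega> ev \<longleftrightarrow> mono ev \<and>
     (\<forall>\<mu>. finite {j. ev j = \<mu>} \<and>
          has_dim_ae (metric_volume G \<Omega>) (dirichlet_eigenspace G \<Omega> \<mu>) (card {j. ev j = \<mu>}))"

lemma lists_dirichlet_spectrum_unique:
  assumes "lists_dirichlet_spectrum G \<Omega> a" "lists_dirichlet_spectrum G \<Omega> b"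
  shows "a = b"
proof (rule ext)
  have key: "\<not> a' j < b' j"
    if "lists_dirichlet_spectrum G \<Omega> a'" "lists_dirichlet_spectrum G \<Omega> b'"
      "\<forall>i<j. a' i = b' i" for a' b' :: "nat \<Rightarrow> real" and j
  proof
    assume less: "a' j < b' j"
    let ?A = "{i. a' i = a' j}" and ?B = "{i. b' i = a' j}"
    have fin: "finite ?A" and mono: "mono b'"
      using that by (auto simp: lists_dirichlet_spectrum_def)
    have "i < j" if "i \<in> ?B" for i
      using that less monoD[OF mono, of j i] by force
    then have "?B \<subset> ?A"
      using that(3) less by auto
    then have lt: "card ?B < card ?A"
      using fin by (rule psubset_card_mono[rotated])
    have dims: "has_dim_ae (metric_volume G \<Omega>) (dirichlet_eigenspace G \<Omega> (a' j)) (card ?A)"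
         "has_dim_ae (metric_volume G \<Omega>) (dirichlet_eigenspace G \<Omega> (a' j)) (card ?B)"
      using that by (auto simp: lists_dirichlet_spectrum_def)
    show False
      using has_dim_ae_unique[OF dims] lt by simp
  qed
  fix j
  show "a j = b j"
  proof (induction j rule: less_induct)
    case (less j)
    then show ?case
      using key[OF assms, of j] key[OF assms(2,1), of j] by (simp add: not_less)
  qed
qed

text \<open>Eigenvalues are numbered from \<open>k = 1\<close>.\<close>

definition dirichlet_eigenvalue ::
  "(real^'n::finite \<Rightarrow> real^'n^'n) \<Rightarrow> (real^'n) set \<Rightarrow> nat \<Rightarrow> real" where
  "dirichlet_eigenvalue G \<Omega> k = (THE ev. lists_dirichlet_spectrum G \<Omega> ev) (k - 1)"


section \<open>Geodesic balls in the sphere and in hyperbolic space\<close>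

text \<open>
  The sphere \<open>S\<^sup>n\<close> is \<open>sphere 0 1\<close> in \<open>\<real>\<^sup>n \<times> \<real>\<close> with geodesic distance \<open>arccos (p \<bullet> q)\<close>.
  Hyperbolic space \<open>H\<^sup>n\<close> is the upper sheet of the hyperboloid \<open>\<langle>p, p\<rangle> = -1\<close> in Minkowski
  space, with geodesic distance \<open>arcosh (- \<langle>p, q\<rangle>)\<close>. The base point of both is \<open>(0, 1)\<close>.
\<close>

definition minkowski :: "(real^'n::finite) \<times> real \<Rightarrow> (real^'n) \<times> real \<Rightarrow> real" where
  "minkowski p q = fst p \<bullet> fst q - snd p * snd q"

definition hyperbolic_space :: "((real^'n::finite) \<times> real) set" where
  "hyperbolic_space = {p. minkowski p p = -1 \<and> snd p > 0}"

definition pole :: "(real^'n::finite) \<times> real" where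
  "pole = (0, 1)"

definition geodesic_cap :: "real \<Rightarrow> ((real^'n::finite) \<times> real) set" where
  "geodesic_cap \<Theta> =
     (if \<Theta> < 0 then {p \<in> hyperbolic_space. arcosh (- minkowski p pole) < \<bar>\<Theta>\<bar>}
      else {p \<in> sphere 0 1. arccos (p \<bullet> pole) < \<Theta>})"

text \<open>
  Global coordinates: inverse stereographic projection from the south pole \<open>-pole\<close>, which
  parametrises the sphere minus that point by \<open>\<real>\<^sup>n\<close>, and the analogous projection which
  parametrises the hyperboloid by the unit ball (Poincare ball model). For \<open>\<Theta> < \<pi>\<close> the
  cap does not contain the south pole.
\<close>

definition sphere_param :: "real^'n::finite \<Rightarrow> (real^'n) \<times> real" where
  "sphere_param x = ((2 / (1 + x \<bullet> x)) *\<^sub>R x, (1 - x \<bullet> x) / (1 + x \<bullet> x))"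

definition hyperbolic_param :: "real^'n::finite \<Rightarrow> (real^'n) \<times> real" where
  "hyperbolic_param x = ((2 / (1 - x \<bullet> x)) *\<^sub>R x, (1 + x \<bullet> x) / (1 - x \<bullet> x))"

lemma sphere_param_bij: "bij_betw sphere_param UNIV (sphere 0 1 - {- pole})"
proof (rule bij_betw_byWitness[where f' = "\<lambda>p. (1 / (1 + snd p)) *\<^sub>R fst p"])
  have pos: "1 + x \<bullet> x > 0" for x :: "real^'n"
    by (simp add: add_pos_nonneg)
  have cancel: "s > 0 \<Longrightarrow> (1 / (2 / s)) *\<^sub>R (2 / s) *\<^sub>R x = x" for s and x :: "real^'n"
    by simp
  show "\<forall>x\<in>UNIV. (1 / (1 + snd (sphere_param x))) *\<^sub>R fst (sphere_param x) = (x :: real^'n)"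
  proof
    fix x :: "real^'n"
    have "1 + (1 - x \<bullet> x) / (1 + x \<bullet> x) = 2 / (1 + x \<bullet> x)"
      using pos[of x] by (simp add: field_simps)
    then show "(1 / (1 + snd (sphere_param x))) *\<^sub>R fst (sphere_param x) = x"
      unfolding sphere_param_def fst_conv snd_conv by (simp only: cancel[OF pos[of x]])
  qed
  have sph: "p \<in> sphere 0 1 \<longleftrightarrow> fst p \<bullet> fst p + (snd p)\<^sup>2 = 1" for p :: "(real^'n) \<times> real"
    by (simp add: norm_eq_1 inner_prod_def power2_eq_square)
  show "sphere_param ` UNIV \<subseteq> sphere 0 1 - {- pole :: (real^'n) \<times> real}"
  proof (rule image_subsetI)
    fix x :: "real^'n"
    define s where "s = 1 + x \<bullet> x"
    have s: "s > 0" and xx: "x \<bullet> x = s - 1" using pos[of x] by (simp_all add: s_def)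
    have "sphere_param x \<in> sphere 0 1"
      unfolding sph sphere_param_def s_def[symmetric] using s
      by (simp add: xx divide_simps) (simp add: algebra_simps power2_eq_square)
    moreover have "sphere_param x \<noteq> - pole"
    proof
      assume "sphere_param x = - pole"
      then have "(1 - x \<bullet> x) / (1 + x \<bullet> x) = -1"
        by (simp add: sphere_param_def pole_def)
      then show False using pos[of x] by (simp add: field_simps)
    qed
    ultimately show "sphere_param x \<in> sphere 0 1 - {- pole}" by simp
  qed
  show "\<forall>p\<in>sphere 0 1 - {- pole}. sphere_param ((1 / (1 + snd p)) *\<^sub>R fst p) = (p :: (real^'n) \<times> real)"
  proof
    fix p :: "(real^'n) \<times> real"
    assume p: "p \<in> sphere 0 1 - {- pole}"
    obtain y t where yt: "p = (y, t)" by force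
    have yy: "y \<bullet> y = (1 - t) * (1 + t)"
      using p sph[of p] yt by (simp add: algebra_simps power2_eq_square)
    have "t \<noteq> -1"
      using p yy yt by (auto simp: pole_def)
    then have t: "1 + t \<noteq> 0" by simp
    have e: "(1 / (1 + t)) *\<^sub>R y \<bullet> (1 / (1 + t)) *\<^sub>R y = (1 - t) / (1 + t)"
      using t by (simp add: yy)
    have s: "1 + (1 - t) / (1 + t) = 2 / (1 + t)"  "1 - (1 - t) / (1 + t) = 2 * t / (1 + t)"
      using t by (simp_all add: field_simps)
    show "sphere_param ((1 / (1 + snd p)) *\<^sub>R fst p) = p"
      unfolding sphere_param_def yt fst_conv snd_conv e s using t by simp
  qed
  show "(\<lambda>p. (1 / (1 + snd p)) *\<^sub>R fst p) ` (sphere 0 1 - {- pole}) \<subseteq> (UNIV :: (real^'n) set)"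
    by simp
qed

lemma hyperbolic_param_bij: "bij_betw hyperbolic_param (ball 0 1) hyperbolic_space"
proof (rule bij_betw_byWitness[where f' = "\<lambda>p. (1 / (1 + snd p)) *\<^sub>R fst p"])
  have pos: "x \<in> ball 0 1 \<longleftrightarrow> 1 - x \<bullet> x > 0" for x :: "real^'n"
    by (simp add: norm_lt square_norm_one norm_eq_sqrt_inner)
  have cancel: "s > 0 \<Longrightarrow> (1 / (2 / s)) *\<^sub>R (2 / s) *\<^sub>R x = x" for s and x :: "real^'n"
    by simp
  show "\<forall>x\<in>ball 0 1. (1 / (1 + snd (hyperbolic_param x))) *\<^sub>R fst (hyperbolic_param x) = (x :: real^'n)"
  proof
    fix x :: "real^'n" assume "x \<in> ball 0 1"
    then have x: "1 - x \<bullet> x > 0" by (simp only: pos)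
    have "1 + (1 + x \<bullet> x) / (1 - x \<bullet> x) = 2 / (1 - x \<bullet> x)"
      using x by (simp add: field_simps)
    then show "(1 / (1 + snd (hyperbolic_param x))) *\<^sub>R fst (hyperbolic_param x) = x"
      unfolding hyperbolic_param_def fst_conv snd_conv by (simp only: cancel[OF x])
  qed
  show "hyperbolic_param ` ball 0 1 \<subseteq> (hyperbolic_space :: ((real^'n) \<times> real) set)"
  proof
    fix p assume "p \<in> hyperbolic_param ` ball (0 :: real^'n) 1"
    then obtain x where p: "p = hyperbolic_param x" and "x \<in> ball 0 1" by blast
    then have x: "1 - x \<bullet> x > 0" by (simp only: pos)
    have "(1 + x \<bullet> x) / (1 - x \<bullet> x) > 0"
      using x by (simp add: add_pos_nonneg)
    then show "p \<in> hyperbolic_space"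
      unfolding hyperbolic_space_def minkowski_def p using x
      by (simp add: hyperbolic_param_def divide_simps) (simp add: algebra_simps)
  qed
  have inv: "hyperbolic_param ((1 / (1 + t)) *\<^sub>R y) = (y, t)"
            "(1 / (1 + t)) *\<^sub>R y \<in> ball 0 1"
    if "(y, t) \<in> hyperbolic_space" for y :: "real^'n" and t :: real
  proof -
    have yy: "y \<bullet> y = (t - 1) * (1 + t)" and t: "1 + t > 0"
      using that by (auto simp: hyperbolic_space_def minkowski_def algebra_simps)
    have e: "(1 / (1 + t)) *\<^sub>R y \<bullet> (1 / (1 + t)) *\<^sub>R y = (t - 1) / (1 + t)"
      using t by (simp add: yy)
    have s: "1 - (t - 1) / (1 + t) = 2 / (1 + t)"  "1 + (t - 1) / (1 + t) = 2 * t / (1 + t)"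
      using t by (simp_all add: field_simps)
    show "hyperbolic_param ((1 / (1 + t)) *\<^sub>R y) = (y, t)"
      unfolding hyperbolic_param_def e s using t by simp
    show "(1 / (1 + t)) *\<^sub>R y \<in> ball 0 1"
      unfolding pos e s using t by simp
  qed
  show "\<forall>p\<in>hyperbolic_space. hyperbolic_param ((1 / (1 + snd p)) *\<^sub>R fst p) = (p :: (real^'n) \<times> real)"
    using inv(1) by (metis prod.collapse)
  show "(\<lambda>p. (1 / (1 + snd p)) *\<^sub>R fst p) ` hyperbolic_space \<subseteq> ball (0 :: real^'n) 1"
  proof (rule image_subsetI)
    fix p :: "(real^'n) \<times> real" assume "p \<in> hyperbolic_space"
    then have "(fst p, snd p) \<in> hyperbolic_space" by simp
    then show "(1 / (1 + snd p)) *\<^sub>R fst p \<in> ball 0 1" by (rule inv(2))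
  qed
qed

text \<open>The metric pulled back along \<open>F\<close> from the ambient bilinear form \<open>B\<close>.\<close>

definition pullback_metric ::
  "((real^'n::finite) \<times> real \<Rightarrow> (real^'n) \<times> real \<Rightarrow> real) \<Rightarrow> (real^'n \<Rightarrow> (real^'n) \<times> real) \<Rightarrow>
   real^'n \<Rightarrow> real^'n^'n" where
  "pullback_metric B F x =
     (\<chi> i j. B (frechet_derivative F (at x) (axis i 1)) (frechet_derivative F (at x) (axis j 1)))"

lemma sphere_metric:
  "pullback_metric inner sphere_param (x :: real^'n::finite) = mat ((2 / (1 + x \<bullet> x))\<^sup>2)"
proof -
  define s where "s = 1 + x \<bullet> x"
  have s: "s > 0" by (simp add: s_def add_pos_nonneg)
  let ?D = "\<lambda>h :: real^'n. ((2 / s) *\<^sub>R h - (4 * (x \<bullet> h) / s\<^sup>2) *\<^sub>R x, - 4 * (x \<bullet> h) / s\<^sup>2)"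
  have q: "((\<lambda>x. x \<bullet> x) has_derivative (\<lambda>h. 2 * (x \<bullet> h))) (at x)"
    by (rule has_derivative_eq_rhs[OF has_derivative_inner[OF has_derivative_ident has_derivative_ident]])
       (simp add: fun_eq_iff inner_commute)
  have r: "((\<lambda>x. 2 / (1 + x \<bullet> x)) has_derivative (\<lambda>h. - 4 * (x \<bullet> h) / s\<^sup>2)) (at x)"
    using has_derivative_divide'[OF has_derivative_const[of 2]
        has_derivative_add[OF has_derivative_const[of 1] q]] s
    by (simp add: s_def[symmetric] power2_eq_square)
  have t: "((\<lambda>x. (1 - x \<bullet> x) / (1 + x \<bullet> x)) has_derivative (\<lambda>h. - 4 * (x \<bullet> h) / s\<^sup>2)) (at x)"
  proof -
    have "(1 - y \<bullet> y) / (1 + y \<bullet> y) = 2 / (1 + y \<bullet> y) - 1" for y :: "real^'n"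
      using inner_ge_zero[of y] by (simp add: field_simps add_pos_nonneg less_imp_neq[symmetric])
    then show ?thesis
      using has_derivative_diff[OF r has_derivative_const[of 1]] by simp
  qed
  have "(sphere_param has_derivative ?D) (at x)"
    using has_derivative_Pair[OF has_derivative_scaleR[OF r has_derivative_ident] t]
    by (simp add: sphere_param_def[abs_def] s_def[symmetric] algebra_simps)
  then have D: "frechet_derivative sphere_param (at x) = ?D"
    by (rule frechet_derivative_at[symmetric])
  have "?D h \<bullet> ?D k = (2 / s)\<^sup>2 * (h \<bullet> k)" for h k
  proof -
    have xx: "x \<bullet> x = s - 1" by (simp add: s_def)
    show ?thesis
      using s
      by (simp add: inner_diff_left inner_diff_right inner_commute xx divide_simps)
         (simp add: algebra_simps power2_eq_square power4_eq_xxxx inner_commute)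
  qed
  then show ?thesis
    unfolding pullback_metric_def D mat_def s_def[symmetric]
    by (simp add: vec_eq_iff inner_axis_axis)
qed

lemma hyperbolic_metric:
  assumes "(x :: real^'n::finite) \<in> ball 0 1"
  shows "pullback_metric minkowski hyperbolic_param x = mat ((2 / (1 - x \<bullet> x))\<^sup>2)"
proof -
  define s where "s = 1 - x \<bullet> x"
  have s: "s > 0"
    using assms by (simp add: s_def norm_eq_sqrt_inner)
  let ?D = "\<lambda>h :: real^'n. ((2 / s) *\<^sub>R h + (4 * (x \<bullet> h) / s\<^sup>2) *\<^sub>R x, 4 * (x \<bullet> h) / s\<^sup>2)"
  have q: "((\<lambda>x. x \<bullet> x) has_derivative (\<lambda>h. 2 * (x \<bullet> h))) (at x)"
    by (rule has_derivative_eq_rhs[OF has_derivative_inner[OF has_derivative_ident has_derivative_ident]])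
       (simp add: fun_eq_iff inner_commute)
  have r: "((\<lambda>x. 2 / (1 - x \<bullet> x)) has_derivative (\<lambda>h. 4 * (x \<bullet> h) / s\<^sup>2)) (at x)"
    using has_derivative_divide'[OF has_derivative_const[of 2]
        has_derivative_diff[OF has_derivative_const[of 1] q]] s
    by (simp add: s_def[symmetric] power2_eq_square)
  have t: "((\<lambda>x. (1 + x \<bullet> x) / (1 - x \<bullet> x)) has_derivative (\<lambda>h. 4 * (x \<bullet> h) / s\<^sup>2)) (at x)"
  proof -
    have xx: "x \<bullet> x = 1 - s" by (simp add: s_def)
    have "((2 * (x \<bullet> h)) * s - (2 - s) * (0 - 2 * (x \<bullet> h))) / (s * s) = 4 * (x \<bullet> h) / s\<^sup>2" for h
      by (simp add: power2_eq_square algebra_simps)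
    then show ?thesis
      using has_derivative_divide'[OF has_derivative_add[OF has_derivative_const[of 1] q]
          has_derivative_diff[OF has_derivative_const[of 1] q]] s
      by (simp add: xx)
  qed
  have "(hyperbolic_param has_derivative ?D) (at x)"
    using has_derivative_Pair[OF has_derivative_scaleR[OF r has_derivative_ident] t]
    by (simp add: hyperbolic_param_def[abs_def] s_def[symmetric] algebra_simps)
  then have D: "frechet_derivative hyperbolic_param (at x) = ?D"
    by (rule frechet_derivative_at[symmetric])
  have "minkowski (?D h) (?D k) = (2 / s)\<^sup>2 * (h \<bullet> k)" for h k
  proof -
    have xx: "x \<bullet> x = 1 - s" by (simp add: s_def)
    show ?thesis
      unfolding minkowski_def using s
      by (simp add: inner_add_left inner_add_right inner_commute xx divide_simps)
         (simp add: algebra_simps power2_eq_square power4_eq_xxxx inner_commute)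
  qed
  then show ?thesis
    unfolding pullback_metric_def D mat_def s_def[symmetric]
    by (simp add: vec_eq_iff inner_axis_axis)
qed

text \<open>
  The \<open>itself\<close> argument carries the dimension \<open>n = CARD('n)\<close>.
\<close>

definition cap_eigenvalue :: "'n::finite itself \<Rightarrow> nat \<Rightarrow> real \<Rightarrow> real" where
  "cap_eigenvalue _ k \<Theta> =
     (if \<Theta> < 0 then
        dirichlet_eigenvalue (pullback_metric minkowski hyperbolic_param :: real^'n \<Rightarrow> real^'n^'n)
          {x \<in> ball 0 1. hyperbolic_param x \<in> geodesic_cap \<Theta>} k
      else
        dirichlet_eigenvalue (pullback_metric inner sphere_param :: real^'n \<Rightarrow> real^'n^'n)
          {x. sphere_param x \<in> geodesic_cap \<Theta>} k)"

definition ball_eigenvalue :: "'n::finite itself \<Rightarrow> nat \<Rightarrow> real" where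
  "ball_eigenvalue _ k = dirichlet_eigenvalue (\<lambda>x :: real^'n. mat 1) (ball 0 1) k"

definition scaled_eigenvalue :: "'n::finite itself \<Rightarrow> nat \<Rightarrow> real \<Rightarrow> real" where
  "scaled_eigenvalue T k \<Theta> =
     (if \<Theta> < 0 then cap_eigenvalue T k \<Theta> * (sinh \<Theta>)\<^sup>2
      else if \<Theta> = 0 then ball_eigenvalue T k
      else cap_eigenvalue T k \<Theta> * (sin \<Theta>)\<^sup>2)"

end

theory Submission
  imports Defs "HOL-Library.Function_Algebras"
begin

text \<open>
  In stereographic coordinates the ball of aperture \<open>\<Theta>\<close> is a Euclidean ball of radius \<open>R\<close> with the
  conformal factor \<open>2 / (1 + \<kappa> |x|\<^sup>2)\<close>, \<open>\<kappa> = \<plusminus>1\<close>. Rescale to the unit ball, put \<open>a = \<kappa> R\<^sup>2\<close>, and let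
  \<open>\<mu>\<close> be the scaled eigenvalue. Since \<open>(1 + a |y|\<^sup>2)\<^bsup>-(n-2)/2\<^esup>\<close> solves the Yamabe equation, multiplying
  by it turns the eigenvalue equation into \<open>-\<Delta> v = K w\<^sub>a\<^sup>2 v\<close> with \<open>w\<^sub>a = (1 + a) / (1 + a |y|\<^sup>2)\<close> and
  \<open>K = \<mu> + n (n - 2) a / (1 + a)\<^sup>2\<close>. As \<open>w\<^sub>a\<close> increases with \<open>a\<close>, min-max shows that \<open>K\<close> does not
  increase, while \<open>a / (1 + a)\<^sup>2\<close> increases strictly for \<open>a \<le> 1\<close>, i.e. for \<open>\<Theta> \<le> \<pi>/2\<close>; this is where
  \<open>n \<ge> 3\<close> enters. For \<open>\<Theta> \<ge> \<pi>/2\<close> both \<open>sin\<^sup>2 \<Theta>\<close> and, by domain monotonicity, the eigenvalue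
  decrease. The limit at \<open>-\<infinity>\<close> follows from \<open>K \<ge> 0\<close>, the limit at \<open>\<pi>\<close> from \<open>sin\<^sup>2 \<Theta> \<rightarrow> 0\<close>.

  Existence of the spectrum and the min-max principle come from the direct method. The only
  compactness needed is Rellich's theorem in the form: for every \<open>\<epsilon>\<close> finitely many bounded
  functionals \<open>l\<^sub>i\<close> give \<open>\<parallel>\<phi>\<parallel>\<^sup>2 \<le> \<epsilon> E(\<phi>) + \<Sum>\<^sub>i l\<^sub>i(\<phi>)\<^sup>2\<close>.
\<close>

text \<open>Regularity of eigenfunctions is never touched. The eigenvalues of the statement are
  defined by a distributional equation in \<open>sobolev_H10\<close>, whereas the comparison needs
  only Rayleigh quotients of test functions. So min-max is proved in two one-sided forms over test
  functions alone, and the abstract eigenvalues are identified with those of the definition,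
  multiplicities included.

  The origin of \<open>K\<close>: with the factor 2 / (1 + \<kappa> |x|^2), rescaling turns a
  Rayleigh bound L into L (2 R)^2 for the weight (1 + a |y|^2)^-2, shifted by n (n - 2) a, the
  zero-order term left by the multiplication. Since (2 R)^2 is (1 + a)^2 sin^2 \<Theta> (sinh^2 for
  negative \<Theta>), division by (1 + a)^2 produces at once the scaled eigenvalue, the weight
  \<open>w\<^sub>a\<close> normalised to 1 at the boundary, and a shift that is n (n - 2) / 4 times
  sin^2 \<Theta> or - sinh^2 \<Theta>. The three geometries thus become values of one parameter a >
  -1, and the Euclidean ball is the value a = 0, with no limiting argument.\<close>

instantiation "fun" :: (type, real_vector) real_vector
begin
text \<open>Used at two levels: test functions are vectors, and so are the sequences of test
  functions from which the completion is built.\<close>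

definition scaleR_fun :: "real \<Rightarrow> ('a \<Rightarrow> 'b) \<Rightarrow> 'a \<Rightarrow> 'b" where
  "scaleR_fun r f = (\<lambda>x. r *\<^sub>R f x)"
instance
  by standard (auto simp: scaleR_fun_def fun_eq_iff algebra_simps)
end

lemma scaleR_fun_apply [simp]: "(r *\<^sub>R f) x = r *\<^sub>R f x"
  by (simp add: scaleR_fun_def)

lemma sum_fun_apply: "(\<Sum>i\<in>I. f i) x = (\<Sum>i\<in>I. f i x)"
  by (induction I rule: infinite_finite_induct) auto

text \<open>Gaussian elimination for N equations in N + 1 unknowns. It replaces dimension arguments
  wherever a trial space that is one dimension too large must contain a nonzero vector meeting N
  linear conditions.\<close>

lemma homogeneous_system_nontrivial:
  fixes A :: "nat \<Rightarrow> nat \<Rightarrow> real"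
  shows "\<exists>c. (\<exists>i\<le>N. c i \<noteq> 0) \<and> (\<forall>j<N. (\<Sum>i\<le>N. c i * A i j) = 0)"
proof (induction N arbitrary: A)
  case 0
  show ?case by (rule exI[of _ "\<lambda>_. 1"]) auto
next
  case (Suc N)
  show ?case
  proof (cases "\<forall>i\<le>Suc N. A i N = 0")
    \<comment> \<open>Every coefficient of the last equation is zero: solve the others with one
      unknown fewer and set the remaining unknown to 0.\<close>
    case True
    obtain c where c: "\<exists>i\<le>N. c i \<noteq> 0" "\<forall>j<N. (\<Sum>i\<le>N. c i * A i j) = 0"
      using Suc by blast
    let ?c = "\<lambda>i. if i \<le> N then c i else 0"
    have 1: "(\<Sum>i\<le>N. c i * A i j) = 0" if "j < Suc N" for j
    proof (cases "j = N")
      case True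
      then show ?thesis using \<open>\<forall>i\<le>Suc N. A i N = 0\<close> by simp
    next
      case False
      then show ?thesis using c(2) that by simp
    qed
    have 2: "(\<Sum>i\<le>Suc N. ?c i * A i j) = (\<Sum>i\<le>N. c i * A i j)" for j
      by (rule sum.mono_neutral_cong_right) auto
    obtain i where i: "i \<le> N" "c i \<noteq> 0" using c(1) by blast
    show ?thesis
    proof (rule exI[of _ ?c], intro conjI allI impI)
      show "\<exists>i\<le>Suc N. ?c i \<noteq> 0" using i by (intro exI[of _ i]) auto
    qed (unfold 2, rule 1)
  next
    case False
    then obtain p where p: "p \<le> Suc N" "A p N \<noteq> 0" by blast
    \<comment> \<open>\<open>s\<close> lists the indices other than the pivot \<open>p\<close>;
      \<open>B\<close> below is the matrix after elimination of the unknown \<open>p\<close> by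
      means of the last equation, so its column \<open>N\<close> vanishes.\<close>
    define s where "s i = (if i < p then i else Suc i)" for i :: nat
    have img: "s ` {..N} = {..Suc N} - {p}"
    proof
      show "s ` {..N} \<subseteq> {..Suc N} - {p}" by (auto simp: s_def)
      show "{..Suc N} - {p} \<subseteq> s ` {..N}"
      proof
        fix x assume x: "x \<in> {..Suc N} - {p}"
        show "x \<in> s ` {..N}"
        proof (cases "x < p")
          case True then show ?thesis using x p by (intro image_eqI[of _ _ x]) (auto simp: s_def)
        next
          case False then show ?thesis using x by (intro image_eqI[of _ _ "x - 1"]) (auto simp: s_def)
        qed
      qed
    qed
    have inj: "inj_on s {..N}" by (auto simp: inj_on_def s_def split: if_splits)
    define B where "B i j = A (s i) j - A (s i) N / A p N * A p j" for i j
    obtain c where c: "\<exists>i\<le>N. c i \<noteq> 0" "\<forall>j<N. (\<Sum>i\<le>N. c i * B i j) = 0"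
      using Suc by blast
    \<comment> \<open>The last equation, solved for the eliminated unknown, gives it the value
      \<open>- t\<close>.\<close>
    define t where "t = (\<Sum>i\<le>N. c i * (A (s i) N / A p N))"
    define d where "d i = (if i = p then - t else c (the_inv_into {..N} s i))" for i
    have ds: "d (s i) = c i" if "i \<le> N" for i
    proof -
      have "s i \<noteq> p" by (auto simp: s_def)
      then show ?thesis using that by (simp add: d_def the_inv_into_f_f[OF inj])
    qed
    have sum: "(\<Sum>i\<le>Suc N. d i * A i j) = (\<Sum>i\<le>N. c i * B i j)" if "j < Suc N" for j
    proof -
      have "(\<Sum>i\<le>Suc N. d i * A i j) = d p * A p j + (\<Sum>i\<in>{..Suc N} - {p}. d i * A i j)"
        using p by (subst sum.remove[of _ p]) auto
      also have "(\<Sum>i\<in>{..Suc N} - {p}. d i * A i j) = (\<Sum>i\<le>N. d (s i) * A (s i) j)"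
        unfolding img[symmetric] using inj by (subst sum.reindex) auto
      also have "\<dots> = (\<Sum>i\<le>N. c i * A (s i) j)"
        using ds by (intro sum.cong) auto
      also have "d p * A p j + \<dots> = (\<Sum>i\<le>N. c i * B i j)"
        by (simp add: d_def t_def B_def sum_distrib_right right_diff_distrib sum_subtractf mult.assoc)
      finally show ?thesis .
    qed
    have "(\<Sum>i\<le>Suc N. d i * A i j) = 0" if "j < Suc N" for j
    proof (cases "j = N")
      case True then show ?thesis unfolding sum[OF that] using p by (simp add: B_def)
    next
      case False then show ?thesis unfolding sum[OF that] using c that by auto
    qed
    moreover obtain i where "i \<le> N" "c i \<noteq> 0" using c by blast
    then have "s i \<le> Suc N \<and> d (s i) \<noteq> 0" using ds by (auto simp: s_def)
    ultimately show ?thesis by blast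
  qed
qed

text \<open>Bolzano-Weierstrass row by row; earlier limits survive the passage to further
  subsequences.\<close>

lemma bounded_imp_common_convergent_subseq:
  fixes a :: "nat \<Rightarrow> nat \<Rightarrow> real"
  assumes "\<And>i. i < N \<Longrightarrow> bounded (range (a i))"
  shows "\<exists>r :: nat \<Rightarrow> nat. strict_mono r \<and> (\<forall>i<N. convergent (\<lambda>j. a i (r j)))"
  using assms
proof (induction N)
  case 0
  show ?case by (rule exI[of _ id]) (auto simp: strict_mono_def)
next
  case (Suc N)
  then obtain r where r: "strict_mono r" "\<forall>i<N. convergent (\<lambda>j. a i (r j))" by auto
  have "bounded (range (\<lambda>j. a N (r j)))"
    by (rule bounded_subset[OF Suc.prems[of N]]) auto
  then obtain l q where q: "strict_mono q" "((\<lambda>j. a N (r j)) \<circ> q) \<longlonglongrightarrow> l"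
    using bounded_imp_convergent_subsequence by blast
  have "convergent (\<lambda>j. a i ((r \<circ> q) j))" if "i < Suc N" for i
  proof (cases "i = N")
    case True then show ?thesis using q(2) by (auto simp: convergent_def o_def)
  next
    case False
    then have "convergent (\<lambda>j. a i (r j))" using r that by auto
    from convergent_subseq_convergent[OF this q(1)] show ?thesis by (simp add: o_def)
  qed
  then show ?case using strict_mono_o[OF r(1) q(1)] by blast
qed

section \<open>Semi-inner products and their spectral theory\<close>

text \<open>Only positive semidefinite, and only on \<open>V\<close>: functions equal almost
  everywhere, or Cauchy sequences with the same limit, then need not be identified.\<close>

locale semi_inner =
  fixes V :: "'v::real_vector set" and b :: "'v \<Rightarrow> 'v \<Rightarrow> real"
  assumes subsp: "subspace V"
    and sym: "x \<in> V \<Longrightarrow> y \<in> V \<Longrightarrow> b x y = b y x"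
    and add: "x \<in> V \<Longrightarrow> y \<in> V \<Longrightarrow> z \<in> V \<Longrightarrow> b (x + y) z = b x z + b y z"
    and scale: "x \<in> V \<Longrightarrow> z \<in> V \<Longrightarrow> b (r *\<^sub>R x) z = r * b x z"
    and nonneg: "x \<in> V \<Longrightarrow> 0 \<le> b x x"
begin

lemma closed:
  "0 \<in> V" "x \<in> V \<Longrightarrow> y \<in> V \<Longrightarrow> x + y \<in> V" "x \<in> V \<Longrightarrow> y \<in> V \<Longrightarrow> x - y \<in> V"
  "x \<in> V \<Longrightarrow> r *\<^sub>R x \<in> V"
  using subsp by (auto intro: subspace_0 subspace_add subspace_diff subspace_scale)

lemma closed_sum: "(\<And>i. i \<in> I \<Longrightarrow> f i \<in> V) \<Longrightarrow> (\<Sum>i\<in>I. f i) \<in> V"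
  using subsp by (rule subspace_sum)

lemma add_right: "x \<in> V \<Longrightarrow> y \<in> V \<Longrightarrow> z \<in> V \<Longrightarrow> b z (x + y) = b z x + b z y"
  using add[of x y z] sym closed by metis

lemma scale_right: "x \<in> V \<Longrightarrow> z \<in> V \<Longrightarrow> b z (r *\<^sub>R x) = r * b z x"
  using scale[of x z r] sym closed by metis

lemma diff: "x \<in> V \<Longrightarrow> y \<in> V \<Longrightarrow> z \<in> V \<Longrightarrow> b (x - y) z = b x z - b y z"
  using add[of x "(-1) *\<^sub>R y" z] scale[of y z "-1"] closed(4)[of y "-1"] by simp

lemma diff_right: "x \<in> V \<Longrightarrow> y \<in> V \<Longrightarrow> z \<in> V \<Longrightarrow> b z (x - y) = b z x - b z y"
  using diff[of x y z] sym closed by metis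

lemma zero: "z \<in> V \<Longrightarrow> b 0 z = 0" "z \<in> V \<Longrightarrow> b z 0 = 0"
  using scale[of z z 0] scale_right[of z z 0] by auto

lemma sum: "(\<And>i. i \<in> I \<Longrightarrow> f i \<in> V) \<Longrightarrow> z \<in> V \<Longrightarrow> b (\<Sum>i\<in>I. f i) z = (\<Sum>i\<in>I. b (f i) z)"
  by (induction I rule: infinite_finite_induct) (auto simp: zero add closed_sum)

lemma sum_right: "(\<And>i. i \<in> I \<Longrightarrow> f i \<in> V) \<Longrightarrow> z \<in> V \<Longrightarrow> b z (\<Sum>i\<in>I. f i) = (\<Sum>i\<in>I. b z (f i))"
  by (induction I rule: infinite_finite_induct) (auto simp: zero add_right closed_sum)

lemma lincomb: "(\<And>i. i \<in> I \<Longrightarrow> f i \<in> V) \<Longrightarrow> z \<in> V \<Longrightarrow>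
    b (\<Sum>i\<in>I. c i *\<^sub>R f i) z = (\<Sum>i\<in>I. c i * b (f i) z)"
  by (simp add: sum closed scale)

lemma lincomb_quad:
  assumes "\<And>i. i \<in> I \<Longrightarrow> f i \<in> V"
  shows "b (\<Sum>i\<in>I. c i *\<^sub>R f i) (\<Sum>i\<in>I. c i *\<^sub>R f i) = (\<Sum>i\<in>I. \<Sum>j\<in>I. c i * c j * b (f i) (f j))"
  using assms
  by (simp add: lincomb closed closed_sum sum_right scale_right sum_distrib_left mult.assoc)
     (intro sum.cong refl, simp add: sym)

lemma quad_add: "x \<in> V \<Longrightarrow> y \<in> V \<Longrightarrow> b (x + y) (x + y) = b x x + 2 * b x y + b y y"
  by (simp add: add add_right closed sym[of y x])

lemma quad_diff: "x \<in> V \<Longrightarrow> y \<in> V \<Longrightarrow> b (x - y) (x - y) = b x x - 2 * b x y + b y y"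
  by (simp add: diff diff_right closed sym[of y x])

lemma quad_scale: "x \<in> V \<Longrightarrow> b (r *\<^sub>R x) (r *\<^sub>R x) = r\<^sup>2 * b x x"
  by (simp add: scale scale_right closed power2_eq_square)

lemma quad_add_le: "x \<in> V \<Longrightarrow> y \<in> V \<Longrightarrow> b (x + y) (x + y) \<le> 2 * b x x + 2 * b y y"
  using nonneg[of "x - y"] by (simp add: quad_add quad_diff closed)

lemma quad_diff_le: "x \<in> V \<Longrightarrow> y \<in> V \<Longrightarrow> b (x - y) (x - y) \<le> 2 * b x x + 2 * b y y"
  using nonneg[of "x + y"] by (simp add: quad_add quad_diff closed)

lemma quad_diff_commute: "x \<in> V \<Longrightarrow> y \<in> V \<Longrightarrow> b (x - y) (x - y) = b (y - x) (y - x)"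
  by (simp add: quad_diff closed sym[of y x])

lemma Cauchy_Schwarz:
  assumes "x \<in> V" "y \<in> V"
  shows "(b x y)\<^sup>2 \<le> b x x * b y y"
proof -
  have nn: "0 \<le> b x x + 2 * t * b x y + t\<^sup>2 * b y y" for t
    using nonneg[of "x + t *\<^sub>R y"] assms
    by (simp add: quad_add scale closed scale_right power2_eq_square mult.assoc)
  show ?thesis
  proof (cases "b y y = 0")
    case True
    have "b x y = 0"
    proof (rule ccontr)
      assume ne: "b x y \<noteq> 0"
      \<comment> \<open>Without the quadratic term the expression is affine in \<open>t\<close>;
        this choice of \<open>t\<close> gives it the value -1.\<close>
      have "2 * (- (b x x + 1) / (2 * b x y)) * b x y = - (b x x + 1)" using ne by simp
      with nn[of "- (b x x + 1) / (2 * b x y)"] show False unfolding True by linarith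
    qed
    then show ?thesis using True by simp
  next
    case False
    then have pos: "b y y > 0" using nonneg[OF assms(2)] by simp
    have "0 \<le> b x x - (b x y)\<^sup>2 / b y y"
      using nn[of "- b x y / b y y"] pos by (simp add: power2_eq_square field_simps)
    then show ?thesis using pos by (simp add: field_simps)
  qed
qed

lemma null_imp_zero: "x \<in> V \<Longrightarrow> y \<in> V \<Longrightarrow> b x x = 0 \<Longrightarrow> b x y = 0"
  using Cauchy_Schwarz[of x y] by simp

lemma tendsto_left:
  assumes "\<And>j. s j \<in> V" "x \<in> V" "y \<in> V" "(\<lambda>j. b (s j - x) (s j - x)) \<longlonglongrightarrow> 0"
  shows "(\<lambda>j. b (s j) y) \<longlonglongrightarrow> b x y"
proof -
  have "(\<lambda>j. b (s j - x) (s j - x) * b y y) \<longlonglongrightarrow> 0"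
    using tendsto_mult_right[OF assms(4), of "b y y"] by simp
  then have "(\<lambda>j. (b (s j - x) y)\<^sup>2) \<longlonglongrightarrow> 0"
    by (rule real_tendsto_sandwich[OF _ _ tendsto_const, rotated 2])
       (auto simp: Cauchy_Schwarz closed assms)
  then have "(\<lambda>j. b (s j - x) y) \<longlonglongrightarrow> 0" by (simp add: power_tendsto_0_iff)
  then show ?thesis using assms by (simp add: diff LIM_zero_cancel)
qed

lemma tendsto_quad:
  assumes "\<And>j. s j \<in> V" "x \<in> V" "(\<lambda>j. b (s j - x) (s j - x)) \<longlonglongrightarrow> 0"
  shows "(\<lambda>j. b (s j) (s j)) \<longlonglongrightarrow> b x x"
proof -
  have "b (s j) (s j) = b (s j - x) (s j - x) + 2 * b (s j) x - b x x" for j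
    using assms by (simp add: quad_diff)
  then show ?thesis
    using tendsto_diff[OF tendsto_add[OF assms(3) tendsto_mult_left[OF tendsto_left[OF assms(1,2,2,3)], of 2]]
        tendsto_const[of "b x x"]] by simp
qed

end

text \<open>What test functions offer before completion: \<open>low\<close> is the Poincare bound
  and \<open>compact\<close> the Rellich inequality. The functionals are bounded in energy, so they
  stay bounded along minimising sequences and extend to limits. \<open>infinite_dim\<close> prevents
  the sequence of eigenvalues from ending.\<close>

locale pre_form =
  m: semi_inner V m + e: semi_inner V e for V :: "'v::real_vector set" and m e +
  fixes low :: real
  assumes low_pos: "low > 0"
    and low: "x \<in> V \<Longrightarrow> low * m x x \<le> e x x"
    and compact: "\<epsilon> > 0 \<Longrightarrow> \<exists>N (l :: nat \<Rightarrow> 'v \<Rightarrow> real) K.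
      (\<forall>i. \<forall>x\<in>V. (l i x)\<^sup>2 \<le> K * e x x) \<and>
      (\<forall>i. \<forall>x\<in>V. \<forall>y\<in>V. l i (x + y) = l i x + l i y) \<and>
      (\<forall>i. \<forall>x\<in>V. \<forall>r. l i (r *\<^sub>R x) = r * l i x) \<and>
      (\<forall>x\<in>V. m x x \<le> \<epsilon> * e x x + (\<Sum>i<N. (l i x)\<^sup>2))"
    and infinite_dim: "\<exists>f :: nat \<Rightarrow> 'v. (\<forall>i. f i \<in> V) \<and>
      (\<forall>i j. i \<noteq> j \<longrightarrow> m (f i) (f j) = 0) \<and> (\<forall>i. m (f i) (f i) > 0)"
begin

lemma m_le: "x \<in> V \<Longrightarrow> m x x \<le> e x x / low"
  using low[of x] low_pos by (simp add: field_simps)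

lemma m_tendsto_0:
  assumes "\<And>j. s j \<in> V" "(\<lambda>j. e (s j) (s j)) \<longlonglongrightarrow> 0"
  shows "(\<lambda>j. m (s j) (s j)) \<longlonglongrightarrow> 0"
proof -
  have "(\<lambda>j. e (s j) (s j) / low) \<longlonglongrightarrow> 0"
    using tendsto_divide[OF assms(2) tendsto_const[of low]] low_pos by simp
  then show ?thesis
    by (rule tendsto_sandwich[OF _ _ tendsto_const, rotated 2]) (auto simp: m_le assms m.nonneg)
qed

definition ortho :: "'v set \<Rightarrow> 'v set" where
  "ortho U = {v \<in> V. \<forall>z\<in>U. m v z = 0}"

lemma orthoD: "v \<in> ortho U \<Longrightarrow> v \<in> V" "v \<in> ortho U \<Longrightarrow> z \<in> U \<Longrightarrow> m v z = 0"
  by (auto simp: ortho_def)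

lemma subspace_ortho: "U \<subseteq> V \<Longrightarrow> subspace (ortho U)"
  unfolding subspace_def ortho_def by (auto simp: m.zero m.add m.scale m.closed subset_iff)

text \<open>One vector more than there are constraints, drawn from the orthogonal system of
  \<open>infinite_dim\<close>; this keeps the set of competitors nonempty at every stage of the
  minimisation.\<close>

lemma ortho_nontrivial:
  assumes "finite U" "U \<subseteq> V"
  shows "\<exists>v\<in>ortho U. m v v = 1"
proof -
  obtain f :: "nat \<Rightarrow> 'v" where f: "\<And>i. f i \<in> V" "\<And>i j. i \<noteq> j \<Longrightarrow> m (f i) (f j) = 0"
    "\<And>i. m (f i) (f i) > 0"
    using infinite_dim by blast
  obtain g where g: "bij_betw g {..<card U} U"
    using ex_bij_betw_nat_finite[OF assms(1)] by (auto simp: atLeast0LessThan)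
  obtain c where c: "\<exists>i\<le>card U. c i \<noteq> 0" "\<forall>j<card U. (\<Sum>i\<le>card U. c i * m (f i) (g j)) = 0"
    using homogeneous_system_nontrivial[of "card U" "\<lambda>i j. m (f i) (g j)"] by blast
  define v where "v = (\<Sum>i\<le>card U. c i *\<^sub>R f i)"
  have v: "v \<in> V" unfolding v_def by (intro m.closed_sum m.closed f)
  have "m v z = 0" if "z \<in> U" for z
  proof -
    have "z \<in> g ` {..<card U}" using g that by (simp add: bij_betw_def)
    then obtain j where j: "j < card U" "z = g j" by blast
    then show ?thesis unfolding v_def using that assms c f by (subst m.lincomb) auto
  qed
  then have vo: "v \<in> ortho U" using v by (simp add: ortho_def)
  have "m v v = (\<Sum>i\<le>card U. \<Sum>j\<le>card U. c i * c j * m (f i) (f j))"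
    unfolding v_def using f by (simp add: m.lincomb_quad)
  also have "\<dots> = (\<Sum>i\<le>card U. \<Sum>j\<le>card U. if i = j then c i * c j * m (f i) (f j) else 0)"
    by (intro sum.cong refl) (auto simp: f)
  also have "\<dots> = (\<Sum>i\<le>card U. c i * c i * m (f i) (f i))"
    by simp
  also obtain i where i: "i \<le> card U" "c i \<noteq> 0" using c by blast
  have "0 < c i * c i" using i(2) by (simp add: zero_less_mult_iff) linarith
  then have "0 < c i * c i * m (f i) (f i)" using f(3) by (rule mult_pos_pos)
  then have "0 < (\<Sum>i\<le>card U. c i * c i * m (f i) (f i))"
    using i f(3) by (intro sum_pos2[of _ i]) (auto simp: less_imp_le)
  finally have pos: "m v v > 0" .
  have "(1 / sqrt (m v v)) *\<^sub>R v \<in> ortho U"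
    using subspace_ortho[OF assms(2)] vo by (rule subspace_scale)
  moreover have "m ((1 / sqrt (m v v)) *\<^sub>R v) ((1 / sqrt (m v v)) *\<^sub>R v) = 1"
    using pos v by (simp add: m.quad_scale power_divide)
  ultimately show ?thesis by blast
qed

end

text \<open>Completeness is meant in the energy seminorm: limits exist but need not be
  unique.\<close>

locale spectral_form = pre_form V m e low for V :: "'v::real_vector set" and m e low +
  assumes complete: "(\<And>j. s j \<in> V) \<Longrightarrow>
      (\<And>\<epsilon>. \<epsilon> > 0 \<Longrightarrow> \<exists>J. \<forall>i\<ge>J. \<forall>j\<ge>J. e (s i - s j) (s i - s j) < \<epsilon>) \<Longrightarrow>
      \<exists>x\<in>V. (\<lambda>j. e (s j - x) (s j - x)) \<longlonglongrightarrow> 0"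
begin

text \<open>The parallelogram law makes a minimising sequence \<open>e\<close>-Cauchy up to finitely many
  functionals, which are handled by passing to a subsequence.\<close>

lemma ex_minimizer:
  assumes "finite U" "U \<subseteq> V"
  shows "\<exists>u\<in>ortho U. m u u = 1 \<and> (\<forall>v\<in>ortho U. e u u * m v v \<le> e v v)"
proof -
  let ?W = "ortho U"
  have sW: "subspace ?W" using assms(2) by (rule subspace_ortho)
  have WV: "v \<in> V" if "v \<in> ?W" for v using that by (rule orthoD)
  define Q where "Q = {e v v | v. v \<in> ?W \<and> m v v = 1}"
  define l where "l = Inf Q"
  have ne: "Q \<noteq> {}" using ortho_nontrivial[OF assms] by (auto simp: Q_def)
  have bdd: "bdd_below Q" by (rule bdd_belowI[of _ 0]) (auto simp: Q_def e.nonneg WV)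
  have l0: "l \<ge> 0" unfolding l_def using ne by (intro cInf_greatest) (auto simp: Q_def e.nonneg WV)
  have le: "l * m v v \<le> e v v" if "v \<in> ?W" for v
  proof (cases "m v v = 0")
    case True then show ?thesis using e.nonneg[OF WV[OF that]] by simp
  next
    case False
    then have pos: "m v v > 0" using m.nonneg[OF WV[OF that]] by simp
    let ?v = "(1 / sqrt (m v v)) *\<^sub>R v"
    have "?v \<in> ?W" using sW that by (rule subspace_scale)
    moreover have "m ?v ?v = 1" using pos WV[OF that] by (simp add: m.quad_scale power_divide)
    ultimately have "e ?v ?v \<in> Q" by (auto simp: Q_def)
    then have "l \<le> e ?v ?v" unfolding l_def using bdd by (rule cInf_lower)
    also have "e ?v ?v = e v v / m v v" using pos WV[OF that] by (simp add: e.quad_scale power_divide)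
    finally show ?thesis using pos by (simp add: field_simps)
  qed
  have "\<exists>v. v \<in> ?W \<and> m v v = 1 \<and> e v v < l + inverse (real (Suc j))" for j
  proof -
    have "l < l + inverse (real (Suc j))" by simp
    then obtain q where "q \<in> Q" "q < l + inverse (real (Suc j))"
      unfolding l_def using cInf_lessD[OF ne] by blast
    then show ?thesis by (auto simp: Q_def)
  qed
  then obtain v where v: "\<And>j. v j \<in> ?W" "\<And>j. m (v j) (v j) = 1"
    "\<And>j. e (v j) (v j) < l + inverse (real (Suc j))" by metis
  have vV: "v j \<in> V" for j using v WV by blast
  \<comment> \<open>With \<open>eps * l \<le> 1/2\<close> the energy part of the compactness bound,
    multiplied by the infimum \<open>l\<close>, can be absorbed into half of the energy of
    \<open>s i - s j\<close>.\<close>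
  define eps where "eps = 1 / (2 * (l + 1))"
  have eps: "eps > 0" "eps * l \<le> 1/2" using l0 by (auto simp: eps_def field_simps)
  obtain N L K where L: "\<And>i x. x \<in> V \<Longrightarrow> (L i x)\<^sup>2 \<le> K * e x x"
    "\<And>i x y. x \<in> V \<Longrightarrow> y \<in> V \<Longrightarrow> L i (x + y) = L i x + L i y"
    "\<And>i x r. x \<in> V \<Longrightarrow> L i (r *\<^sub>R x) = r * L i x"
    "\<And>x. x \<in> V \<Longrightarrow> m x x \<le> eps * e x x + (\<Sum>i<(N::nat). (L (i::nat) x)\<^sup>2)"
    using compact[OF eps(1)] by metis
  have Ldiff: "L i (x - y) = L i x - L i y" if "x \<in> V" "y \<in> V" for i x y
    using L(2)[of x "(-1) *\<^sub>R y" i] L(3)[of y i "-1"] that m.closed(4)[of y "-1"] by simp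
  have "bounded (range (\<lambda>j. L i (v j)))" for i
  proof -
    have "\<bar>L i (v j)\<bar> \<le> sqrt (\<bar>K\<bar> * (l + 1))" for j
    proof -
      have "(L i (v j))\<^sup>2 \<le> K * e (v j) (v j)" using L(1) vV by blast
      also have "\<dots> \<le> \<bar>K\<bar> * e (v j) (v j)"
        using e.nonneg[OF vV[of j]] by (intro mult_right_mono) auto
      also have "\<dots> \<le> \<bar>K\<bar> * (l + 1)"
      proof (rule mult_left_mono)
        have "inverse (real (Suc j)) \<le> 1" by (simp add: field_simps)
        then show "e (v j) (v j) \<le> l + 1" using v(3)[of j] by linarith
      qed simp
      finally show ?thesis by (simp add: real_le_rsqrt)
    qed
    then show ?thesis by (auto simp: bounded_iff)
  qed
  then obtain r where r: "strict_mono r" "\<forall>i<N. convergent (\<lambda>j. L i (v (r j)))"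
    using bounded_imp_common_convergent_subseq[of N "\<lambda>i j. L i (v j)"] by auto
  define s where "s j = v (r j)" for j
  have sV: "s j \<in> V" and sWj: "s j \<in> ?W" for j using vV v by (auto simp: s_def)
  have sm: "m (s j) (s j) = 1" for j by (simp add: s_def v)
  have se: "e (s j) (s j) \<le> l + inverse (real (Suc j))" for j
  proof -
    have "j \<le> r j" using r(1) by (rule seq_suble)
    then have "inverse (real (Suc (r j))) \<le> inverse (real (Suc j))" by (simp add: field_simps)
    then show ?thesis unfolding s_def using v(3)[of "r j"] by linarith
  qed
  have key: "e (s i - s j) (s i - s j) \<le>
      4 * (inverse (real (Suc i)) + inverse (real (Suc j))) + 2 * l * (\<Sum>k<N. (L k (s i) - L k (s j))\<^sup>2)" for i j
  proof -
    let ?d = "e (s i - s j) (s i - s j)"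
    have mem: "s i - s j \<in> V" "s i + s j \<in> ?W" using m.closed sV subspace_add[OF sW] sWj by auto
    \<comment> \<open>Parallelogram law. The sum \<open>s i + s j\<close> is still orthogonal to
      \<open>U\<close>, so \<open>l\<close> bounds its energy from below; both vectors have unit
      mass, so the mass of the sum is 4 minus the mass of the difference.\<close>
    have "?d = 2 * e (s i) (s i) + 2 * e (s j) (s j) - e (s i + s j) (s i + s j)"
      using sV by (simp add: e.quad_add e.quad_diff)
    also have "\<dots> \<le> 2 * (l + inverse (real (Suc i))) + 2 * (l + inverse (real (Suc j)))
         - l * m (s i + s j) (s i + s j)"
    proof -
      have gen: "a \<le> l + p \<Longrightarrow> b \<le> l + q \<Longrightarrow> c \<le> d \<Longrightarrow>
          2 * a + 2 * b - d \<le> 2 * (l + p) + 2 * (l + q) - c" for a b c d p q :: real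
        by argo
      show ?thesis by (rule gen[OF se se le[OF mem(2)]])
    qed
    also have "m (s i + s j) (s i + s j) = 4 - m (s i - s j) (s i - s j)"
      using sV by (simp add: m.quad_add m.quad_diff sm)
    finally have 1: "?d \<le> 2 * (inverse (real (Suc i)) + inverse (real (Suc j))) + l * m (s i - s j) (s i - s j)"
      by (simp add: algebra_simps)
    have "l * m (s i - s j) (s i - s j) \<le> l * (eps * ?d + (\<Sum>k<N. (L k (s i - s j))\<^sup>2))"
      using l0 L(4)[OF mem(1)] by (intro mult_left_mono) auto
    also have "\<dots> = (eps * l) * ?d + l * (\<Sum>k<N. (L k (s i) - L k (s j))\<^sup>2)"
      using sV by (simp add: Ldiff algebra_simps)
    also have "(eps * l) * ?d \<le> 1/2 * ?d"
      using eps(2) e.nonneg[OF mem(1)] by (rule mult_right_mono)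
    finally show ?thesis using 1 by linarith
  qed
  have cauchy: "\<exists>J. \<forall>i\<ge>J. \<forall>j\<ge>J. e (s i - s j) (s i - s j) < \<epsilon>" if "\<epsilon> > 0" for \<epsilon>
  proof -
    \<comment> \<open>The \<open>N\<close> functional terms, each at most \<eta>, cost at most
      \<epsilon>/2; the two inverse indices, each below \<epsilon>/16 and weighted by 4, cost the
      other half.\<close>
    define \<eta> where "\<eta> = \<epsilon> / (4 * (l * real N + 1))"
    have pos: "l * real N + 1 > 0" using l0 by (simp add: add_nonneg_pos)
    then have eta: "\<eta> > 0" using that by (simp add: \<eta>_def)
    have "\<exists>J. \<forall>k<N. \<forall>i\<ge>J. \<forall>j\<ge>J. (L k (s i) - L k (s j))\<^sup>2 \<le> \<eta>"
    proof -
      have "\<exists>J. \<forall>i\<ge>J. \<forall>j\<ge>J. (L k (s i) - L k (s j))\<^sup>2 \<le> \<eta>" if k: "k < N" for k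
      proof -
        have "Cauchy (\<lambda>j. L k (s j))" using r(2) k by (simp add: s_def convergent_Cauchy)
        then obtain J where J: "\<forall>i\<ge>J. \<forall>j\<ge>J. norm (L k (s i) - L k (s j)) < sqrt \<eta>"
          using eta unfolding Cauchy_iff by (meson real_sqrt_gt_0_iff)
        have "(L k (s i) - L k (s j))\<^sup>2 \<le> \<eta>" if "i \<ge> J" "j \<ge> J" for i j
        proof -
          have "\<bar>L k (s i) - L k (s j)\<bar>\<^sup>2 \<le> (sqrt \<eta>)\<^sup>2"
            using J that by (intro power_mono) (auto simp: less_imp_le)
          then show ?thesis using eta by simp
        qed
        then show ?thesis by blast
      qed
      then obtain J where J: "\<And>k i j. k < N \<Longrightarrow> i \<ge> J k \<Longrightarrow> j \<ge> J k \<Longrightarrow> (L k (s i) - L k (s j))\<^sup>2 \<le> \<eta>" by metis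
      have "J k \<le> (\<Sum>k<N. J k)" if "k < N" for k
        using that by (intro member_le_sum) auto
      then show ?thesis using J by (intro exI[of _ "\<Sum>k<N. J k"]) (meson le_trans)
    qed
    then obtain J where J: "\<And>k i j. k < N \<Longrightarrow> i \<ge> J \<Longrightarrow> j \<ge> J \<Longrightarrow> (L k (s i) - L k (s j))\<^sup>2 \<le> \<eta>" by blast
    have "0 < \<epsilon> / 16" using that by simp
    then obtain J' where J': "inverse (real (Suc J')) < \<epsilon> / 16"
      using reals_Archimedean[of "\<epsilon>/16"] by blast
    have "e (s i - s j) (s i - s j) < \<epsilon>" if ij: "i \<ge> max J J'" "j \<ge> max J J'" for i j
    proof -
      have inv: "inverse (real (Suc i)) < \<epsilon> / 16" if "i \<ge> J'" for i
      proof -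
        have "inverse (real (Suc i)) \<le> inverse (real (Suc J'))" using that by (simp add: field_simps)
        then show ?thesis using J' by linarith
      qed
      have "(\<Sum>k<N. (L k (s i) - L k (s j))\<^sup>2) \<le> (\<Sum>k<N. \<eta>)"
        using J ij by (intro sum_mono) auto
      then have "2 * l * (\<Sum>k<N. (L k (s i) - L k (s j))\<^sup>2) \<le> 2 * l * (real N * \<eta>)"
        using l0 by (intro mult_left_mono) auto
      also have "\<dots> \<le> \<epsilon> / 2"
        using pos that l0 \<open>\<epsilon> > 0\<close> by (simp add: \<eta>_def field_simps)
      finally show ?thesis using key[of i j] inv[of i] inv[of j] ij that \<open>\<epsilon> > 0\<close> by simp
    qed
    then show ?thesis by blast
  qed
  obtain x where x: "x \<in> V" "(\<lambda>j. e (s j - x) (s j - x)) \<longlonglongrightarrow> 0"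
    using complete[OF sV cauchy] by blast
  have mx: "(\<lambda>j. m (s j - x) (s j - x)) \<longlonglongrightarrow> 0"
    using m_tendsto_0[of "\<lambda>j. s j - x"] x sV m.closed by auto
  have "m x z = 0" if "z \<in> U" for z
  proof -
    have "(\<lambda>j. m (s j) z) \<longlonglongrightarrow> m x z" using m.tendsto_left[OF sV x(1) _ mx] that assms by blast
    moreover have "(\<lambda>j. m (s j) z) = (\<lambda>_. 0)" using orthoD(2)[OF sWj that] by blast
    ultimately show ?thesis by (simp add: LIMSEQ_const_iff)
  qed
  then have xW: "x \<in> ?W" using x by (simp add: ortho_def)
  have x1: "m x x = 1"
    using m.tendsto_quad[OF sV x(1) mx] by (simp add: sm LIMSEQ_const_iff)
  have "e x x \<le> l + 0"
  proof (rule LIMSEQ_le)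
    show "(\<lambda>j. e (s j) (s j)) \<longlonglongrightarrow> e x x" using e.tendsto_quad[OF sV x] .
    show "(\<lambda>j. l + inverse (real (Suc j))) \<longlonglongrightarrow> l + 0"
      by (intro tendsto_intros LIMSEQ_inverse_real_of_nat)
  qed (use se in auto)
  then have "e x x = l" using le[OF xW] x1 by simp
  then show ?thesis using xW x1 le by auto
qed

definition next_vec :: "'v set \<Rightarrow> 'v" where
  "next_vec U = (SOME u. u \<in> ortho U \<and> m u u = 1 \<and> (\<forall>v\<in>ortho U. e u u * m v v \<le> e v v))"

text \<open>A new minimiser depends on all earlier ones, so the recursion carries the set of vectors
  already chosen.\<close>

primrec basis_upto :: "nat \<Rightarrow> 'v set" where
  "basis_upto 0 = {}"
| "basis_upto (Suc k) = insert (next_vec (basis_upto k)) (basis_upto k)"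

definition eigvec :: "nat \<Rightarrow> 'v" where "eigvec k = next_vec (basis_upto k)"

definition eigval :: "nat \<Rightarrow> real" where "eigval k = e (eigvec k) (eigvec k)"

lemma basis_upto_eq: "basis_upto k = eigvec ` {..<k}"
  by (induction k) (auto simp: eigvec_def lessThan_Suc)

text \<open>Strong induction, because the choice at \<open>k\<close> is known to pick a minimiser
  only once all earlier vectors are known to lie in \<open>V\<close>.\<close>

lemma eigvec_props:
  "eigvec k \<in> ortho (eigvec ` {..<k}) \<and> m (eigvec k) (eigvec k) = 1 \<and>
   (\<forall>v\<in>ortho (eigvec ` {..<k}). eigval k * m v v \<le> e v v)"
proof (induction k rule: less_induct)
  case (less k)
  have "eigvec ` {..<k} \<subseteq> V" using less orthoD(1) by blast
  then have "\<exists>u. u \<in> ortho (eigvec ` {..<k}) \<and> m u u = 1 \<and>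
      (\<forall>v\<in>ortho (eigvec ` {..<k}). e u u * m v v \<le> e v v)"
    using ex_minimizer[of "eigvec ` {..<k}"] by blast
  from someI_ex[OF this] show ?case
    unfolding eigval_def by (simp add: eigvec_def[of k] basis_upto_eq next_vec_def)
qed

lemma eigvec_V [simp]: "eigvec k \<in> V"
  using eigvec_props orthoD(1) by blast

lemma eigvec_orthonormal: "m (eigvec i) (eigvec j) = (if i = j then 1 else 0)"
proof -
  have *: "m (eigvec i) (eigvec j) = 0" if "j < i" for i j
    using eigvec_props[of i] orthoD(2)[of "eigvec i" _ "eigvec j"] that by blast
  show ?thesis
    using *[of i j] *[of j i] eigvec_props[of i] m.sym[of "eigvec i" "eigvec j"]
    by (cases i j rule: linorder_cases) auto
qed

lemma eigval_minimal:
  assumes "v \<in> V" "\<And>i. i < k \<Longrightarrow> m v (eigvec i) = 0"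
  shows "eigval k * m v v \<le> e v v"
  using eigvec_props[of k] assms by (auto simp: ortho_def)

lemma eigval_mono: "mono eigval"
proof (rule monoI)
  fix i j :: nat assume "i \<le> j"
  then have "eigval i * m (eigvec j) (eigvec j) \<le> e (eigvec j) (eigvec j)"
    by (intro eigval_minimal) (auto simp: eigvec_orthonormal)
  then show "eigval i \<le> eigval j" by (simp add: eigvec_orthonormal eigval_def)
qed

lemma eigval_low: "low \<le> eigval k"
  using low[of "eigvec k"] by (simp add: eigvec_orthonormal eigval_def)

text \<open>The Euler-Lagrange equation without differentiation: on the orthogonal complement of the
  earlier eigenvectors, \<open>e - eigval k * m\<close> is a semi-inner product by minimality and
  its quadratic form vanishes at \<open>eigvec k\<close>, so by Cauchy-Schwarz
  \<open>eigvec k\<close> is in its kernel. The earlier eigenvectors are handled by induction and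
  symmetry.\<close>

lemma eigvec_weak: "w \<in> V \<Longrightarrow> e (eigvec k) w = eigval k * m (eigvec k) w"
proof (induction k arbitrary: w rule: less_induct)
  case (less k)
  let ?W = "ortho (eigvec ` {..<k})"
  have UV: "eigvec ` {..<k} \<subseteq> V" by auto
  have WV: "v \<in> V" if "v \<in> ?W" for v using that by (rule orthoD)
  interpret d: semi_inner ?W "\<lambda>x y. e x y - eigval k * m x y"
    by standard
       (auto simp: subspace_ortho[OF UV] WV e.add m.add e.scale m.scale right_diff_distrib distrib_left mult.left_commute
          e.sym m.sym eigvec_props mult.commute[of _ "eigval k"] intro!: eigval_minimal dest: orthoD(2))
  have uW: "eigvec k \<in> ?W" using eigvec_props by blast
  \<comment> \<open>Removes from the test vector its components along the earlier
    eigenvectors.\<close>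
  define w' where "w' = w - (\<Sum>i<k. m w (eigvec i) *\<^sub>R eigvec i)"
  have sV: "(\<Sum>i<k. m w (eigvec i) *\<^sub>R eigvec i) \<in> V" by (intro m.closed_sum m.closed) auto
  have w'V: "w' \<in> V" unfolding w'_def by (intro m.closed sV less.prems)
  have "m w' (eigvec j) = 0" if "j < k" for j
  proof -
    have "m (\<Sum>i<k. m w (eigvec i) *\<^sub>R eigvec i) (eigvec j) = (\<Sum>i<k. m w (eigvec i) * m (eigvec i) (eigvec j))"
      by (rule m.lincomb) auto
    also have "\<dots> = (\<Sum>i<k. if i = j then m w (eigvec i) else 0)"
      by (intro sum.cong) (auto simp: eigvec_orthonormal)
    also have "\<dots> = m w (eigvec j)" using that by simp
    finally show ?thesis using less.prems sV by (simp add: w'_def m.diff)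
  qed
  then have w'W: "w' \<in> ?W" using w'V by (auto simp: ortho_def)
  have "e (eigvec k) w' - eigval k * m (eigvec k) w' = 0"
    using d.null_imp_zero[OF uW w'W] by (simp add: eigval_def eigvec_orthonormal)
  moreover have "e (eigvec k) (\<Sum>i<k. m w (eigvec i) *\<^sub>R eigvec i) = 0"
  proof -
    have "e (eigvec k) (eigvec i) = 0" if "i < k" for i
      using less.IH[OF that, of "eigvec k"] that e.sym[of "eigvec k" "eigvec i"]
      by (simp add: eigvec_orthonormal)
    then show ?thesis by (simp add: e.sum_right e.scale_right m.closed)
  qed
  moreover have "m (eigvec k) (\<Sum>i<k. m w (eigvec i) *\<^sub>R eigvec i) = 0"
    by (simp add: m.sum_right m.scale_right m.closed eigvec_orthonormal)
  ultimately show ?case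
    using sV less.prems by (simp add: w'_def e.diff_right m.diff_right)
qed

lemma quad_eigvec_sum:
  "m (\<Sum>i\<in>I. c i *\<^sub>R eigvec i) (\<Sum>i\<in>I. c i *\<^sub>R eigvec i) = (\<Sum>i\<in>I. (c i)\<^sup>2)" (is ?m)
  "e (\<Sum>i\<in>I. c i *\<^sub>R eigvec i) (\<Sum>i\<in>I. c i *\<^sub>R eigvec i) = (\<Sum>i\<in>I. eigval i * (c i)\<^sup>2)" (is ?e)
  if "finite I" for I :: "nat set"
  using that
  by (simp_all add: m.lincomb_quad e.lincomb_quad eigvec_weak eigvec_orthonormal power2_eq_square
      if_distrib[of "\<lambda>x. _ * x"] mult_ac cong: if_cong)

text \<open>If all eigenvalues were at most B, compactness with \<epsilon> = 1 / (2 B) would leave N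
  functionals; they vanish on some nonzero combination of N + 1 eigenvectors, whose mass would then
  be at most half of itself.\<close>

lemma eigval_unbounded: "\<exists>i. B < eigval i"
proof (rule ccontr)
  assume "\<not> ?thesis"
  then have B: "eigval i \<le> B" for i by (simp add: not_less)
  have B0: "B > 0" using B[of 0] eigval_low[of 0] low_pos by linarith
  have "1 / (2 * B) > 0" using B0 by simp
  from compact[OF this] obtain N L K where L: "\<And>i x y. x \<in> V \<Longrightarrow> y \<in> V \<Longrightarrow> L i (x + y) = L i x + L i y"
    "\<And>i x r. x \<in> V \<Longrightarrow> L i (r *\<^sub>R x) = r * L i x"
    "\<And>x. x \<in> V \<Longrightarrow> m x x \<le> 1 / (2 * B) * e x x + (\<Sum>i<(N::nat). (L (i::nat) x)\<^sup>2)"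
    by metis
  have Lsum: "L j (\<Sum>i\<in>I. c i *\<^sub>R eigvec i) = (\<Sum>i\<in>I. c i * L j (eigvec i))" if "finite I" for I c j
    using that
  proof (induction I rule: finite_induct)
    case empty
    show ?case using L(2)[of 0 j 0] m.closed by simp
  next
    case (insert i I)
    then show ?case using L by (simp add: m.closed m.closed_sum)
  qed
  obtain c where c: "\<exists>i\<le>N. c i \<noteq> 0" "\<forall>j<N. (\<Sum>i\<le>N. c i * L j (eigvec i)) = 0"
    using homogeneous_system_nontrivial[of N "\<lambda>i j. L j (eigvec i)"] by blast
  define v where "v = (\<Sum>i\<le>N. c i *\<^sub>R eigvec i)"
  have v: "v \<in> V" unfolding v_def by (intro m.closed_sum m.closed) auto
  have "m v v \<le> 1 / (2 * B) * e v v"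
    using L(3)[OF v] c(2) by (simp add: v_def Lsum)
  also have "e v v \<le> B * m v v"
    using B unfolding v_def by (auto simp: quad_eigvec_sum sum_distrib_left intro!: sum_mono mult_right_mono)
  finally have "m v v \<le> m v v / 2" using B0 by (simp add: field_simps)
  moreover obtain i where "i \<le> N" "c i \<noteq> 0" using c by blast
  then have "0 < (\<Sum>i\<le>N. (c i)\<^sup>2)" by (intro sum_pos2[of _ i]) auto
  then have "m v v > 0" unfolding v_def by (simp add: quad_eigvec_sum)
  ultimately show False by simp
qed

lemma finite_eigval: "finite {j. eigval j = \<mu>}"
proof -
  obtain i where i: "\<mu> < eigval i" using eigval_unbounded by blast
  have "{j. eigval j = \<mu>} \<subseteq> {..<i}"
  proof (rule subsetI)
    fix j assume "j \<in> {j. eigval j = \<mu>}"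
    then have "eigval j < eigval i" using i by simp
    then show "j \<in> {..<i}" using monoD[OF eigval_mono, of i j] by (cases "i \<le> j") auto
  qed
  then show ?thesis using finite_subset by blast
qed

text \<open>Bounds the multiplicity from above. A combination orthogonal to the listed eigenvectors
  for \<mu> is orthogonal to all the others too, since weak eigenvectors for different eigenvalues
  are orthogonal; minimality at an eigenvalue above \<mu> then leaves it no mass. Zero mass is the
  right conclusion, as \<open>m\<close> may be degenerate.\<close>

lemma eigenspace_dim_le:
  assumes w: "\<And>i. i \<le> card {j. eigval j = \<mu>} \<Longrightarrow> w i \<in> V"
    and eq: "\<And>i z. i \<le> card {j. eigval j = \<mu>} \<Longrightarrow> z \<in> V \<Longrightarrow> e (w i) z = \<mu> * m (w i) z"
  shows "\<exists>c. (\<exists>i\<le>card {j. eigval j = \<mu>}. c i \<noteq> 0) \<and>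
     m (\<Sum>i\<le>card {j. eigval j = \<mu>}. c i *\<^sub>R w i) (\<Sum>i\<le>card {j. eigval j = \<mu>}. c i *\<^sub>R w i) = 0"
proof -
  let ?J = "{j. eigval j = \<mu>}"
  let ?n = "card ?J"
  obtain g where g: "bij_betw g {..<?n} ?J"
    using ex_bij_betw_nat_finite[OF finite_eigval[of \<mu>]] by (auto simp: atLeast0LessThan)
  obtain c where c: "\<exists>i\<le>?n. c i \<noteq> 0" "\<forall>j<?n. (\<Sum>i\<le>?n. c i * m (w i) (eigvec (g j))) = 0"
    using homogeneous_system_nontrivial[of ?n "\<lambda>i j. m (w i) (eigvec (g j))"] by blast
  define v where "v = (\<Sum>i\<le>?n. c i *\<^sub>R w i)"
  have v: "v \<in> V" unfolding v_def using w by (intro m.closed_sum m.closed) auto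
  have ev: "e v z = \<mu> * m v z" if "z \<in> V" for z
  proof -
    have "e v z = (\<Sum>i\<le>?n. c i * e (w i) z)" unfolding v_def using w that by (intro e.lincomb) auto
    also have "\<dots> = (\<Sum>i\<le>?n. \<mu> * (c i * m (w i) z))" using eq that by (intro sum.cong) auto
    also have "\<dots> = \<mu> * m v z"
      unfolding v_def sum_distrib_left[symmetric] using w that by (subst m.lincomb) auto
    finally show ?thesis .
  qed
  have orth: "m v (eigvec i) = 0" for i
  proof (cases "i \<in> ?J")
    case True
    then have "i \<in> g ` {..<?n}" using g by (simp add: bij_betw_def)
    then obtain j where "j < ?n" "i = g j" by blast
    then show ?thesis unfolding v_def using w c by (subst m.lincomb) auto
  next
    case False
    have "e v (eigvec i) = eigval i * m v (eigvec i)"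
      using eigvec_weak[OF v, of i] e.sym[OF v, of "eigvec i"] m.sym[OF v, of "eigvec i"] by simp
    then show ?thesis using ev[of "eigvec i"] False by simp
  qed
  obtain k where k: "\<mu> < eigval k" using eigval_unbounded by blast
  have "eigval k * m v v \<le> \<mu> * m v v"
    using eigval_minimal[OF v, of k] orth ev[OF v] by simp
  then have "(eigval k - \<mu>) * m v v \<le> 0" by (simp add: algebra_simps)
  then have "m v v = 0" using k m.nonneg[OF v] by (simp add: mult_le_0_iff)
  then show ?thesis using c(1) unfolding v_def by blast
qed

text \<open>Upper half of min-max: a space of dimension k + 1 contains a nonzero vector orthogonal
  to the first k eigenvectors.\<close>

lemma eigval_le:
  assumes f: "\<And>i. i \<le> k \<Longrightarrow> f i \<in> V"
    and pos: "\<And>c. \<exists>i\<le>k. c i \<noteq> 0 \<Longrightarrow> 0 < m (\<Sum>i\<le>k. c i *\<^sub>R f i) (\<Sum>i\<le>k. c i *\<^sub>R f i)"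
    and le: "\<And>c. e (\<Sum>i\<le>k. c i *\<^sub>R f i) (\<Sum>i\<le>k. c i *\<^sub>R f i) \<le> \<Lambda> * m (\<Sum>i\<le>k. c i *\<^sub>R f i) (\<Sum>i\<le>k. c i *\<^sub>R f i)"
  shows "eigval k \<le> \<Lambda>"
proof -
  obtain c where c: "\<exists>i\<le>k. c i \<noteq> 0" "\<forall>j<k. (\<Sum>i\<le>k. c i * m (f i) (eigvec j)) = 0"
    using homogeneous_system_nontrivial[of k "\<lambda>i j. m (f i) (eigvec j)"] by blast
  let ?v = "\<Sum>i\<le>k. c i *\<^sub>R f i"
  have v: "?v \<in> V" using f by (intro m.closed_sum m.closed) auto
  have "m ?v (eigvec j) = 0" if "j < k" for j
    using f c that by (subst m.lincomb) auto
  then have "eigval k * m ?v ?v \<le> e ?v ?v" using v by (intro eigval_minimal) auto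
  also have "\<dots> \<le> \<Lambda> * m ?v ?v" by (rule le)
  finally show ?thesis using pos[OF c(1)] by simp
qed

end

section \<open>Completion of a form by its Cauchy sequences\<close>

lemma semi_inner_subset:
  assumes "semi_inner V b" "subspace W" "W \<subseteq> V"
  shows "semi_inner W b"
proof -
  interpret semi_inner V b by fact
  show ?thesis using assms(2,3) by unfold_locales (auto intro: sym add scale nonneg)
qed

text \<open>Meaningful only where the limit exists, which is the case for Cauchy sequences of a
  semi-inner product.\<close>

definition lim_form :: "('v \<Rightarrow> 'v \<Rightarrow> real) \<Rightarrow> (nat \<Rightarrow> 'v) \<Rightarrow> (nat \<Rightarrow> 'v) \<Rightarrow> real" where
  "lim_form b s t = lim (\<lambda>j. b (s j) (t j))"

context semi_inner
begin

lemma sqrt_quad_diff: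
  assumes "x \<in> V" "y \<in> V"
  shows "\<bar>sqrt (b x x) - sqrt (b y y)\<bar> \<le> sqrt (b (x - y) (x - y))"
proof (rule real_le_rsqrt)
  have "b x y \<le> sqrt (b x x * b y y)"
    using Cauchy_Schwarz[OF assms] by (rule real_le_rsqrt)
  then have "(sqrt (b x x) - sqrt (b y y))\<^sup>2 \<le> b (x - y) (x - y)"
    using assms nonneg by (simp add: quad_diff power2_diff real_sqrt_mult)
  then show "\<bar>sqrt (b x x) - sqrt (b y y)\<bar>\<^sup>2 \<le> b (x - y) (x - y)" by simp
qed

definition cauchy_seqs :: "(nat \<Rightarrow> 'v) set" where
  "cauchy_seqs = {s. (\<forall>j. s j \<in> V) \<and>
     (\<forall>\<epsilon>>0. \<exists>J. \<forall>i\<ge>J. \<forall>j\<ge>J. b (s i - s j) (s i - s j) < \<epsilon>)}"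

lemma cauchy_seqs_V: "s \<in> cauchy_seqs \<Longrightarrow> s j \<in> V"
  by (simp add: cauchy_seqs_def)

lemma cauchy_seqsD: "s \<in> cauchy_seqs \<Longrightarrow> \<epsilon> > 0 \<Longrightarrow>
    \<exists>J. \<forall>i\<ge>J. \<forall>j\<ge>J. b (s i - s j) (s i - s j) < \<epsilon>"
  by (simp add: cauchy_seqs_def)

lemma const_cauchy_seqs: "x \<in> V \<Longrightarrow> (\<lambda>_. x) \<in> cauchy_seqs"
  by (simp add: cauchy_seqs_def zero closed)

lemma subspace_cauchy_seqs: "subspace cauchy_seqs"
  unfolding subspace_def
proof (intro conjI ballI allI)
  show "0 \<in> cauchy_seqs" using const_cauchy_seqs[of 0] closed by (simp add: zero_fun_def)
next
  fix s t assume st: "s \<in> cauchy_seqs" "t \<in> cauchy_seqs"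
  show "s + t \<in> cauchy_seqs"
    unfolding cauchy_seqs_def
  proof (intro CollectI conjI allI impI)
    show "(s + t) j \<in> V" for j using st by (simp add: cauchy_seqs_V closed)
  next
    fix \<epsilon> :: real assume "\<epsilon> > 0"
    then have pos: "\<epsilon> / 4 > 0" by simp
    obtain J1 J2 where J: "\<forall>i\<ge>J1. \<forall>j\<ge>J1. b (s i - s j) (s i - s j) < \<epsilon> / 4"
      "\<forall>i\<ge>J2. \<forall>j\<ge>J2. b (t i - t j) (t i - t j) < \<epsilon> / 4"
      using cauchy_seqsD[OF st(1) pos] cauchy_seqsD[OF st(2) pos] by blast
    have "b ((s + t) i - (s + t) j) ((s + t) i - (s + t) j) < \<epsilon>"
      if "i \<ge> max J1 J2" "j \<ge> max J1 J2" for i j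
    proof -
      have "(s + t) i - (s + t) j = (s i - s j) + (t i - t j)" by simp
      then have "b ((s + t) i - (s + t) j) ((s + t) i - (s + t) j)
          \<le> 2 * b (s i - s j) (s i - s j) + 2 * b (t i - t j) (t i - t j)"
        using quad_add_le[of "s i - s j" "t i - t j"] st by (simp only: cauchy_seqs_V closed)
      moreover have "b (s i - s j) (s i - s j) < \<epsilon> / 4" "b (t i - t j) (t i - t j) < \<epsilon> / 4"
        using J that by auto
      ultimately show ?thesis by linarith
    qed
    then show "\<exists>J. \<forall>i\<ge>J. \<forall>j\<ge>J. b ((s + t) i - (s + t) j) ((s + t) i - (s + t) j) < \<epsilon>" by blast
  qed
next
  fix r :: real and s assume s: "s \<in> cauchy_seqs"
  show "r *\<^sub>R s \<in> cauchy_seqs"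
    unfolding cauchy_seqs_def
  proof (intro CollectI conjI allI impI)
    show "(r *\<^sub>R s) j \<in> V" for j using s by (simp add: cauchy_seqs_V closed)
  next
    fix \<epsilon> :: real assume "\<epsilon> > 0"
    have r: "r\<^sup>2 + 1 > 0" by (simp add: add_nonneg_pos)
    then have "\<epsilon> / (r\<^sup>2 + 1) > 0" using \<open>\<epsilon> > 0\<close> by simp
    from cauchy_seqsD[OF s this] obtain J where
      J: "\<forall>i\<ge>J. \<forall>j\<ge>J. b (s i - s j) (s i - s j) < \<epsilon> / (r\<^sup>2 + 1)" by blast
    have "b ((r *\<^sub>R s) i - (r *\<^sub>R s) j) ((r *\<^sub>R s) i - (r *\<^sub>R s) j) < \<epsilon>" if "i \<ge> J" "j \<ge> J" for i j
    proof -
      have V: "s i - s j \<in> V" using s by (simp add: cauchy_seqs_V closed)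
      have "b ((r *\<^sub>R s) i - (r *\<^sub>R s) j) ((r *\<^sub>R s) i - (r *\<^sub>R s) j) = r\<^sup>2 * b (s i - s j) (s i - s j)"
        using quad_scale[OF V, of r] by (simp add: scaleR_diff_right)
      also have "\<dots> \<le> (r\<^sup>2 + 1) * b (s i - s j) (s i - s j)"
        using nonneg[OF V] by (intro mult_right_mono) auto
      also have "\<dots> < \<epsilon>" using J that r by (simp add: field_simps)
      finally show ?thesis .
    qed
    then show "\<exists>J. \<forall>i\<ge>J. \<forall>j\<ge>J. b ((r *\<^sub>R s) i - (r *\<^sub>R s) j) ((r *\<^sub>R s) i - (r *\<^sub>R s) j) < \<epsilon>" by blast
  qed
qed

text \<open>The seminorm is 1-Lipschitz with respect to itself, its square is not; so the square
  root is shown to be Cauchy.\<close>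

lemma convergent_quad:
  assumes s: "s \<in> cauchy_seqs"
  shows "convergent (\<lambda>j. b (s j) (s j))"
proof -
  have "Cauchy (\<lambda>j. sqrt (b (s j) (s j)))"
    unfolding Cauchy_iff
  proof (intro allI impI)
    fix \<epsilon> :: real assume e: "\<epsilon> > 0"
    then have "\<epsilon>\<^sup>2 > 0" by simp
    from cauchy_seqsD[OF s this] obtain J where
      J: "\<forall>i\<ge>J. \<forall>j\<ge>J. b (s i - s j) (s i - s j) < \<epsilon>\<^sup>2" by blast
    have "norm (sqrt (b (s i) (s i)) - sqrt (b (s j) (s j))) < \<epsilon>" if "i \<ge> J" "j \<ge> J" for i j
    proof -
      have "sqrt (b (s i - s j) (s i - s j)) < sqrt (\<epsilon>\<^sup>2)" using J that by (simp only: real_sqrt_less_iff)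
      then show ?thesis using sqrt_quad_diff[of "s i" "s j"] s e by (simp add: cauchy_seqs_V)
    qed
    then show "\<exists>M. \<forall>m\<ge>M. \<forall>n\<ge>M. norm (sqrt (b (s m) (s m)) - sqrt (b (s n) (s n))) < \<epsilon>" by blast
  qed
  then have "convergent (\<lambda>j. sqrt (b (s j) (s j)))" by (rule Cauchy_convergent)
  then obtain l where "(\<lambda>j. sqrt (b (s j) (s j))) \<longlonglongrightarrow> l" by (auto simp: convergent_def)
  from tendsto_power[OF this, of 2] have "(\<lambda>j. b (s j) (s j)) \<longlonglongrightarrow> l\<^sup>2"
    using s by (simp add: cauchy_seqs_V nonneg)
  then show ?thesis by (auto simp: convergent_def)
qed

text \<open>Polarisation reduces the mixed limit to three quadratic ones.\<close>

lemma lim_form_LIMSEQ: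
  assumes s: "s \<in> cauchy_seqs" "t \<in> cauchy_seqs"
  shows "(\<lambda>j. b (s j) (t j)) \<longlonglongrightarrow> lim_form b s t"
proof -
  have st: "s + t \<in> cauchy_seqs" using subspace_cauchy_seqs s by (rule subspace_add)
  have eq: "b (s j) (t j) = (b ((s + t) j) ((s + t) j) - b (s j) (s j) - b (t j) (t j)) / 2" for j
    using s by (simp add: quad_add cauchy_seqs_V)
  have "convergent (\<lambda>j. (b ((s + t) j) ((s + t) j) - b (s j) (s j) - b (t j) (t j)) / 2)"
    unfolding divide_inverse
    by (intro convergent_mult convergent_diff convergent_quad s st convergent_const)
  then show ?thesis unfolding lim_form_def eq[symmetric] convergent_LIMSEQ_iff .
qed

lemma lim_form_const: "lim_form b (\<lambda>_. x) (\<lambda>_. y) = b x y"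
  by (simp add: lim_form_def lim_const)

lemma semi_inner_lim_form: "semi_inner cauchy_seqs (lim_form b)"
proof
  note L = lim_form_LIMSEQ
  show "subspace cauchy_seqs" by (rule subspace_cauchy_seqs)
  fix s t assume st: "s \<in> cauchy_seqs" "t \<in> cauchy_seqs"
  show "lim_form b s t = lim_form b t s"
    using st by (simp add: lim_form_def sym cauchy_seqs_V)
  show "lim_form b (s + t) u = lim_form b s u + lim_form b t u" if u: "u \<in> cauchy_seqs" for u
  proof (rule LIMSEQ_unique)
    show "(\<lambda>j. b ((s + t) j) (u j)) \<longlonglongrightarrow> lim_form b (s + t) u"
      using u by (intro L subspace_add subspace_cauchy_seqs st)
    show "(\<lambda>j. b ((s + t) j) (u j)) \<longlonglongrightarrow> lim_form b s u + lim_form b t u"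
      using tendsto_add[OF L[OF st(1) u] L[OF st(2) u]] st u by (simp add: add cauchy_seqs_V)
  qed
  show "lim_form b (r *\<^sub>R s) t = r * lim_form b s t" for r
  proof (rule LIMSEQ_unique)
    show "(\<lambda>j. b ((r *\<^sub>R s) j) (t j)) \<longlonglongrightarrow> lim_form b (r *\<^sub>R s) t"
      by (intro L subspace_scale subspace_cauchy_seqs st)
    show "(\<lambda>j. b ((r *\<^sub>R s) j) (t j)) \<longlonglongrightarrow> r * lim_form b s t"
      using tendsto_mult_left[OF L[OF st], of r] st by (simp add: scale cauchy_seqs_V)
  qed
  show "0 \<le> lim_form b s s"
    using L[OF st(1,1)] by (rule LIMSEQ_le_const) (auto simp: nonneg cauchy_seqs_V[OF st(1)])
qed

lemma const_dense:
  assumes s: "s \<in> cauchy_seqs"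
  shows "(\<lambda>J. lim_form b (s - (\<lambda>_. s J)) (s - (\<lambda>_. s J))) \<longlonglongrightarrow> 0"
proof (rule LIMSEQ_I)
  fix r :: real assume r: "r > 0"
  then have "r / 2 > 0" by simp
  from cauchy_seqsD[OF s this] obtain J where
    J: "\<forall>i\<ge>J. \<forall>j\<ge>J. b (s i - s j) (s i - s j) < r / 2" by blast
  have "norm (lim_form b (s - (\<lambda>_. s n)) (s - (\<lambda>_. s n)) - 0) < r" if "n \<ge> J" for n
  proof -
    have mem: "s - (\<lambda>_. s n) \<in> cauchy_seqs"
      using subspace_diff[OF subspace_cauchy_seqs s const_cauchy_seqs[of "s n"]] s cauchy_seqs_V by blast
    have "(\<lambda>j. b (s j - s n) (s j - s n)) \<longlonglongrightarrow> lim_form b (s - (\<lambda>_. s n)) (s - (\<lambda>_. s n))"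
      using lim_form_LIMSEQ[OF mem mem] by simp
    then have "lim_form b (s - (\<lambda>_. s n)) (s - (\<lambda>_. s n)) \<le> r / 2"
      by (rule LIMSEQ_le_const2) (use J that in \<open>auto intro!: exI[of _ J] less_imp_le\<close>)
    moreover have "0 \<le> lim_form b (s - (\<lambda>_. s n)) (s - (\<lambda>_. s n))"
      using semi_inner.nonneg[OF semi_inner_lim_form mem] .
    ultimately show ?thesis using r by simp
  qed
  then show "\<exists>no. \<forall>n\<ge>no. norm (lim_form b (s - (\<lambda>_. s n)) (s - (\<lambda>_. s n)) - 0) < r" by blast
qed

text \<open>Diagonal argument: each \<open>\<sigma> k\<close> is close to one of its own entries
  regarded as a constant sequence; the sequence \<open>d\<close> of these entries is Cauchy and is
  the limit.\<close>

lemma lim_form_complete: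
  assumes \<sigma>: "\<And>k. \<sigma> k \<in> cauchy_seqs"
    and cauchy: "\<And>\<epsilon>. \<epsilon> > 0 \<Longrightarrow> \<exists>J. \<forall>i\<ge>J. \<forall>j\<ge>J. lim_form b (\<sigma> i - \<sigma> j) (\<sigma> i - \<sigma> j) < \<epsilon>"
  shows "\<exists>d\<in>cauchy_seqs. (\<lambda>k. lim_form b (\<sigma> k - d) (\<sigma> k - d)) \<longlonglongrightarrow> 0"
proof -
  interpret L: semi_inner cauchy_seqs "lim_form b" by (rule semi_inner_lim_form)
  have "\<exists>J. lim_form b (\<sigma> k - (\<lambda>_. \<sigma> k J)) (\<sigma> k - (\<lambda>_. \<sigma> k J)) < inverse (real (Suc k))" for k
  proof -
    have "0 < inverse (real (Suc k))" by simp
    from LIMSEQ_D[OF const_dense[OF \<sigma>[of k]] this] obtain J where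
      "norm (lim_form b (\<sigma> k - (\<lambda>_. \<sigma> k J)) (\<sigma> k - (\<lambda>_. \<sigma> k J)) - 0) < inverse (real (Suc k))" by blast
    then show ?thesis by (intro exI[of _ J]) (simp only: real_norm_def diff_0_right)
  qed
  then obtain J where J: "\<And>k. lim_form b (\<sigma> k - (\<lambda>_. \<sigma> k (J k))) (\<sigma> k - (\<lambda>_. \<sigma> k (J k))) < inverse (real (Suc k))"
    by metis
  define d where "d k = \<sigma> k (J k)" for k
  have dV: "d k \<in> V" for k using \<sigma> cauchy_seqs_V by (simp add: d_def)
  note dC = const_cauchy_seqs[OF dV]
  have d: "lim_form b (\<sigma> k - (\<lambda>_. d k)) (\<sigma> k - (\<lambda>_. d k)) < inverse (real (Suc k))" for k
    using J by (simp add: d_def)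
  \<comment> \<open>The squared seminorm obeys the triangle inequality only with a factor 2, which
    is used twice on the way from \<open>d i\<close> through \<open>\<sigma> i\<close> and
    \<open>\<sigma> j\<close> to \<open>d j\<close>.\<close>
  have dd: "b (d i - d j) (d i - d j) \<le> 2 * inverse (real (Suc i)) + 4 * inverse (real (Suc j)) +
     4 * lim_form b (\<sigma> i - \<sigma> j) (\<sigma> i - \<sigma> j)" for i j
  proof -
    let ?q = "\<lambda>x. lim_form b x x"
    have eq: "b (d i - d j) (d i - d j) = ?q ((\<lambda>_. d i) - (\<lambda>_. d j))"
      by (simp add: fun_diff_def lim_form_const)
    have "(\<lambda>_. d i) - (\<lambda>_. d j) = (\<sigma> i - (\<lambda>_. d j)) - (\<sigma> i - (\<lambda>_. d i))" by simp
    then have 1: "?q ((\<lambda>_. d i) - (\<lambda>_. d j)) \<le> 2 * ?q (\<sigma> i - (\<lambda>_. d j)) + 2 * ?q (\<sigma> i - (\<lambda>_. d i))"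
      using L.quad_diff_le[of "\<sigma> i - (\<lambda>_. d j)" "\<sigma> i - (\<lambda>_. d i)"] L.closed(3)[OF \<sigma> dC] by metis
    have "\<sigma> i - (\<lambda>_. d j) = (\<sigma> i - \<sigma> j) + (\<sigma> j - (\<lambda>_. d j))" by simp
    then have 2: "?q (\<sigma> i - (\<lambda>_. d j)) \<le> 2 * ?q (\<sigma> i - \<sigma> j) + 2 * ?q (\<sigma> j - (\<lambda>_. d j))"
      using L.quad_add_le[of "\<sigma> i - \<sigma> j" "\<sigma> j - (\<lambda>_. d j)"] L.closed(3)[OF \<sigma> dC] L.closed(3)[OF \<sigma> \<sigma>]
      by metis
    show ?thesis using 1 2 d[of i] d[of j] unfolding eq by argo
  qed
  have dmem: "d \<in> cauchy_seqs"
    unfolding cauchy_seqs_def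
  proof (intro CollectI conjI allI impI)
    show "d j \<in> V" for j by (rule dV)
    fix \<epsilon> :: real assume "\<epsilon> > 0"
    then have pos: "\<epsilon> / 16 > 0" by simp
    obtain J1 where J1: "\<forall>i\<ge>J1. \<forall>j\<ge>J1. lim_form b (\<sigma> i - \<sigma> j) (\<sigma> i - \<sigma> j) < \<epsilon> / 16"
      using cauchy[OF pos] by blast
    obtain J2 where J2: "inverse (real (Suc J2)) < \<epsilon> / 16"
      using reals_Archimedean[OF pos] by blast
    have inv: "inverse (real (Suc i)) < \<epsilon> / 16" if "i \<ge> J2" for i
    proof -
      have "inverse (real (Suc i)) \<le> inverse (real (Suc J2))" using that by (simp add: field_simps)
      then show ?thesis using J2 by linarith
    qed
    have "b (d i - d j) (d i - d j) < \<epsilon>" if "i \<ge> max J1 J2" "j \<ge> max J1 J2" for i j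
    proof -
      have "lim_form b (\<sigma> i - \<sigma> j) (\<sigma> i - \<sigma> j) < \<epsilon> / 16" using J1 that by auto
      moreover have "inverse (real (Suc i)) < \<epsilon> / 16" "inverse (real (Suc j)) < \<epsilon> / 16"
        using inv that by auto
      ultimately show ?thesis using dd[of i j] \<open>\<epsilon> > 0\<close> by argo
    qed
    then show "\<exists>J. \<forall>i\<ge>J. \<forall>j\<ge>J. b (d i - d j) (d i - d j) < \<epsilon>" by blast
  qed
  have up: "lim_form b (\<sigma> k - d) (\<sigma> k - d) \<le>
      2 * inverse (real (Suc k)) + 2 * lim_form b (d - (\<lambda>_. d k)) (d - (\<lambda>_. d k))" for k
  proof -
    have "\<sigma> k - d = (\<sigma> k - (\<lambda>_. d k)) - (d - (\<lambda>_. d k))" by simp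
    then have "lim_form b (\<sigma> k - d) (\<sigma> k - d) \<le> 2 * lim_form b (\<sigma> k - (\<lambda>_. d k)) (\<sigma> k - (\<lambda>_. d k))
        + 2 * lim_form b (d - (\<lambda>_. d k)) (d - (\<lambda>_. d k))"
      using L.quad_diff_le[of "\<sigma> k - (\<lambda>_. d k)" "d - (\<lambda>_. d k)"] L.closed \<sigma> dC dmem by metis
    then show ?thesis using d[of k] by linarith
  qed
  have "(\<lambda>k. 2 * inverse (real (Suc k)) + 2 * lim_form b (d - (\<lambda>_. d k)) (d - (\<lambda>_. d k))) \<longlonglongrightarrow> 2 * 0 + 2 * 0"
    by (intro tendsto_intros LIMSEQ_inverse_real_of_nat const_dense dmem)
  then have "(\<lambda>k. 2 * inverse (real (Suc k)) + 2 * lim_form b (d - (\<lambda>_. d k)) (d - (\<lambda>_. d k))) \<longlonglongrightarrow> 0" by simp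
  then have "(\<lambda>k. lim_form b (\<sigma> k - d) (\<sigma> k - d)) \<longlonglongrightarrow> 0"
    by (rule tendsto_sandwich[OF _ _ tendsto_const, rotated 2])
       (use up L.nonneg[OF L.closed(3)[OF \<sigma> dmem]] in auto)
  then show ?thesis using dmem by blast
qed

end

context pre_form
begin

text \<open>Thanks to \<open>low\<close>, convergence in energy controls convergence in mass, so the
  limits defining \<open>lim_form m\<close> exist on the energy completion.\<close>

lemma cauchy_seqs_subset: "e.cauchy_seqs \<subseteq> m.cauchy_seqs"
proof
  fix s assume s: "s \<in> e.cauchy_seqs"
  show "s \<in> m.cauchy_seqs"
    unfolding m.cauchy_seqs_def
  proof (intro CollectI conjI allI impI)
    show "s j \<in> V" for j using s by (rule e.cauchy_seqs_V)
    fix \<epsilon> :: real assume "\<epsilon> > 0"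
    then have "low * \<epsilon> > 0" using low_pos by simp
    from e.cauchy_seqsD[OF s this] obtain J where
      J: "\<forall>i\<ge>J. \<forall>j\<ge>J. e (s i - s j) (s i - s j) < low * \<epsilon>" by blast
    have "m (s i - s j) (s i - s j) < \<epsilon>" if "i \<ge> J" "j \<ge> J" for i j
    proof -
      have "low * m (s i - s j) (s i - s j) \<le> e (s i - s j) (s i - s j)"
        using s by (intro low m.closed e.cauchy_seqs_V)
      also have "\<dots> < low * \<epsilon>" using J that by blast
      finally show ?thesis using low_pos by simp
    qed
    then show "\<exists>J. \<forall>i\<ge>J. \<forall>j\<ge>J. m (s i - s j) (s i - s j) < \<epsilon>" by blast
  qed
qed

lemma m_LIMSEQ: "s \<in> e.cauchy_seqs \<Longrightarrow> t \<in> e.cauchy_seqs \<Longrightarrow> (\<lambda>j. m (s j) (t j)) \<longlonglongrightarrow> lim_form m s t"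
  using m.lim_form_LIMSEQ cauchy_seqs_subset by blast

text \<open>The Cauchy sequences serve as their own completion: no quotient is taken, since the
  spectral theory only needs semi-inner products.\<close>

lemma completion_spectral_form: "spectral_form e.cauchy_seqs (lim_form m) (lim_form e) low"
proof -
  have sm: "semi_inner e.cauchy_seqs (lim_form m)"
    by (rule semi_inner_subset[OF m.semi_inner_lim_form e.subspace_cauchy_seqs cauchy_seqs_subset])
  interpret M: semi_inner e.cauchy_seqs "lim_form m" by (rule sm)
  interpret E: semi_inner e.cauchy_seqs "lim_form e" by (rule e.semi_inner_lim_form)
  show ?thesis
  proof unfold_locales
    show "low > 0" by (rule low_pos)
    show "low * lim_form m s s \<le> lim_form e s s" if s: "s \<in> e.cauchy_seqs" for s
      using tendsto_mult_left[OF m_LIMSEQ[OF s s], of low] e.lim_form_LIMSEQ[OF s s]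
      by (rule LIMSEQ_le) (use low e.cauchy_seqs_V[OF s] in auto)
    show "\<exists>d\<in>e.cauchy_seqs. (\<lambda>j. lim_form e (\<sigma> j - d) (\<sigma> j - d)) \<longlonglongrightarrow> 0"
      if "\<And>j. \<sigma> j \<in> e.cauchy_seqs"
        "\<And>\<epsilon>. \<epsilon> > 0 \<Longrightarrow> \<exists>J. \<forall>i\<ge>J. \<forall>j\<ge>J. lim_form e (\<sigma> i - \<sigma> j) (\<sigma> i - \<sigma> j) < \<epsilon>" for \<sigma>
      using that by (rule e.lim_form_complete)
    obtain f :: "nat \<Rightarrow> 'v" where f: "\<And>i. f i \<in> V" "\<And>i j. i \<noteq> j \<Longrightarrow> m (f i) (f j) = 0"
      "\<And>i. m (f i) (f i) > 0"
      using infinite_dim by blast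
    show "\<exists>f. (\<forall>i::nat. f i \<in> e.cauchy_seqs) \<and> (\<forall>i j. i \<noteq> j \<longrightarrow> lim_form m (f i) (f j) = 0) \<and>
        (\<forall>i. 0 < lim_form m (f i) (f i))"
      using f by (intro exI[of _ "\<lambda>i _. f i"]) (simp add: m.lim_form_const e.const_cauchy_seqs)
    fix \<epsilon> :: real assume "\<epsilon> > 0"
    from compact[OF this] obtain N L K where L: "\<And>i x. x \<in> V \<Longrightarrow> (L i x)\<^sup>2 \<le> K * e x x"
      "\<And>i x y. x \<in> V \<Longrightarrow> y \<in> V \<Longrightarrow> L i (x + y) = L i x + L i y"
      "\<And>i x r. x \<in> V \<Longrightarrow> L i (r *\<^sub>R x) = r * L i x"
      "\<And>x. x \<in> V \<Longrightarrow> m x x \<le> \<epsilon> * e x x + (\<Sum>i<(N::nat). (L (i::nat) x)\<^sup>2)"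
      by metis
    \<comment> \<open>The functionals extend by continuity: the bound of their squares by
      \<open>K\<close> times the energy makes their values along \<open>s\<close> a Cauchy
      sequence.\<close>
    define L' where "L' i s = lim (\<lambda>j. L i (s j))" for i and s :: "nat \<Rightarrow> 'v"
    have L': "(\<lambda>j. L i (s j)) \<longlonglongrightarrow> L' i s" if s: "s \<in> e.cauchy_seqs" for i s
    proof -
      note sV = e.cauchy_seqs_V[OF s]
      have "Cauchy (\<lambda>j. L i (s j))"
        unfolding Cauchy_iff
      proof (intro allI impI)
        fix \<eta> :: real assume eta: "\<eta> > 0"
        have K: "\<bar>K\<bar> + 1 > 0" by linarith
        then have "\<eta>\<^sup>2 / (\<bar>K\<bar> + 1) > 0" using eta by simp
        from e.cauchy_seqsD[OF s this] obtain J where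
          J: "\<forall>i\<ge>J. \<forall>j\<ge>J. e (s i - s j) (s i - s j) < \<eta>\<^sup>2 / (\<bar>K\<bar> + 1)" by blast
        have "norm (L i (s p) - L i (s q)) < \<eta>" if "p \<ge> J" "q \<ge> J" for p q
        proof -
          have mem: "s p - s q \<in> V" by (intro m.closed sV)
          have "L i (s p) = L i (s p - s q) + L i (s q)"
            using L(2)[OF mem sV[of q], of i] by simp
          then have "(L i (s p) - L i (s q))\<^sup>2 = (L i (s p - s q))\<^sup>2" by simp
          also have "\<dots> \<le> K * e (s p - s q) (s p - s q)" by (rule L(1)[OF mem])
          also have "\<dots> \<le> (\<bar>K\<bar> + 1) * e (s p - s q) (s p - s q)"
            using e.nonneg[OF mem] by (intro mult_right_mono) auto
          also have "\<dots> < \<eta>\<^sup>2" using J that K by (simp add: field_simps)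
          finally have "\<bar>L i (s p) - L i (s q)\<bar>\<^sup>2 < \<eta>\<^sup>2" by (simp only: power2_abs)
          then have "\<bar>L i (s p) - L i (s q)\<bar> < \<eta>"
            by (rule power_less_imp_less_base[OF _ less_imp_le[OF eta]])
          then show ?thesis by (simp only: real_norm_def)
        qed
        then show "\<exists>M. \<forall>m\<ge>M. \<forall>n\<ge>M. norm (L i (s m) - L i (s n)) < \<eta>" by blast
      qed
      then have "convergent (\<lambda>j. L i (s j))" by (rule Cauchy_convergent)
      then show ?thesis by (simp only: L'_def convergent_LIMSEQ_iff)
    qed
    show "\<exists>N l K. (\<forall>i. \<forall>x\<in>e.cauchy_seqs. (l i x)\<^sup>2 \<le> K * lim_form e x x) \<and>
       (\<forall>i. \<forall>x\<in>e.cauchy_seqs. \<forall>y\<in>e.cauchy_seqs. l i (x + y) = l i x + l i y) \<and>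
       (\<forall>i. \<forall>x\<in>e.cauchy_seqs. \<forall>r. l i (r *\<^sub>R x) = r * l i x) \<and>
       (\<forall>x\<in>e.cauchy_seqs. lim_form m x x \<le> \<epsilon> * lim_form e x x + (\<Sum>i<N::nat. (l (i::nat) x)\<^sup>2))"
    proof (intro exI[of _ N] exI[of _ L'] exI[of _ K] conjI allI ballI)
      fix i r s t assume s: "s \<in> e.cauchy_seqs" and t: "t \<in> e.cauchy_seqs"
      note sV = e.cauchy_seqs_V[OF s] and tV = e.cauchy_seqs_V[OF t]
      show "L' i (s + t) = L' i s + L' i t"
        by (rule LIMSEQ_unique[OF L'[OF E.closed(2)[OF s t]]])
           (use tendsto_add[OF L'[OF s, of i] L'[OF t, of i]] in \<open>simp add: L(2) sV tV\<close>)
    next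
      fix i r s assume s: "s \<in> e.cauchy_seqs"
      note sV = e.cauchy_seqs_V[OF s]
      show "(L' i s)\<^sup>2 \<le> K * lim_form e s s"
        using tendsto_power[OF L'[OF s, of i], of 2] tendsto_mult_left[OF e.lim_form_LIMSEQ[OF s s], of K]
        by (rule LIMSEQ_le) (use L(1) sV in auto)
      show "L' i (r *\<^sub>R s) = r * L' i s"
        by (rule LIMSEQ_unique[OF L'[OF E.closed(4)[OF s]]])
           (use tendsto_mult_left[OF L'[OF s, of i], of r] in \<open>simp add: L(3) sV\<close>)
    next
      fix s assume s: "s \<in> e.cauchy_seqs"
      note sV = e.cauchy_seqs_V[OF s]
      show "lim_form m s s \<le> \<epsilon> * lim_form e s s + (\<Sum>i<N. (L' i s)\<^sup>2)"
      proof (rule LIMSEQ_le)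
        show "(\<lambda>j. m (s j) (s j)) \<longlonglongrightarrow> lim_form m s s" by (rule m_LIMSEQ[OF s s])
        show "(\<lambda>j. \<epsilon> * e (s j) (s j) + (\<Sum>i<N. (L i (s j))\<^sup>2)) \<longlonglongrightarrow> \<epsilon> * lim_form e s s + (\<Sum>i<N. (L' i s)\<^sup>2)"
          by (intro tendsto_intros e.lim_form_LIMSEQ L' s)
      qed (use L(4) sV in auto)
    qed
  qed
qed

section \<open>Min-max over the uncompleted space\<close>

definition form_eigval :: "nat \<Rightarrow> real" where
  "form_eigval = spectral_form.eigval e.cauchy_seqs (lim_form m) (lim_form e)"

lemma form_eigval_low: "low \<le> form_eigval k"
  unfolding form_eigval_def by (rule spectral_form.eigval_low[OF completion_spectral_form])

lemma const_lincomb: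
  "(\<Sum>i\<in>I. c i *\<^sub>R (\<lambda>_ :: nat. f i)) = (\<lambda>_. \<Sum>i\<in>I. c i *\<^sub>R (f i :: 'v))"
  by (rule ext) (simp add: sum_fun_apply)

text \<open>Trial vectors in \<open>V\<close> are trial vectors of the completion, as constant
  sequences.\<close>

lemma form_eigval_le:
  assumes f: "\<And>i. i \<le> k \<Longrightarrow> f i \<in> V"
    and pos: "\<And>c. \<exists>i\<le>k. c i \<noteq> 0 \<Longrightarrow> 0 < m (\<Sum>i\<le>k. c i *\<^sub>R f i) (\<Sum>i\<le>k. c i *\<^sub>R f i)"
    and le: "\<And>c. e (\<Sum>i\<le>k. c i *\<^sub>R f i) (\<Sum>i\<le>k. c i *\<^sub>R f i) \<le> \<Lambda> * m (\<Sum>i\<le>k. c i *\<^sub>R f i) (\<Sum>i\<le>k. c i *\<^sub>R f i)"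
  shows "form_eigval k \<le> \<Lambda>"
  unfolding form_eigval_def
proof (rule spectral_form.eigval_le[OF completion_spectral_form, where f = "\<lambda>i _. f i"])
  show "(\<lambda>_. f i) \<in> e.cauchy_seqs" if "i \<le> k" for i using f[OF that] by (rule e.const_cauchy_seqs)
qed (simp_all only: const_lincomb m.lim_form_const e.lim_form_const pos le)

text \<open>Near-optimal trial spaces inside \<open>V\<close>: entries far out in the Cauchy
  sequences of the first k + 1 eigenvectors have Gram matrices, for mass and for energy, that are
  nearly diagonal.\<close>

lemma form_eigval_approx:
  assumes "\<delta> > 0"
  shows "\<exists>f. (\<forall>i\<le>k. f i \<in> V) \<and>
    (\<forall>c. (\<exists>i\<le>k. c i \<noteq> 0) \<longrightarrow> 0 < m (\<Sum>i\<le>k. c i *\<^sub>R f i) (\<Sum>i\<le>k. c i *\<^sub>R f i)) \<and>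
    (\<forall>c. e (\<Sum>i\<le>k. c i *\<^sub>R f i) (\<Sum>i\<le>k. c i *\<^sub>R f i) \<le>
       (form_eigval k + \<delta>) * m (\<Sum>i\<le>k. c i *\<^sub>R f i) (\<Sum>i\<le>k. c i *\<^sub>R f i))"
proof -
  interpret S: spectral_form e.cauchy_seqs "lim_form m" "lim_form e" low
    by (rule completion_spectral_form)
  let ?s = S.eigvec and ?l = "form_eigval k"
  have l: "?l = S.eigval k" by (simp add: form_eigval_def)
  have l0: "?l > 0" using form_eigval_low[of k] low_pos by linarith
  \<comment> \<open>Put x = (k + 1) \<eta>, the relative error of a quadratic form in k + 1
    variables. Then x \<le> 1/2 keeps the mass positive, and x (1 + l + \<delta>) \<le> \<delta> is
    what l + x \<le> (l + \<delta>) (1 - x) requires.\<close>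
  define \<eta> where "\<eta> = min (1/2) (\<delta> / (2 * (1 + ?l + \<delta>))) / real (Suc k)"
  have eta0: "\<eta> > 0" using l0 assms by (simp add: \<eta>_def)
  have kpos: "real (Suc k) > 0" by simp
  have etak: "real (Suc k) * \<eta> = min (1/2) (\<delta> / (2 * (1 + ?l + \<delta>)))" using kpos by (simp add: \<eta>_def)
  then have eta1: "real (Suc k) * \<eta> \<le> 1/2" and eta2: "real (Suc k) * \<eta> \<le> \<delta> / (2 * (1 + ?l + \<delta>))"
    by (metis min.cobounded1, metis min.cobounded2)
  have eta3: "real (Suc k) * \<eta> * (1 + ?l + \<delta>) \<le> \<delta>"
    using eta2 l0 assms by (simp add: field_simps)
  have "\<forall>\<^sub>F J in sequentially. \<forall>i\<in>{..k}. \<forall>j\<in>{..k}.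
      \<bar>m (?s i J) (?s j J) - (if i = j then 1 else 0)\<bar> < \<eta> \<and>
      \<bar>e (?s i J) (?s j J) - (if i = j then S.eigval i else 0)\<bar> < \<eta>"
  proof (intro eventually_ball_finite ballI eventually_conj finite_atMost)
    fix i j
    have "(\<lambda>J. m (?s i J) (?s j J)) \<longlonglongrightarrow> (if i = j then 1 else 0)"
      using m_LIMSEQ[of "?s i" "?s j"] S.eigvec_orthonormal[of i j] by simp
    from tendstoD[OF this eta0]
    show "\<forall>\<^sub>F J in sequentially. \<bar>m (?s i J) (?s j J) - (if i = j then 1 else 0)\<bar> < \<eta>"
      by (simp add: dist_real_def)
    have "(\<lambda>J. e (?s i J) (?s j J)) \<longlonglongrightarrow> (if i = j then S.eigval i else 0)"
      using e.lim_form_LIMSEQ[of "?s i" "?s j"] S.eigvec_weak[of "?s j" i] S.eigvec_orthonormal[of i j]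
      by (simp split: if_splits)
    from tendstoD[OF this eta0]
    show "\<forall>\<^sub>F J in sequentially. \<bar>e (?s i J) (?s j J) - (if i = j then S.eigval i else 0)\<bar> < \<eta>"
      by (simp add: dist_real_def)
  qed
  then obtain J where J': "\<forall>i\<in>{..k}. \<forall>j\<in>{..k}.
      \<bar>m (?s i J) (?s j J) - (if i = j then 1 else 0)\<bar> < \<eta> \<and>
      \<bar>e (?s i J) (?s j J) - (if i = j then S.eigval i else 0)\<bar> < \<eta>"
    using eventually_happens'[OF sequentially_bot] by blast
  have J: "\<bar>m (?s i J) (?s j J) - (if i = j then 1 else 0)\<bar> < \<eta>"
    "\<bar>e (?s i J) (?s j J) - (if i = j then S.eigval i else 0)\<bar> < \<eta>" if "i \<le> k" "j \<le> k" for i j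
    using J'[THEN bspec, THEN bspec, of i j] that by simp_all
  define f where "f i = ?s i J" for i
  have fV: "f i \<in> V" for i unfolding f_def by (intro e.cauchy_seqs_V S.eigvec_V)
  define Q where "Q c = (\<Sum>i\<le>k. (c i)\<^sup>2)" for c :: "nat \<Rightarrow> real"
  \<comment> \<open>The entrywise error \<eta> is summed using |c i c j| \<le> ((c i)^2 + (c j)^2) /
    2.\<close>
  have perturb: "\<bar>(\<Sum>i\<le>k. \<Sum>j\<le>k. c i * c j * B i j) - (\<Sum>i\<le>k. d i * (c i)\<^sup>2)\<bar> \<le> real (Suc k) * \<eta> * Q c"
    if B: "\<And>i j. i \<le> k \<Longrightarrow> j \<le> k \<Longrightarrow> \<bar>B i j - (if i = j then d i else 0)\<bar> < \<eta>"
    for B :: "nat \<Rightarrow> nat \<Rightarrow> real" and d c :: "nat \<Rightarrow> real"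
  proof -
    have "(\<Sum>i\<le>k. d i * (c i)\<^sup>2) = (\<Sum>i\<le>k. \<Sum>j\<le>k. c i * c j * (if i = j then d i else 0))"
      by (simp add: if_distrib[of "\<lambda>x. _ * x"] power2_eq_square mult_ac cong: if_cong)
    then have "\<bar>(\<Sum>i\<le>k. \<Sum>j\<le>k. c i * c j * B i j) - (\<Sum>i\<le>k. d i * (c i)\<^sup>2)\<bar> =
        \<bar>\<Sum>i\<le>k. \<Sum>j\<le>k. c i * c j * (B i j - (if i = j then d i else 0))\<bar>"
      by (simp add: sum_subtractf right_diff_distrib)
    also have "\<dots> \<le> (\<Sum>i\<le>k. \<bar>\<Sum>j\<le>k. c i * c j * (B i j - (if i = j then d i else 0))\<bar>)"
      by (rule sum_abs)
    also have "\<dots> \<le> (\<Sum>i\<le>k. \<Sum>j\<le>k. \<bar>c i * c j * (B i j - (if i = j then d i else 0))\<bar>)"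
      by (intro sum_mono sum_abs)
    also have "\<dots> \<le> (\<Sum>i\<le>k. \<Sum>j\<le>k. ((c i)\<^sup>2 + (c j)\<^sup>2) / 2 * \<eta>)"
    proof (intro sum_mono)
      fix i j assume ij: "i \<in> {..k}" "j \<in> {..k}"
      have "0 \<le> (\<bar>c i\<bar> - \<bar>c j\<bar>)\<^sup>2" by simp
      then have "\<bar>c i\<bar> * \<bar>c j\<bar> \<le> ((c i)\<^sup>2 + (c j)\<^sup>2) / 2" by (simp add: power2_diff)
      then show "\<bar>c i * c j * (B i j - (if i = j then d i else 0))\<bar> \<le> ((c i)\<^sup>2 + (c j)\<^sup>2) / 2 * \<eta>"
        unfolding abs_mult using B[of i j] ij by (intro mult_mono) auto
    qed
    also have "\<dots> = real (Suc k) * \<eta> * Q c"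
      by (simp add: Q_def sum.distrib sum_divide_distrib[symmetric] sum_distrib_right[symmetric]
          sum_distrib_left[symmetric] algebra_simps)
    finally show ?thesis .
  qed
  let ?v = "\<lambda>c. \<Sum>i\<le>k. c i *\<^sub>R f i"
  have mq: "\<bar>m (?v c) (?v c) - Q c\<bar> \<le> real (Suc k) * \<eta> * Q c" for c
    using perturb[of "\<lambda>i j. m (f i) (f j)" "\<lambda>_. 1" c] J(1) fV by (simp add: m.lincomb_quad f_def Q_def)
  have eq: "\<bar>e (?v c) (?v c) - (\<Sum>i\<le>k. S.eigval i * (c i)\<^sup>2)\<bar> \<le> real (Suc k) * \<eta> * Q c" for c
    using perturb[of "\<lambda>i j. e (f i) (f j)" S.eigval c] J(2) fV by (simp add: e.lincomb_quad f_def)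
  have Q0: "Q c \<ge> 0" for c by (simp add: Q_def sum_nonneg)
  show ?thesis
  proof (intro exI[of _ f] conjI allI impI)
    show "f i \<in> V" for i by (rule fV)
    fix c :: "nat \<Rightarrow> real"
    have half: "m (?v c) (?v c) \<ge> Q c - real (Suc k) * \<eta> * Q c" using mq[of c] by linarith
    show "0 < m (?v c) (?v c)" if nz: "\<exists>i\<le>k. c i \<noteq> 0"
    proof -
      from nz obtain i where "i \<le> k" "c i \<noteq> 0" by (elim exE conjE)
      then have "Q c > 0" unfolding Q_def by (intro sum_pos2[of _ i]) auto
      moreover have "real (Suc k) * \<eta> * Q c \<le> 1/2 * Q c"
        using eta1 Q0[of c] by (rule mult_right_mono)
      ultimately show ?thesis using half by linarith
    qed
    have "(\<Sum>i\<le>k. S.eigval i * (c i)\<^sup>2) \<le> ?l * Q c"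
      unfolding Q_def sum_distrib_left l
      by (intro sum_mono mult_right_mono monoD[OF S.eigval_mono]) auto
    then have "e (?v c) (?v c) \<le> (?l + real (Suc k) * \<eta>) * Q c"
      using eq[of c] by (simp add: distrib_right)
    also have "\<dots> \<le> (?l + \<delta>) * (1 - real (Suc k) * \<eta>) * Q c"
    proof (rule mult_right_mono[OF _ Q0])
      show "?l + real (Suc k) * \<eta> \<le> (?l + \<delta>) * (1 - real (Suc k) * \<eta>)"
        using eta3 by (simp add: algebra_simps)
    qed
    also have "\<dots> = (?l + \<delta>) * (Q c - real (Suc k) * \<eta> * Q c)" by (simp add: algebra_simps)
    also have "\<dots> \<le> (?l + \<delta>) * m (?v c) (?v c)"
      using half l0 assms by (intro mult_left_mono) auto
    finally show "e (?v c) (?v c) \<le> (?l + \<delta>) * m (?v c) (?v c)" .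
  qed
qed

end

section \<open>Calculus of test functions\<close>

text \<open>Local version of \<open>cont_diff\<close>: the conformal factor is smooth only inside
  the ball. The derivatives are those of the whole space, so the notion is meant for open
  \<open>S\<close>.\<close>

fun cont_diff_on :: "nat \<Rightarrow> (real^'n::finite) set \<Rightarrow> (real^'n \<Rightarrow> real) \<Rightarrow> bool" where
  "cont_diff_on 0 S f \<longleftrightarrow> continuous_on S f"
| "cont_diff_on (Suc m) S f \<longleftrightarrow>
     (\<forall>x\<in>S. f differentiable (at x)) \<and> (\<forall>i. cont_diff_on m S (partial_deriv i f))"

lemma cont_diff_on_UNIV: "cont_diff_on m UNIV f = cont_diff m f"
  by (induction m arbitrary: f) auto

lemma partial_deriv_eqI: "(f has_derivative D) (at x) \<Longrightarrow> partial_deriv i f x = D (axis i 1)"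
  unfolding partial_deriv_def using frechet_derivative_at by metis

text \<open>\<open>frechet_derivative\<close> is a choice among the derivatives at the point, and
  functions that agree near the point have the same ones.\<close>

lemma partial_deriv_cong:
  assumes "open S" "x \<in> S" "\<And>x. x \<in> S \<Longrightarrow> f x = g x"
  shows "partial_deriv i f x = partial_deriv i g x"
proof -
  have "(f has_derivative D) (at x) \<longleftrightarrow> (g has_derivative D) (at x)" for D
    using assms by (metis has_derivative_transform_within_open)
  then show ?thesis by (simp add: partial_deriv_def frechet_derivative_def)
qed

lemma has_derivative_coord_grad:
  assumes "f differentiable (at x)"
  shows "(f has_derivative (\<lambda>h. coord_grad f x \<bullet> h)) (at x)"
proof -
  obtain D where D: "(f has_derivative D) (at x)" using assms by (auto simp: differentiable_def)
  have lin: "linear D" using D by (simp add: has_derivative_bounded_linear bounded_linear.linear)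
  have "D h = coord_grad f x \<bullet> h" for h
  proof -
    have "h = (\<Sum>i\<in>UNIV. (h $ i) *\<^sub>R axis i 1)"
      by (simp add: vec_eq_iff axis_def if_distrib[of "\<lambda>x. _ * x"] cong: if_cong)
    then have "D h = (\<Sum>i\<in>UNIV. (h $ i) * D (axis i 1))"
      using lin by (metis (mono_tags, lifting) linear_sum linear_scale real_scaleR_def sum.cong)
    then show ?thesis
      by (simp add: coord_grad_def inner_vec_def partial_deriv_eqI[OF D] mult.commute)
  qed
  then have "D = (\<lambda>h. coord_grad f x \<bullet> h)" by (rule ext)
  then show ?thesis using D by simp
qed

lemma partial_deriv_const: "partial_deriv i (\<lambda>_. c) = (\<lambda>_. 0)"
  by (rule ext, rule partial_deriv_eqI[THEN trans, OF has_derivative_const]) simp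

lemma partial_deriv_add:
  assumes "f differentiable (at x)" "g differentiable (at x)"
  shows "partial_deriv i (\<lambda>x. f x + g x) x = partial_deriv i f x + partial_deriv i g x"
proof -
  obtain D E where "(f has_derivative D) (at x)" "(g has_derivative E) (at x)"
    using assms by (auto simp: differentiable_def)
  then show ?thesis
    using partial_deriv_eqI[OF has_derivative_add, of f D x g E i] by (simp add: partial_deriv_eqI)
qed

lemma partial_deriv_mult:
  fixes f g :: "real^'n::finite \<Rightarrow> real"
  assumes "f differentiable (at x)" "g differentiable (at x)"
  shows "partial_deriv i (\<lambda>x. f x * g x) x = f x * partial_deriv i g x + partial_deriv i f x * g x"
proof -
  obtain D E where "(f has_derivative D) (at x)" "(g has_derivative E) (at x)"
    using assms by (auto simp: differentiable_def)
  then show ?thesis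
    using partial_deriv_eqI[OF has_derivative_mult, of f D x g E i] by (simp add: partial_deriv_eqI)
qed

lemma partial_deriv_comp:
  fixes f :: "real \<Rightarrow> real"
  assumes "(f has_real_derivative d) (at (s x))" "s differentiable (at x)"
  shows "partial_deriv i (\<lambda>x. f (s x)) x = d * partial_deriv i s x"
proof -
  obtain D where D: "(s has_derivative D) (at x)"
    using assms by (auto simp: differentiable_def)
  show ?thesis
    using partial_deriv_eqI[OF DERIV_compose_FDERIV[OF assms(1) D], of i] by (simp add: partial_deriv_eqI[OF D])
qed

lemma partial_deriv_component: "partial_deriv i (\<lambda>x :: real^'n::finite. x $ j) = (\<lambda>_. if i = j then 1 else 0)"
proof
  fix x :: "real^'n"
  have "((\<lambda>x. x $ j) has_derivative (\<lambda>h. h $ j)) (at x)"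
    by (rule bounded_linear_imp_has_derivative[OF bounded_linear_vec_nth])
  from partial_deriv_eqI[OF this] show "partial_deriv i (\<lambda>x. x $ j) x = (if i = j then 1 else 0)"
    by (auto simp: axis_def)
qed

lemma differentiable_component: "(\<lambda>x. (x :: real^'n::finite) $ j) differentiable (at x)"
  using bounded_linear_imp_differentiable[OF bounded_linear_vec_nth] .

lemma has_derivative_inner_self:
  "((\<lambda>x. x \<bullet> x) has_derivative (\<lambda>h. 2 * (x \<bullet> h))) (at (x :: real^'n::finite))"
  by (rule has_derivative_eq_rhs[OF has_derivative_inner[OF has_derivative_ident has_derivative_ident]])
     (simp add: fun_eq_iff inner_commute)

lemma partial_deriv_inner_self: "partial_deriv i (\<lambda>x. x \<bullet> x) = (\<lambda>x. 2 * x $ i)"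
  using partial_deriv_eqI[OF has_derivative_inner_self] by (auto simp: fun_eq_iff inner_axis)

lemma partial_deriv_scaled:
  fixes f :: "real^'n::finite \<Rightarrow> real"
  assumes "\<And>x. f differentiable (at x)"
  shows "partial_deriv i (\<lambda>x. f (r *\<^sub>R x)) = (\<lambda>x. r * partial_deriv i f (r *\<^sub>R x))"
proof
  fix x :: "real^'n"
  have "((\<lambda>x. r *\<^sub>R x) has_derivative (\<lambda>h. r *\<^sub>R h)) (at x)"
    by (auto intro!: derivative_eq_intros)
  from has_derivative_compose[OF this has_derivative_coord_grad[of f "r *\<^sub>R x", OF assms]]
  have "((\<lambda>x. f (r *\<^sub>R x)) has_derivative (\<lambda>h. coord_grad f (r *\<^sub>R x) \<bullet> (r *\<^sub>R h))) (at x)" .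
  from partial_deriv_eqI[OF this] show "partial_deriv i (\<lambda>x. f (r *\<^sub>R x)) x = r * partial_deriv i f (r *\<^sub>R x)"
    by (simp add: inner_axis coord_grad_def)
qed

lemma cont_diff_on_cong:
  assumes "open S" "\<And>x. x \<in> S \<Longrightarrow> f x = g x"
  shows "cont_diff_on m S f \<longleftrightarrow> cont_diff_on m S g"
  using assms(2)
proof (induction m arbitrary: f g)
  case 0
  show ?case unfolding cont_diff_on.simps by (rule continuous_on_cong[OF refl 0])
next
  case (Suc m)
  have "f differentiable (at x) \<longleftrightarrow> g differentiable (at x)" if x: "x \<in> S" for x
  proof
    show "g differentiable (at x)" if "f differentiable (at x)"
      using that has_derivative_transform_within_open[OF _ assms(1) x, of f _ UNIV g] Suc.prems
      unfolding differentiable_def by blast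
    show "f differentiable (at x)" if "g differentiable (at x)"
      using that has_derivative_transform_within_open[OF _ assms(1) x, of g _ UNIV f] Suc.prems[symmetric]
      unfolding differentiable_def by blast
  qed
  moreover have "cont_diff_on m S (partial_deriv i f) \<longleftrightarrow> cont_diff_on m S (partial_deriv i g)" for i
    by (rule Suc.IH) (use partial_deriv_cong[OF assms(1)] Suc.prems in blast)
  ultimately show ?case by auto
qed

lemma cont_diff_on_continuous: "cont_diff_on m S f \<Longrightarrow> continuous_on S f"
  by (cases m) (auto intro!: continuous_at_imp_continuous_on differentiable_imp_continuous_within)

lemma cont_diff_on_Suc: "cont_diff_on (Suc m) S f \<Longrightarrow> cont_diff_on m S f"
proof (induction m arbitrary: f)
  case 0
  then show ?case using cont_diff_on_continuous by fastforce
next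
  case (Suc m)
  show ?case unfolding cont_diff_on.simps(2)[of m]
  proof (intro conjI ballI allI)
    show "f differentiable at x" if "x \<in> S" for x using Suc.prems that by simp
    have "cont_diff_on (Suc m) S (partial_deriv i f)" for i
      using Suc.prems unfolding cont_diff_on.simps(2)[of "Suc m"] by blast
    then show "cont_diff_on m S (partial_deriv i f)" for i by (rule Suc.IH)
  qed
qed

lemma cont_diff_on_subset: "cont_diff_on m S f \<Longrightarrow> T \<subseteq> S \<Longrightarrow> cont_diff_on m T f"
  by (induction m arbitrary: f) (auto intro: continuous_on_subset)

lemma cont_diff_on_Un:
  "open S \<Longrightarrow> open T \<Longrightarrow> cont_diff_on m S f \<Longrightarrow> cont_diff_on m T f \<Longrightarrow> cont_diff_on m (S \<union> T) f"
  by (induction m arbitrary: f) (auto intro: continuous_on_open_Un)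

lemma cont_diff_on_const [simp]: "cont_diff_on m S (\<lambda>_. c)"
  by (induction m arbitrary: c) (auto simp: partial_deriv_const)

lemma cont_diff_on_add:
  "open S \<Longrightarrow> cont_diff_on m S f \<Longrightarrow> cont_diff_on m S g \<Longrightarrow> cont_diff_on m S (\<lambda>x. f x + g x)"
proof (induction m arbitrary: f g)
  case 0
  then show ?case by (auto intro: continuous_on_add)
next
  case (Suc m)
  have "cont_diff_on m S (partial_deriv i (\<lambda>x. f x + g x))" for i
    using Suc.prems Suc.IH[of "partial_deriv i f" "partial_deriv i g"]
    by (subst cont_diff_on_cong[OF Suc.prems(1), of _ "\<lambda>x. partial_deriv i f x + partial_deriv i g x"])
       (auto simp: partial_deriv_add)
  then show ?case using Suc.prems by (auto intro: differentiable_add)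
qed

lemma cont_diff_on_mult:
  "open S \<Longrightarrow> cont_diff_on m S f \<Longrightarrow> cont_diff_on m S g \<Longrightarrow> cont_diff_on m S (\<lambda>x. f x * g x)"
proof (induction m arbitrary: f g)
  case 0
  then show ?case by (auto intro: continuous_on_mult)
next
  case (Suc m)
  have "cont_diff_on m S (\<lambda>x. f x * partial_deriv i g x + partial_deriv i f x * g x)" for i
    using Suc.prems cont_diff_on_Suc[OF Suc.prems(2)] cont_diff_on_Suc[OF Suc.prems(3)]
    by (intro cont_diff_on_add Suc.IH) auto
  then have "cont_diff_on m S (partial_deriv i (\<lambda>x. f x * g x))" for i
    using Suc.prems
    by (subst cont_diff_on_cong[OF Suc.prems(1), of _ "\<lambda>x. f x * partial_deriv i g x + partial_deriv i f x * g x"])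
       (auto simp: partial_deriv_mult)
  then show ?case using Suc.prems by (auto intro: differentiable_mult)
qed

lemma cont_diff_on_component [simp]: "cont_diff_on m S (\<lambda>x. x $ j)"
  by (cases m) (auto simp: partial_deriv_component differentiable_component intro!: continuous_intros)

lemma cont_diff_on_inner_self: "open S \<Longrightarrow> cont_diff_on m S (\<lambda>x. x \<bullet> x)"
  by (cases m)
     (auto simp: partial_deriv_inner_self differentiable_def
       intro!: continuous_intros cont_diff_on_mult has_derivative_inner_self)

text \<open>The outer functions come from a family closed under differentiation, which carries the
  induction on the order without a notion of smoothness in one variable. The families used are
  multiples of powers and \<open>exp_bump\<close>.\<close>

lemma cont_diff_on_comp:
  fixes F :: "(real \<Rightarrow> real) set" and s :: "real^'n::finite \<Rightarrow> real"
  assumes F: "\<And>f. f \<in> F \<Longrightarrow> \<exists>f'\<in>F. \<forall>t\<in>T. (f has_real_derivative f' t) (at t)"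
    and S: "open S" "\<And>m. cont_diff_on m S s" "s ` S \<subseteq> T"
  shows "f \<in> F \<Longrightarrow> cont_diff_on m S (\<lambda>x. f (s x))"
proof (induction m arbitrary: f)
  case (0 f)
  obtain f' where "\<forall>t\<in>T. (f has_real_derivative f' t) (at t)" using F[OF 0] by blast
  then have "continuous_on T f"
    using DERIV_isCont by (blast intro: continuous_at_imp_continuous_on)
  then show ?case
    using continuous_on_compose2[of T f S s] cont_diff_on_continuous[OF S(2)] S(3) by simp
next
  case (Suc m)
  obtain f' where f': "f' \<in> F" "\<forall>t\<in>T. (f has_real_derivative f' t) (at t)" using F[OF Suc.prems] by blast
  have sd: "s differentiable (at x)" "cont_diff_on m S (partial_deriv i s)" if "x \<in> S" for x i
    using S(2)[of "Suc m"] that by auto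
  show ?case unfolding cont_diff_on.simps(2)
  proof (intro conjI ballI allI)
    show "(\<lambda>x. f (s x)) differentiable at x" if x: "x \<in> S" for x
    proof -
      obtain D where "(s has_derivative D) (at x)" using sd(1)[OF x] by (auto simp: differentiable_def)
      moreover have "(f has_real_derivative f' (s x)) (at (s x))" using f' x S(3) by blast
      ultimately show ?thesis using DERIV_compose_FDERIV differentiable_def by blast
    qed
    fix i
    have "cont_diff_on m S (\<lambda>x. f' (s x) * partial_deriv i s x)"
      using S(2)[of "Suc m"] by (intro cont_diff_on_mult S Suc.IH f') auto
    moreover have "partial_deriv i (\<lambda>x. f (s x)) x = f' (s x) * partial_deriv i s x" if "x \<in> S" for x
      using f' that S(3) by (intro partial_deriv_comp sd) auto
    ultimately show "cont_diff_on m S (partial_deriv i (\<lambda>x. f (s x)))"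
      by (subst cont_diff_on_cong[OF S(1), of _ "\<lambda>x. f' (s x) * partial_deriv i s x"])
  qed
qed

lemma cont_diff_on_powr:
  assumes "open S" "\<And>m. cont_diff_on m S s" "\<And>x. x \<in> S \<Longrightarrow> s x > 0"
  shows "cont_diff_on m S (\<lambda>x. s x powr p)"
proof -
  let ?F = "{\<lambda>t. c * t powr q | c q. True}"
  have "\<exists>f'\<in>?F. \<forall>t\<in>{0<..}. (f has_real_derivative f' t) (at t)" if f: "f \<in> ?F" for f
  proof -
    obtain c q where f: "f = (\<lambda>t. c * t powr q)" using f by blast
    have "(f has_real_derivative (c * q) * t powr (q - 1)) (at t)" if "t \<in> {0<..}" for t
      unfolding f using that by (auto intro!: derivative_eq_intros)
    then show ?thesis by (intro bexI[of _ "\<lambda>t. (c * q) * t powr (q - 1)"]) blast+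
  qed
  from cont_diff_on_comp[OF this assms(1,2), of "\<lambda>t. 1 * t powr p" m]
  show ?thesis using assms(3) by fastforce
qed

text \<open>The standard flat function exp(-1/t), with a polynomial in 1/t in front so that the
  family is closed under differentiation.\<close>

definition exp_bump :: "real poly \<Rightarrow> real \<Rightarrow> real" where
  "exp_bump P t = (if t > 0 then poly P (1 / t) * exp (- (1 / t)) else 0)"

lemma exp_bump_has_derivative_0: "(exp_bump P has_real_derivative 0) (at 0)"
proof -
  have poly0: "((\<lambda>x. poly Q x / exp x) \<longlongrightarrow> 0) at_top" for Q :: "real poly"
  proof -
    have "((\<lambda>x. \<Sum>i\<le>degree Q. coeff Q i * (x ^ i / exp x)) \<longlongrightarrow> (\<Sum>i\<le>degree Q. coeff Q i * 0)) at_top"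
      by (intro tendsto_intros tendsto_power_div_exp_0)
    then show ?thesis by (simp add: poly_altdef sum_divide_distrib)
  qed
  have "((\<lambda>t. exp_bump P t / t) \<longlongrightarrow> 0) (at 0)"
  proof (rule filterlim_split_at)
    show "((\<lambda>t. exp_bump P t / t) \<longlongrightarrow> 0) (at_left 0)"
      by (rule tendsto_eventually) (auto simp: eventually_at_left_field exp_bump_def intro!: exI[of _ "-1"])
    \<comment> \<open>With x = 1/t the quotient by t is x P(x) / exp x, and \<open>pCons 0 P\<close>
      is the polynomial x P.\<close>
    have "((\<lambda>t. poly (pCons 0 P) (inverse t) / exp (inverse t)) \<longlongrightarrow> 0) (at_right (0::real))"
      by (rule filterlim_compose[OF poly0 filterlim_inverse_at_top_right])
    moreover have "\<forall>\<^sub>F t in at_right (0::real). poly (pCons 0 P) (inverse t) / exp (inverse t) = exp_bump P t / t"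
      unfolding eventually_at_right_field
      by (rule exI[of _ 1]) (auto simp: exp_bump_def exp_minus field_simps)
    ultimately show "((\<lambda>t. exp_bump P t / t) \<longlongrightarrow> 0) (at_right 0)"
      by (rule Lim_transform_eventually)
  qed
  then show ?thesis by (simp add: has_field_derivative_iff exp_bump_def)
qed

text \<open>For t > 0 and x = 1/t, differentiation in t brings out a factor x^2 and replaces P by P
  - P'.\<close>

lemma exp_bump_deriv:
  "(exp_bump P has_real_derivative exp_bump ([:0, 0, 1:] * (P - pderiv P)) t) (at t)"
proof -
  consider "t > 0" | "t = 0" | "t < 0" by linarith
  then show ?thesis
  proof cases
    case 1
    have "((\<lambda>t. poly P (1 / t) * exp (- (1 / t))) has_real_derivative
       exp_bump ([:0, 0, 1:] * (P - pderiv P)) t) (at t)"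
      using 1 unfolding exp_bump_def
      by (auto intro!: derivative_eq_intros DERIV_chain2[OF poly_DERIV] simp: field_simps power2_eq_square)
    then show ?thesis
      by (rule has_field_derivative_transform_within_open[of _ _ _ "{0<..}"]) (use 1 in \<open>auto simp: exp_bump_def\<close>)
  next
    case 2
    then show ?thesis using exp_bump_has_derivative_0 by (simp add: exp_bump_def)
  next
    case 3
    have "((\<lambda>_. 0) has_real_derivative exp_bump ([:0, 0, 1:] * (P - pderiv P)) t) (at t)"
      using 3 by (auto simp: exp_bump_def)
    then show ?thesis
      by (rule has_field_derivative_transform_within_open[of _ _ _ "{..<0}"]) (use 3 in \<open>auto simp: exp_bump_def\<close>)
  qed
qed

lemma cont_diff_on_exp_bump:
  assumes "open S" "\<And>m. cont_diff_on m S s"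
  shows "cont_diff_on m S (\<lambda>x. exp_bump P (s x))"
proof (rule cont_diff_on_comp[of "range exp_bump" UNIV S s "exp_bump P"])
  show "\<exists>f'\<in>range exp_bump. \<forall>t\<in>UNIV. (f has_real_derivative f' t) (at t)" if "f \<in> range exp_bump" for f
    using that exp_bump_deriv by blast
qed (use assms in auto)

text \<open>Any compact set containing the support will do, which spares computing closures for
  sums, products and derivatives.\<close>

lemma test_functions_iff:
  "\<phi> \<in> test_functions \<Omega> \<longleftrightarrow> (\<forall>m. cont_diff_on m UNIV \<phi>) \<and>
     (\<exists>K. compact K \<and> K \<subseteq> \<Omega> \<and> (\<forall>x. x \<notin> K \<longrightarrow> \<phi> x = 0))"
proof
  assume "\<phi> \<in> test_functions \<Omega>"
  then show "(\<forall>m. cont_diff_on m UNIV \<phi>) \<and> (\<exists>K. compact K \<and> K \<subseteq> \<Omega> \<and> (\<forall>x. x \<notin> K \<longrightarrow> \<phi> x = 0))"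
    unfolding test_functions_def cont_diff_on_UNIV
    using closure_subset[of "{x. \<phi> x \<noteq> 0}"] by (auto intro!: exI[of _ "closure {x. \<phi> x \<noteq> 0}"])
next
  assume "(\<forall>m. cont_diff_on m UNIV \<phi>) \<and> (\<exists>K. compact K \<and> K \<subseteq> \<Omega> \<and> (\<forall>x. x \<notin> K \<longrightarrow> \<phi> x = 0))"
  then obtain K where K: "\<forall>m. cont_diff_on m UNIV \<phi>" "compact K" "K \<subseteq> \<Omega>" "\<And>x. x \<notin> K \<Longrightarrow> \<phi> x = 0" by blast
  have "closure {x. \<phi> x \<noteq> 0} \<subseteq> K"
    by (rule closure_minimal) (use K compact_imp_closed in auto)
  moreover have "compact (closure {x. \<phi> x \<noteq> 0})"
    using calculation K(2) by (meson bounded_subset closed_closure compact_eq_bounded_closed)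
  ultimately show "\<phi> \<in> test_functions \<Omega>"
    using K by (auto simp: test_functions_def cont_diff_on_UNIV)
qed

lemma test_functionsE:
  assumes "\<phi> \<in> test_functions \<Omega>"
  obtains K where "compact K" "K \<subseteq> \<Omega>" "\<And>x. x \<notin> K \<Longrightarrow> \<phi> x = 0"
  using assms unfolding test_functions_iff by blast

lemma test_functions_cont_diff: "\<phi> \<in> test_functions \<Omega> \<Longrightarrow> cont_diff_on m UNIV \<phi>"
  by (simp add: test_functions_iff)

lemma test_functions_differentiable: "\<phi> \<in> test_functions \<Omega> \<Longrightarrow> \<phi> differentiable (at x)"
  using test_functions_cont_diff[of \<phi> \<Omega> "Suc 0"] by simp

lemma test_functions_continuous: "\<phi> \<in> test_functions \<Omega> \<Longrightarrow> continuous_on UNIV \<phi>"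
  using test_functions_cont_diff[of \<phi> \<Omega> 0] by simp

lemma test_functions_mono: "\<Omega> \<subseteq> \<Omega>' \<Longrightarrow> test_functions \<Omega> \<subseteq> test_functions \<Omega>'"
  by (auto simp: test_functions_def)

lemma test_functions_eq_0: "\<phi> \<in> test_functions \<Omega> \<Longrightarrow> x \<notin> \<Omega> \<Longrightarrow> \<phi> x = 0"
  by (erule test_functionsE) auto

lemma test_functions_add:
  assumes "\<phi> \<in> test_functions \<Omega>" "\<psi> \<in> test_functions \<Omega>"
  shows "(\<lambda>x. \<phi> x + \<psi> x) \<in> test_functions \<Omega>"
proof -
  obtain K L where K: "compact K" "K \<subseteq> \<Omega>" "\<And>x. x \<notin> K \<Longrightarrow> \<phi> x = 0"
    and L: "compact L" "L \<subseteq> \<Omega>" "\<And>x. x \<notin> L \<Longrightarrow> \<psi> x = 0"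
    using assms by (metis test_functionsE)
  show ?thesis
    unfolding test_functions_iff
  proof (intro conjI allI exI[of _ "K \<union> L"] impI)
    show "cont_diff_on m UNIV (\<lambda>x. \<phi> x + \<psi> x)" for m
      using assms by (intro cont_diff_on_add test_functions_cont_diff) auto
    show "\<phi> x + \<psi> x = 0" if "x \<notin> K \<union> L" for x
      using K(3)[of x] L(3)[of x] that by simp
  qed (use K L in \<open>auto intro: compact_Un\<close>)
qed

text \<open>The factor \<open>g\<close> may be singular at the boundary: the product is smooth on
  \<open>\<Omega>\<close>, is zero on the complement of a compact subset, and these two open sets
  cover the space.\<close>

lemma test_functions_mult:
  assumes \<phi>: "\<phi> \<in> test_functions \<Omega>" and "open \<Omega>" and g: "\<And>m. cont_diff_on m \<Omega> g"
  shows "(\<lambda>x. \<phi> x * g x) \<in> test_functions \<Omega>"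
proof -
  obtain K where K: "compact K" "K \<subseteq> \<Omega>" "\<And>x. x \<notin> K \<Longrightarrow> \<phi> x = 0"
    using \<phi> by (metis test_functionsE)
  have opK: "open (- K)" using compact_imp_closed[OF K(1)] by (rule open_Compl)
  have "cont_diff_on m \<Omega> (\<lambda>x. \<phi> x * g x)" for m
    by (intro cont_diff_on_mult assms cont_diff_on_subset[OF test_functions_cont_diff[OF \<phi>]]) auto
  moreover have "cont_diff_on m (- K) (\<lambda>x. \<phi> x * g x)" for m
    using cont_diff_on_cong[OF opK, of "\<lambda>x. \<phi> x * g x" "\<lambda>_. 0"] K(3) by simp
  ultimately have "cont_diff_on m (\<Omega> \<union> - K) (\<lambda>x. \<phi> x * g x)" for m
    using cont_diff_on_Un[OF \<open>open \<Omega>\<close> opK] by blast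
  moreover have "\<Omega> \<union> - K = UNIV" using K(2) by blast
  ultimately have "cont_diff_on m UNIV (\<lambda>x. \<phi> x * g x)" for m by metis
  then show ?thesis unfolding test_functions_iff using K by auto
qed

lemma test_functions_cmult: "\<phi> \<in> test_functions \<Omega> \<Longrightarrow> (\<lambda>x. c * \<phi> x) \<in> test_functions \<Omega>"
  unfolding test_functions_iff by (auto intro!: cont_diff_on_mult)

lemma test_functions_zero: "(\<lambda>_. 0) \<in> test_functions \<Omega>"
  unfolding test_functions_iff by (auto intro: exI[of _ "{}"])

lemma subspace_test_functions: "subspace (test_functions \<Omega>)"
  unfolding subspace_def plus_fun_def zero_fun_def scaleR_fun_def
  by (auto intro: test_functions_zero test_functions_add test_functions_cmult)

lemma test_functions_partial_deriv:
  assumes "\<phi> \<in> test_functions \<Omega>"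
  shows "partial_deriv i \<phi> \<in> test_functions \<Omega>"
proof -
  obtain K where K: "compact K" "K \<subseteq> \<Omega>" "\<And>x. x \<notin> K \<Longrightarrow> \<phi> x = 0"
    using assms by (metis test_functionsE)
  have opK: "open (- K)" using compact_imp_closed[OF K(1)] by (rule open_Compl)
  have "partial_deriv i \<phi> x = 0" if "x \<notin> K" for x
    using partial_deriv_cong[OF opK, of x \<phi> "\<lambda>_. 0" i] that K(3) by (simp add: partial_deriv_const)
  moreover have "cont_diff_on m UNIV (partial_deriv i \<phi>)" for m
    using test_functions_cont_diff[OF assms, of "Suc m"] by simp
  ultimately show ?thesis unfolding test_functions_iff using K by auto
qed

lemma test_functions_scaled:
  assumes \<phi>: "\<phi> \<in> test_functions (ball 0 R)" and r: "r > 0"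
  shows "(\<lambda>x. \<phi> (r *\<^sub>R x)) \<in> test_functions (ball (0 :: real^'n::finite) (R / r))"
proof -
  obtain K where K: "compact K" "K \<subseteq> ball 0 R" "\<And>x. x \<notin> K \<Longrightarrow> \<phi> x = 0"
    using \<phi> by (metis test_functionsE)
  have sm: "cont_diff_on m UNIV (\<lambda>x. f (r *\<^sub>R x))" if "cont_diff_on m UNIV f" for m and f :: "real^'n \<Rightarrow> real"
    using that
  proof (induction m arbitrary: f)
    case 0
    then show ?case by (auto intro!: continuous_on_compose2[of UNIV f] continuous_intros)
  next
    case (Suc m)
    have "cont_diff_on m UNIV (\<lambda>x. r * partial_deriv i f (r *\<^sub>R x))" for i
      using Suc by (intro cont_diff_on_mult) auto
    moreover have "(\<lambda>x. f (r *\<^sub>R x)) differentiable (at x)" for x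
    proof -
      have "f differentiable (at (r *\<^sub>R x))" using Suc.prems by simp
      moreover have "(\<lambda>x. r *\<^sub>R x) differentiable (at x)" by simp
      ultimately show ?thesis using differentiable_chain_at[of "\<lambda>x. r *\<^sub>R x" x f] by (simp add: o_def)
    qed
    ultimately show ?case using Suc.prems by (simp add: partial_deriv_scaled)
  qed
  have "compact ((\<lambda>x. (1 / r) *\<^sub>R x) ` K)"
    by (intro compact_continuous_image K continuous_intros)
  moreover have "(\<lambda>x. (1 / r) *\<^sub>R x) ` K \<subseteq> ball 0 (R / r)"
  proof
    fix y assume "y \<in> (\<lambda>x. (1 / r) *\<^sub>R x) ` K"
    then obtain x where "x \<in> K" "y = (1 / r) *\<^sub>R x" by blast
    then show "y \<in> ball 0 (R / r)" using K(2) r by (auto simp: divide_strict_right_mono)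
  qed
  moreover have "\<phi> (r *\<^sub>R x) = 0" if "x \<notin> (\<lambda>x. (1 / r) *\<^sub>R x) ` K" for x
  proof (rule K(3))
    show "r *\<^sub>R x \<notin> K" using that r by (auto intro: image_eqI[of _ _ "r *\<^sub>R x"])
  qed
  ultimately show ?thesis
    unfolding test_functions_iff using sm test_functions_cont_diff[OF \<phi>] by blast
qed

text \<open>Bumps on disjoint spherical shells: the argument of \<open>exp_bump\<close> is a product
  of two factors in |x|^2, positive exactly between the two radii. They witness
  \<open>infinite_dim\<close>.\<close>

lemma ex_disjoint_test_functions:
  assumes "R > 0"
  shows "\<exists>f :: nat \<Rightarrow> real^'n::finite \<Rightarrow> real. (\<forall>i. f i \<in> test_functions (ball 0 R)) \<and>
     (\<forall>i. \<exists>x. f i x \<noteq> 0) \<and> (\<forall>i j x. i \<noteq> j \<longrightarrow> f i x * f j x = 0)"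
proof -
  \<comment> \<open>Squared radii; starting at \<open>i + 2\<close> keeps the outermost shell
    strictly inside the ball.\<close>
  define a where "a i = R\<^sup>2 / real (i + 2)" for i :: nat
  have R2: "R\<^sup>2 > 0" using assms by simp
  have a_less: "a i < R\<^sup>2" "a i > 0" for i using R2 by (auto simp: a_def field_simps intro: add_pos_nonneg)
  have a_mono: "a j \<le> a i" if "i \<le> j" for i j
    unfolding a_def using R2 that by (intro divide_left_mono mult_pos_pos) auto
  have a_Suc: "a (Suc i) < a i" for i
    unfolding a_def using R2 by (intro divide_strict_left_mono mult_pos_pos) auto
  define f where "f i x = exp_bump 1 ((x \<bullet> x + - a (Suc i)) * (a i + (-1) * (x \<bullet> x)))" for i and x :: "real^'n"
  have nz: "f i x \<noteq> 0 \<longleftrightarrow> a (Suc i) < x \<bullet> x \<and> x \<bullet> x < a i" for i x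
    using a_Suc[of i] by (auto simp: f_def exp_bump_def zero_less_mult_iff)
  have "f i \<in> test_functions (ball 0 R)" for i
    unfolding test_functions_iff
  proof (intro conjI allI exI[of _ "cball 0 (sqrt (a i))"])
    show "cont_diff_on m UNIV (f i)" for m unfolding f_def
      by (intro cont_diff_on_exp_bump cont_diff_on_mult cont_diff_on_add cont_diff_on_inner_self cont_diff_on_const open_UNIV)
    have "sqrt (a i) < R" using a_less[of i] assms by (intro real_less_lsqrt) auto
    then show "cball 0 (sqrt (a i)) \<subseteq> ball (0 :: real^'n) R" by auto
    show "x \<notin> cball 0 (sqrt (a i)) \<longrightarrow> f i x = 0" for x
      using nz[of i x] by (auto simp: norm_eq_sqrt_inner)
  qed auto
  moreover have "\<exists>x. f i x \<noteq> 0" for i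
  proof -
    obtain t where t: "a (Suc i) < t" "t < a i" using dense[OF a_Suc] by blast
    then have "t > 0" using a_less(2)[of "Suc i"] by simp
    \<comment> \<open>Any coordinate direction serves to place a point in the shell.\<close>
    fix j :: 'n
    have "(sqrt t *\<^sub>R axis j 1) \<bullet> (sqrt t *\<^sub>R (axis j 1 :: real^'n)) = t"
      using \<open>t > 0\<close> by (simp add: inner_axis_axis)
    then show ?thesis using nz t by metis
  qed
  moreover have "f i x * f j x = 0" if "i < j" for i j x
  proof (rule ccontr)
    assume "f i x * f j x \<noteq> 0"
    then have "a (Suc i) < x \<bullet> x" "x \<bullet> x < a j" using nz by auto
    then show False using a_mono[of "Suc i" j] that by simp
  qed
  then have "f i x * f j x = 0" if "i \<noteq> j" for i j x
    using that by (metis linorder_neqE_nat mult.commute)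
  ultimately show ?thesis by blast
qed

section \<open>The inequalities of Poincare and Rellich\<close>

lemma integrable_compact_support:
  fixes f :: "real^'n::finite \<Rightarrow> real"
  assumes "compact K" "continuous_on K f" "\<And>x. x \<notin> K \<Longrightarrow> f x = 0"
  shows "integrable lborel f"
proof -
  have "f = (\<lambda>x. indicator K x *\<^sub>R f x)" by (rule ext) (auto simp: indicator_def assms(3))
  then show ?thesis using borel_integrable_compact[OF assms(1,2)] by simp
qed

lemma borel_measurable_test [measurable_dest]:
  "\<phi> \<in> test_functions \<Omega> \<Longrightarrow> \<phi> \<in> borel_measurable borel"
  by (rule borel_measurable_continuous_onI) (rule test_functions_continuous)

lemma integrable_test_mult:
  fixes g :: "real^'n::finite \<Rightarrow> real"
  assumes "\<phi> \<in> test_functions \<Omega>" "continuous_on \<Omega> g"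
  shows "integrable lborel (\<lambda>x. \<phi> x * g x)"
proof -
  obtain K where K: "compact K" "K \<subseteq> \<Omega>" "\<And>x. x \<notin> K \<Longrightarrow> \<phi> x = 0"
    using assms(1) by (metis test_functionsE)
  show ?thesis
    by (rule integrable_compact_support[OF K(1)])
       (use K continuous_on_subset[OF test_functions_continuous[OF assms(1)]]
          continuous_on_subset[OF assms(2)] in \<open>auto intro!: continuous_on_mult\<close>)
qed

lemma integrable_test: "\<phi> \<in> test_functions \<Omega> \<Longrightarrow> integrable lborel (\<phi> :: real^'n::finite \<Rightarrow> real)"
  using integrable_test_mult[of \<phi> \<Omega> "\<lambda>_. 1"] by simp

lemma integrable_test_test:
  "\<phi> \<in> test_functions \<Omega> \<Longrightarrow> \<psi> \<in> test_functions \<Omega> \<Longrightarrow>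
   integrable lborel (\<lambda>x :: real^'n::finite. \<phi> x * \<psi> x)"
  using integrable_test_mult[of \<phi> \<Omega> \<psi>] test_functions_continuous continuous_on_subset by blast

lemma integrable_test_square:
  "\<phi> \<in> test_functions \<Omega> \<Longrightarrow> integrable lborel (\<lambda>x :: real^'n::finite. (\<phi> x)\<^sup>2)"
  unfolding power2_eq_square by (rule integrable_test_test)

lemma test_functions_bounded:
  assumes "\<phi> \<in> test_functions (\<Omega> :: (real^'n::finite) set)"
  shows "\<exists>B. \<forall>x. \<bar>\<phi> x\<bar> \<le> B"
proof -
  obtain K where K: "compact K" "\<And>x. x \<notin> K \<Longrightarrow> \<phi> x = 0" using assms by (metis test_functionsE)
  have "bounded (\<phi> ` K)"
    using K(1) continuous_on_subset[OF test_functions_continuous[OF assms]]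
    by (intro compact_imp_bounded compact_continuous_image) auto
  then obtain B where B: "\<And>x. x \<in> K \<Longrightarrow> \<bar>\<phi> x\<bar> \<le> B" by (auto simp: bounded_iff)
  have "\<bar>\<phi> x\<bar> \<le> max B 0" for x using B[of x] K(2)[of x] by (cases "x \<in> K") auto
  then show ?thesis by blast
qed

lemma coord_grad_bounded:
  assumes "\<phi> \<in> test_functions (\<Omega> :: (real^'n::finite) set)"
  obtains B where "B \<ge> 0" "\<And>x. norm (coord_grad \<phi> x) \<le> B"
proof -
  have "\<exists>B. \<forall>x. \<bar>partial_deriv i \<phi> x\<bar> \<le> B" for i
    by (rule test_functions_bounded[OF test_functions_partial_deriv[OF assms]])
  then obtain B where B: "\<And>i x. \<bar>partial_deriv i \<phi> x\<bar> \<le> B i" by metis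
  have "norm (coord_grad \<phi> x) \<le> (\<Sum>i\<in>UNIV. B i)" for x
    using norm_le_l1_cart[of "coord_grad \<phi> x"] sum_mono[of UNIV "\<lambda>i. \<bar>partial_deriv i \<phi> x\<bar>" B] B
    by (auto simp: coord_grad_def intro: order_trans)
  moreover from this[of 0] have "(\<Sum>i\<in>UNIV. B i) \<ge> 0" using norm_ge_zero order_trans by blast
  ultimately show thesis using that by blast
qed

lemma continuous_on_coord_grad:
  "\<phi> \<in> test_functions \<Omega> \<Longrightarrow> continuous_on UNIV (coord_grad (\<phi> :: real^'n::finite \<Rightarrow> real))"
  unfolding coord_grad_def
  by (intro continuous_on_vec_lambda test_functions_continuous test_functions_partial_deriv)

lemma borel_measurable_coord_grad [measurable_dest]:
  "\<phi> \<in> test_functions \<Omega> \<Longrightarrow> coord_grad (\<phi> :: real^'n::finite \<Rightarrow> real) \<in> borel_measurable borel"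
  by (rule borel_measurable_continuous_onI) (rule continuous_on_coord_grad)

lemma coord_grad_eq_0:
  assumes "compact K" "\<And>x. x \<notin> K \<Longrightarrow> \<phi> x = 0" "x \<notin> K"
  shows "coord_grad \<phi> x = 0"
proof -
  have "open (- K)" using compact_imp_closed[OF assms(1)] by (rule open_Compl)
  then have "partial_deriv i \<phi> x = 0" for i
    using partial_deriv_cong[of "- K" x \<phi> "\<lambda>_. 0" i] assms by (simp add: partial_deriv_const)
  then show ?thesis by (simp add: coord_grad_def vec_eq_iff)
qed

lemma integrable_grad_grad:
  fixes g :: "real^'n::finite \<Rightarrow> real"
  assumes \<phi>: "\<phi> \<in> test_functions \<Omega>" and \<psi>: "\<psi> \<in> test_functions \<Omega>" and g: "continuous_on \<Omega> g"
  shows "integrable lborel (\<lambda>x. g x * (coord_grad \<phi> x \<bullet> coord_grad \<psi> x))"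
proof -
  have "integrable lborel (\<lambda>x. partial_deriv i \<phi> x * (partial_deriv i \<psi> x * g x))" for i
    by (rule integrable_test_mult[OF test_functions_partial_deriv[OF \<phi>]])
       (use continuous_on_subset[OF test_functions_continuous[OF test_functions_partial_deriv[OF \<psi>]]] g in
         \<open>auto intro!: continuous_on_mult\<close>)
  then have "integrable lborel (\<lambda>x. \<Sum>i\<in>UNIV. partial_deriv i \<phi> x * (partial_deriv i \<psi> x * g x))"
    by (rule Bochner_Integration.integrable_sum)
  then show ?thesis by (simp add: inner_vec_def coord_grad_def sum_distrib_left mult_ac)
qed

lemma test_functions_Lipschitz:
  assumes "\<phi> \<in> test_functions (\<Omega> :: (real^'n::finite) set)" "\<And>x. norm (coord_grad \<phi> x) \<le> B"
  shows "\<bar>\<phi> x - \<phi> y\<bar> \<le> B * norm (x - y)"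
proof -
  have "norm (\<phi> x - \<phi> y) \<le> B * norm (x - y)"
  proof (rule differentiable_bound[of UNIV \<phi> "\<lambda>x h. coord_grad \<phi> x \<bullet> h"])
    show "(\<phi> has_derivative (\<bullet>) (coord_grad \<phi> x)) (at x)" for x
      by (rule has_derivative_coord_grad[OF test_functions_differentiable[OF assms(1)]])
    show "onorm ((\<bullet>) (coord_grad \<phi> x)) \<le> B" for x
    proof (rule onorm_le)
      fix h
      have "\<bar>coord_grad \<phi> x \<bullet> h\<bar> \<le> norm (coord_grad \<phi> x) * norm h" by (rule Cauchy_Schwarz_ineq2)
      also have "\<dots> \<le> B * norm h" by (intro mult_right_mono assms) simp
      finally show "norm (coord_grad \<phi> x \<bullet> h) \<le> B * norm h" by simp
    qed
  qed auto
  then show ?thesis by simp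
qed

section \<open>Difference quotients and integration by parts\<close>

definition diff_quot :: "(real^'n::finite \<Rightarrow> real) \<Rightarrow> real^'n \<Rightarrow> nat \<Rightarrow> real^'n \<Rightarrow> real" where
  "diff_quot \<phi> z N x = real (Suc N) * (\<phi> (x + inverse (real (Suc N)) *\<^sub>R z) - \<phi> x)"

lemma diff_quot_tendsto:
  assumes "\<phi> differentiable (at x)"
  shows "(\<lambda>N. diff_quot \<phi> z N x) \<longlonglongrightarrow> coord_grad \<phi> x \<bullet> z"
proof -
  have "((\<lambda>s. x + s *\<^sub>R z) has_derivative (\<lambda>s. s *\<^sub>R z)) (at 0)"
    by (auto intro!: derivative_eq_intros)
  moreover have "(\<phi> has_derivative (\<bullet>) (coord_grad \<phi> x)) (at (x + 0 *\<^sub>R z))"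
    using has_derivative_coord_grad[OF assms] by simp
  ultimately have "((\<lambda>s. \<phi> (x + s *\<^sub>R z)) has_derivative (\<lambda>s. coord_grad \<phi> x \<bullet> (s *\<^sub>R z))) (at 0)"
    by (rule has_derivative_compose)
  then have "((\<lambda>s. \<phi> (x + s *\<^sub>R z)) has_real_derivative (coord_grad \<phi> x \<bullet> z)) (at 0)"
    by (rule has_derivative_imp_has_field_derivative) simp
  then have lim: "((\<lambda>s. (\<phi> (x + s *\<^sub>R z) - \<phi> x) / s) \<longlongrightarrow> coord_grad \<phi> x \<bullet> z) (at 0)"
    by (simp add: has_field_derivative_iff)
  have "filterlim (\<lambda>N. inverse (real (Suc N))) (at 0) sequentially"
    by (rule filterlim_atI[OF LIMSEQ_inverse_real_of_nat]) auto
  from filterlim_compose[OF lim this] show ?thesis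
    unfolding diff_quot_def by (simp add: field_simps del: of_nat_Suc)
qed

text \<open>Majorant for dominated convergence: a Lipschitz bound, on a ball enlarged by |z| because
  the step lengths are at most 1.\<close>

lemma diff_quot_dominated:
  assumes \<phi>: "\<phi> \<in> test_functions (\<Omega> :: (real^'n::finite) set)"
  obtains B M where "B \<ge> 0" "\<And>N x. \<bar>diff_quot \<phi> z N x\<bar> \<le> B * indicator (cball 0 M) x"
proof -
  obtain K where K: "compact K" "\<And>x. x \<notin> K \<Longrightarrow> \<phi> x = 0" using \<phi> by (metis test_functionsE)
  obtain B where B: "B \<ge> 0" "\<And>x. norm (coord_grad \<phi> x) \<le> B" using coord_grad_bounded[OF \<phi>] by metis
  obtain M where M: "\<And>x. x \<in> K \<Longrightarrow> norm x \<le> M" using compact_imp_bounded[OF K(1)] by (auto simp: bounded_iff)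
  have "\<bar>diff_quot \<phi> z N x\<bar> \<le> (B * norm z) * indicator (cball 0 (M + norm z)) x" for N x
  proof -
    let ?t = "inverse (real (Suc N))"
    have t: "0 < ?t" "?t \<le> 1" by (auto simp: field_simps)
    show ?thesis
    proof (cases "x \<in> cball 0 (M + norm z)")
      case True
      have "\<bar>\<phi> (x + ?t *\<^sub>R z) - \<phi> x\<bar> \<le> B * norm (?t *\<^sub>R z)"
        using test_functions_Lipschitz[OF \<phi> B(2), of "x + ?t *\<^sub>R z" x] by simp
      also have "\<dots> = ?t * (B * norm z)" by simp
      finally have "real (Suc N) * \<bar>\<phi> (x + ?t *\<^sub>R z) - \<phi> x\<bar> \<le> real (Suc N) * (?t * (B * norm z))"
        by (rule mult_left_mono) simp
      also have "\<dots> = B * norm z" by (simp del: of_nat_Suc)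
      finally show ?thesis using True by (simp add: diff_quot_def abs_mult del: of_nat_Suc)
    next
      case False
      have "norm x \<le> norm (x + ?t *\<^sub>R z) + norm (?t *\<^sub>R z)"
        by (metis add_diff_cancel_right' norm_triangle_ineq4)
      moreover have "norm (?t *\<^sub>R z) \<le> norm z" using t mult_left_le_one_le[of "norm z" ?t] by simp
      ultimately have "norm (x + ?t *\<^sub>R z) > M" "norm x > M" using False norm_ge_zero[of z] by (simp_all del: norm_ge_zero)
      then have "x + ?t *\<^sub>R z \<notin> K" "x \<notin> K" using M by fastforce+
      then show ?thesis using K(2) B(1) by (simp add: diff_quot_def)
    qed
  qed
  then show thesis using that B(1) by (metis mult_nonneg_nonneg norm_ge_zero)
qed

lemma integrable_indicator_cball: "integrable lborel (\<lambda>x :: real^'n::finite. (B::real) * indicator (cball 0 M) x)"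
  by (intro integrable_mult_right integrable_real_indicator) (auto simp: emeasure_lborel_cball_finite[unfolded infinity_ennreal_def])

lemma integral_translate:
  fixes f :: "real^'n::finite \<Rightarrow> real"
  assumes "f \<in> borel_measurable borel"
  shows "(LINT x|lborel. f (x + c)) = (LINT x|lborel. f x)"
proof -
  have "(LINT x|lborel. f x) = (LINT x|distr lborel borel ((+) c). f x)" by (simp only: lborel_distr_plus)
  also have "\<dots> = (LINT x|lborel. f (c + x))" using assms by (intro integral_distr) auto
  finally show ?thesis by (simp add: add.commute)
qed

lemma integrable_translate:
  fixes f :: "real^'n::finite \<Rightarrow> real"
  assumes "integrable lborel f"
  shows "integrable lborel (\<lambda>x. f (x + c))"
proof -
  have "integrable (distr lborel borel ((+) c)) f" using assms by (simp only: lborel_distr_plus)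
  then have "integrable lborel (\<lambda>x. f (c + x))"
    using assms by (subst (asm) integrable_distr_eq) auto
  then show ?thesis by (simp add: add.commute)
qed

text \<open>Translation invariance makes the integral of every difference quotient zero. All
  integrations by parts below rest on this.\<close>

lemma integral_partial_deriv:
  assumes \<phi>: "\<phi> \<in> test_functions (\<Omega> :: (real^'n::finite) set)"
  shows "(LINT x|lborel. partial_deriv i \<phi> x) = 0"
proof -
  note [measurable] = borel_measurable_test[OF \<phi>]
  have grad: "coord_grad \<phi> x \<bullet> axis i 1 = partial_deriv i \<phi> x" for x
    by (simp add: inner_axis coord_grad_def)
  obtain B M where B: "B \<ge> 0" "\<And>N x. \<bar>diff_quot \<phi> (axis i 1) N x\<bar> \<le> B * indicator (cball 0 M) x"
    using diff_quot_dominated[OF \<phi>] by metis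
  have "(\<lambda>N. LINT x|lborel. diff_quot \<phi> (axis i 1) N x) \<longlonglongrightarrow> (LINT x|lborel. coord_grad \<phi> x \<bullet> axis i 1)"
  proof (rule integral_dominated_convergence[where w = "\<lambda>x. B * indicator (cball 0 M) x"])
    show "(\<lambda>x. coord_grad \<phi> x \<bullet> axis i 1) \<in> borel_measurable lborel"
      using borel_measurable_test[OF test_functions_partial_deriv[OF \<phi>]] by (simp add: grad)
    show "(\<lambda>x. diff_quot \<phi> (axis i 1) N x) \<in> borel_measurable lborel" for N
      unfolding diff_quot_def by measurable
    show "AE x in lborel. (\<lambda>N. diff_quot \<phi> (axis i 1) N x) \<longlonglongrightarrow> coord_grad \<phi> x \<bullet> axis i 1"
      by (intro AE_I2 diff_quot_tendsto test_functions_differentiable[OF \<phi>])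
    show "AE x in lborel. norm (diff_quot \<phi> (axis i 1) N x) \<le> B * indicator (cball 0 M) x" for N
      using B by (intro AE_I2) simp
  qed (rule integrable_indicator_cball)
  moreover have "(LINT x|lborel. diff_quot \<phi> (axis i 1) N x) = 0" for N
    unfolding diff_quot_def
    using integrable_translate[OF integrable_test[OF \<phi>]] integrable_test[OF \<phi>]
    by (simp add: integral_translate Bochner_Integration.integral_diff)
  ultimately show ?thesis by (simp add: grad LIMSEQ_const_iff)
qed

definition dirichlet_energy :: "(real^'n::finite \<Rightarrow> real) \<Rightarrow> real" where
  "dirichlet_energy \<phi> = (LINT x|lborel. coord_grad \<phi> x \<bullet> coord_grad \<phi> x)"

lemma integrable_grad_sq:
  "\<phi> \<in> test_functions \<Omega> \<Longrightarrow> integrable lborel (\<lambda>x. coord_grad \<phi> x \<bullet> coord_grad (\<phi> :: real^'n::finite \<Rightarrow> real) x)"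
  using integrable_grad_grad[of \<phi> \<Omega> \<phi> "\<lambda>_. 1"] by simp

lemma dirichlet_energy_nonneg: "0 \<le> dirichlet_energy \<phi>"
  unfolding dirichlet_energy_def by (rule integral_nonneg_AE) auto

text \<open>A translation by z is composed of N + 1 translations by z / (N + 1). Telescoping and
  Cauchy-Schwarz bound the left side by the integral of the squared difference quotient for every N,
  and then N tends to infinity.\<close>

lemma translation_energy:
  assumes \<phi>: "\<phi> \<in> test_functions (\<Omega> :: (real^'n::finite) set)"
  shows "(LINT x|lborel. (\<phi> (x + z) - \<phi> x)\<^sup>2) \<le> (norm z)\<^sup>2 * dirichlet_energy \<phi>"
    and "integrable lborel (\<lambda>x. (\<phi> (x + z) - \<phi> x)\<^sup>2)"
proof -
  note [measurable] = borel_measurable_test[OF \<phi>]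
  have int: "integrable lborel (\<lambda>x. (\<phi> (x + c) - \<phi> (x + d))\<^sup>2)" for c d
  proof (rule Bochner_Integration.integrable_bound)
    show "integrable lborel (\<lambda>x. 2 * (\<phi> (x + c))\<^sup>2 + 2 * (\<phi> (x + d))\<^sup>2)"
      using integrable_test_square[OF \<phi>]
      by (intro Bochner_Integration.integrable_add integrable_mult_right
          integrable_translate[of "\<lambda>x. (\<phi> x)\<^sup>2"]) auto
    have "(a - b)\<^sup>2 \<le> 2 * a\<^sup>2 + 2 * b\<^sup>2" for a b :: real
      using zero_le_power2[of "a + b"] by (simp add: power2_diff power2_sum)
    then show "AE x in lborel. norm ((\<phi> (x + c) - \<phi> (x + d))\<^sup>2) \<le> norm (2 * (\<phi> (x + c))\<^sup>2 + 2 * (\<phi> (x + d))\<^sup>2)"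
      by simp
  qed measurable
  show "integrable lborel (\<lambda>x. (\<phi> (x + z) - \<phi> x)\<^sup>2)" using int[of z 0] by simp
  have le: "(LINT x|lborel. (\<phi> (x + z) - \<phi> x)\<^sup>2) \<le> (LINT x|lborel. (diff_quot \<phi> z N x)\<^sup>2)" for N
  proof -
    let ?t = "inverse (real (Suc N))"
    let ?d = "\<lambda>j x. \<phi> (x + (real (Suc j) * ?t) *\<^sub>R z) - \<phi> (x + (real j * ?t) *\<^sub>R z)"
    have tel: "\<phi> (x + z) - \<phi> x = (\<Sum>j<Suc N. ?d j x)" for x
      using sum_lessThan_telescope[of "\<lambda>j. \<phi> (x + (real j * ?t) *\<^sub>R z)" "Suc N"] by (simp del: of_nat_Suc sum.lessThan_Suc)
    have shift: "(LINT x|lborel. (?d j x)\<^sup>2) = (LINT x|lborel. (\<phi> (x + ?t *\<^sub>R z) - \<phi> x)\<^sup>2)" for j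
    proof -
      have "x + (real (Suc j) * ?t) *\<^sub>R z = (x + (real j * ?t) *\<^sub>R z) + ?t *\<^sub>R z" for x
        by (simp add: algebra_simps)
      then show ?thesis
        using integral_translate[of "\<lambda>x. (\<phi> (x + ?t *\<^sub>R z) - \<phi> x)\<^sup>2" "(real j * ?t) *\<^sub>R z"]
        by (simp del: of_nat_Suc add: add.assoc)
    qed
    have "(LINT x|lborel. (\<phi> (x + z) - \<phi> x)\<^sup>2) \<le> (LINT x|lborel. (\<Sum>j<Suc N. (?d j x)\<^sup>2) * real (Suc N))"
    proof (rule integral_mono)
      show "integrable lborel (\<lambda>x. (\<phi> (x + z) - \<phi> x)\<^sup>2)" using int[of z 0] by simp
      show "integrable lborel (\<lambda>x. (\<Sum>j<Suc N. (?d j x)\<^sup>2) * real (Suc N))"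
        by (intro integrable_mult_left Bochner_Integration.integrable_sum int)
      show "(\<phi> (x + z) - \<phi> x)\<^sup>2 \<le> (\<Sum>j<Suc N. (?d j x)\<^sup>2) * real (Suc N)" for x
        unfolding tel using sum_squared_le_sum_of_squares[of "\<lambda>j. ?d j x" "{..<Suc N}"] by simp
    qed
    also have "\<dots> = (\<Sum>j<Suc N. LINT x|lborel. (?d j x)\<^sup>2) * real (Suc N)"
    proof -
      have "integrable lborel (\<lambda>x. (?d j x)\<^sup>2)" for j by (rule int)
      then show ?thesis by (simp only: integral_mult_left_zero Bochner_Integration.integral_sum)
    qed
    also have "\<dots> = (\<Sum>j<Suc N. LINT x|lborel. (\<phi> (x + ?t *\<^sub>R z) - \<phi> x)\<^sup>2) * real (Suc N)"
      by (simp only: shift)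
    also have "\<dots> = (LINT x|lborel. (diff_quot \<phi> z N x)\<^sup>2)"
      unfolding diff_quot_def power_mult_distrib by (simp add: power2_eq_square mult_ac)
    finally show ?thesis .
  qed
  obtain B M where B: "B \<ge> 0" "\<And>N x. \<bar>diff_quot \<phi> z N x\<bar> \<le> B * indicator (cball 0 M) x"
    using diff_quot_dominated[OF \<phi>] by metis
  have "(\<lambda>N. LINT x|lborel. (diff_quot \<phi> z N x)\<^sup>2) \<longlonglongrightarrow> (LINT x|lborel. (coord_grad \<phi> x \<bullet> z)\<^sup>2)"
  proof (rule integral_dominated_convergence[where w = "\<lambda>x. B\<^sup>2 * indicator (cball 0 M) x"])
    show "(\<lambda>x. (coord_grad \<phi> x \<bullet> z)\<^sup>2) \<in> borel_measurable lborel"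
      using borel_measurable_coord_grad[OF \<phi>] by measurable
    show "(\<lambda>x. (diff_quot \<phi> z N x)\<^sup>2) \<in> borel_measurable lborel" for N
      unfolding diff_quot_def by measurable
    show "AE x in lborel. (\<lambda>N. (diff_quot \<phi> z N x)\<^sup>2) \<longlonglongrightarrow> (coord_grad \<phi> x \<bullet> z)\<^sup>2"
      by (intro AE_I2 tendsto_power diff_quot_tendsto test_functions_differentiable[OF \<phi>])
    show "AE x in lborel. norm ((diff_quot \<phi> z N x)\<^sup>2) \<le> B\<^sup>2 * indicator (cball 0 M) x" for N
    proof (rule AE_I2)
      fix x
      have "\<bar>diff_quot \<phi> z N x\<bar>\<^sup>2 \<le> (B * indicator (cball 0 M) x)\<^sup>2"
        using B(2) by (intro power_mono) auto
      also have "\<dots> = B\<^sup>2 * indicator (cball 0 M) x" by (simp add: indicator_def power_mult_distrib)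
      finally show "norm ((diff_quot \<phi> z N x)\<^sup>2) \<le> B\<^sup>2 * indicator (cball 0 M) x" by simp
    qed
  qed (rule integrable_indicator_cball)
  then have "(LINT x|lborel. (\<phi> (x + z) - \<phi> x)\<^sup>2) \<le> (LINT x|lborel. (coord_grad \<phi> x \<bullet> z)\<^sup>2)"
    using le by (intro LIMSEQ_le_const) auto
  also have "\<dots> \<le> (LINT x|lborel. (norm z)\<^sup>2 * (coord_grad \<phi> x \<bullet> coord_grad \<phi> x))"
  proof (rule integral_mono')
    show "integrable lborel (\<lambda>x. (norm z)\<^sup>2 * (coord_grad \<phi> x \<bullet> coord_grad \<phi> x))"
      by (intro integrable_mult_right integrable_grad_sq[OF \<phi>])
    show "(coord_grad \<phi> x \<bullet> z)\<^sup>2 \<le> (norm z)\<^sup>2 * (coord_grad \<phi> x \<bullet> coord_grad \<phi> x)" for x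
      using Cauchy_Schwarz_ineq[of "coord_grad \<phi> x" z] by (simp add: power2_norm_eq_inner mult.commute)
  qed simp
  finally show "(LINT x|lborel. (\<phi> (x + z) - \<phi> x)\<^sup>2) \<le> (norm z)\<^sup>2 * dirichlet_energy \<phi>"
    by (simp add: dirichlet_energy_def)
qed

lemma Poincare_inequality:
  assumes \<phi>: "\<phi> \<in> test_functions (ball (0 :: real^'n::finite) R)"
  shows "(LINT x|lborel. (\<phi> x)\<^sup>2) \<le> 4 * R\<^sup>2 * dirichlet_energy \<phi>"
proof -
  fix i :: 'n
  note p\<phi> = test_functions_partial_deriv[OF \<phi>, of i]
  let ?F = "\<lambda>x. \<phi> x * (x $ i * \<phi> x)"
  have cd: "cont_diff_on m S \<phi>" for m S
    using test_functions_cont_diff[OF \<phi>] cont_diff_on_subset by blast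
  have F: "?F \<in> test_functions (ball 0 R)"
    by (intro test_functions_mult[OF \<phi>] cont_diff_on_mult cd) auto
  have dF: "partial_deriv i ?F x = (\<phi> x)\<^sup>2 + 2 * (\<phi> x * (x $ i) * partial_deriv i \<phi> x)" for x
  proof -
    have d: "\<phi> differentiable (at x)" by (rule test_functions_differentiable[OF \<phi>])
    then have "(\<lambda>x. x $ i * \<phi> x) differentiable (at x)"
      by (intro differentiable_mult differentiable_component)
    then show ?thesis using d
      by (simp add: partial_deriv_mult differentiable_component partial_deriv_component power2_eq_square algebra_simps)
  qed
  \<comment> \<open>The derivative of x_i \<phi>^2 in direction i has integral zero; subtracting it
    twice turns \<phi>^2 into -\<phi>^2 plus a cross term, and completing the square leaves at most
    4 x_i^2 (d_i \<phi>)^2. Hence the constant 4 R^2.\<close>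
  have "(LINT x|lborel. (\<phi> x)\<^sup>2) = (LINT x|lborel. (\<phi> x)\<^sup>2) - 2 * (LINT x|lborel. partial_deriv i ?F x)"
    by (simp only: integral_partial_deriv[OF F])
  also have "\<dots> = (LINT x|lborel. (\<phi> x)\<^sup>2 - 2 * partial_deriv i ?F x)"
    using integrable_test_square[OF \<phi>] integrable_test[OF test_functions_partial_deriv[OF F]] by simp
  also have "\<dots> \<le> (LINT x|lborel. 4 * R\<^sup>2 * (coord_grad \<phi> x \<bullet> coord_grad \<phi> x))"
  proof (rule integral_mono)
    show "integrable lborel (\<lambda>x. (\<phi> x)\<^sup>2 - 2 * partial_deriv i ?F x)"
      using integrable_test_square[OF \<phi>] integrable_test[OF test_functions_partial_deriv[OF F]] by simp
    show "integrable lborel (\<lambda>x. 4 * R\<^sup>2 * (coord_grad \<phi> x \<bullet> coord_grad \<phi> x))"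
      by (intro integrable_mult_right integrable_grad_sq[OF \<phi>])
    fix x
    let ?d = "partial_deriv i \<phi> x"
    show "(\<phi> x)\<^sup>2 - 2 * partial_deriv i ?F x \<le> 4 * R\<^sup>2 * (coord_grad \<phi> x \<bullet> coord_grad \<phi> x)"
    proof (cases "x \<in> ball 0 R")
      case True
      have "\<bar>x $ i\<bar> \<le> R" using component_le_norm_cart[of x i] True by simp
      then have xR: "(x $ i)\<^sup>2 \<le> R\<^sup>2" by (simp add: power2_le_iff_abs_le)
      have "(\<phi> x)\<^sup>2 - 2 * partial_deriv i ?F x = - (\<phi> x)\<^sup>2 - 4 * (\<phi> x * (x $ i) * ?d)" unfolding dF by simp
      also have "\<dots> \<le> 4 * ((x $ i)\<^sup>2 * ?d\<^sup>2)"
        using zero_le_power2[of "\<phi> x + 2 * (x $ i) * ?d"] by (simp add: power2_sum power_mult_distrib mult_ac)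
      also have "\<dots> \<le> 4 * (R\<^sup>2 * (coord_grad \<phi> x \<bullet> coord_grad \<phi> x))"
      proof (intro mult_left_mono mult_mono xR)
        have "?d * ?d \<le> (\<Sum>j\<in>UNIV. partial_deriv j \<phi> x * partial_deriv j \<phi> x)"
          by (rule member_le_sum[of i]) auto
        then show "?d\<^sup>2 \<le> coord_grad \<phi> x \<bullet> coord_grad \<phi> x"
          by (simp add: inner_vec_def coord_grad_def power2_eq_square)
      qed auto
      finally show ?thesis by simp
    next
      case False
      then have "\<phi> x = 0" using test_functions_eq_0[OF \<phi>] by blast
      then show ?thesis unfolding dF by simp
    qed
  qed
  also have "\<dots> = 4 * R\<^sup>2 * dirichlet_energy \<phi>" by (simp add: dirichlet_energy_def)
  finally show ?thesis .
qed

section \<open>Local means and Rellich compactness\<close>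

lemma measure_ball_eq:
  "r \<ge> 0 \<Longrightarrow> measure lborel (ball c r) = r ^ CARD('n) * measure lborel (ball (0 :: real^'n::finite) 1)"
  for c :: "real^'n"
  using content_ball_conv_unit_ball[of r c] by simp

text \<open>Cauchy-Schwarz against the indicator, obtained from the nonnegative variance about the
  mean \<open>?t\<close>.\<close>

lemma mean_functional_bound:
  assumes \<phi>: "\<phi> \<in> test_functions (\<Omega> :: (real^'n::finite) set)" and b: "measure lborel (ball p h) > 0"
  shows "(LINT y|lborel. indicator (ball p h) y * \<phi> y)\<^sup>2
     \<le> measure lborel (ball p h) * (LINT y|lborel. (\<phi> y)\<^sup>2)"
proof -
  let ?B = "ball p h" and ?b = "measure lborel (ball p h)"
  let ?I = "LINT y|lborel. indicator ?B y * \<phi> y"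
  let ?J = "LINT y|lborel. indicator ?B y * (\<phi> y)\<^sup>2"
  note [measurable] = borel_measurable_test[OF \<phi>]
  have i0: "integrable lborel (\<lambda>y. indicator ?B y :: real)"
    using emeasure_lborel_ball_finite[of p h] by (intro integrable_real_indicator) auto
  have i1: "integrable lborel (\<lambda>y. indicator ?B y * \<phi> y)"
    using integrable_mult_indicator[OF _ integrable_test[OF \<phi>], of ?B] by simp
  have i2: "integrable lborel (\<lambda>y. indicator ?B y * (\<phi> y)\<^sup>2)"
    using integrable_mult_indicator[OF _ integrable_test_square[OF \<phi>], of ?B] by simp
  have m0: "(LINT y|lborel. indicator ?B y :: real) = ?b" by simp
  let ?t = "?I / ?b"
  have "0 \<le> (LINT y|lborel. indicator ?B y * (\<phi> y - ?t)\<^sup>2)" by (rule integral_nonneg_AE) auto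
  also have "\<dots> = (LINT y|lborel. indicator ?B y * (\<phi> y)\<^sup>2 - 2 * ?t * (indicator ?B y * \<phi> y) + ?t\<^sup>2 * indicator ?B y)"
    by (rule Bochner_Integration.integral_cong) (auto simp: power2_diff algebra_simps)
  also have "\<dots> = ?J - 2 * ?t * ?I + ?t\<^sup>2 * ?b"
    using i0 i1 i2 by (simp add: m0)
  finally have "?I\<^sup>2 \<le> ?b * ?J" using b by (simp add: field_simps power2_eq_square)
  also have "?J \<le> (LINT y|lborel. (\<phi> y)\<^sup>2)"
    using i2 integrable_test_square[OF \<phi>] by (intro integral_mono) (auto simp: indicator_def)
  finally show ?thesis using b by simp
qed

text \<open>Compares \<phi> x with its mean over a small ball containing x. The oscillation is taken
  over the larger ball about x itself, in the translation variable z, so that it no longer depends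
  on the small ball.\<close>

lemma pointwise_mean_estimate:
  assumes \<phi>: "\<phi> \<in> test_functions (\<Omega> :: (real^'n::finite) set)"
    and b: "b = measure lborel (ball p h)" "b > 0" and x: "x \<in> ball p h"
  shows "(\<phi> x)\<^sup>2 \<le> 2 / b * (LINT z|lborel. indicator (ball 0 (2 * h)) z * (\<phi> (z + x) - \<phi> x)\<^sup>2)
     + 4 / b\<^sup>2 * (LINT y|lborel. indicator (ball p h) y * \<phi> y)\<^sup>2"
    and "integrable lborel (\<lambda>z. indicator (ball 0 (2 * h)) z * (\<phi> (z + x) - \<phi> x)\<^sup>2)"
proof -
  let ?B = "ball p h" and ?B2 = "ball x (2 * h)"
  let ?I = "LINT y|lborel. indicator ?B y * \<phi> y"
  let ?J = "LINT y|lborel. indicator ?B y * (\<phi> y)\<^sup>2"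
  note [measurable] = borel_measurable_test[OF \<phi>]
  have i: "integrable lborel (\<lambda>y. indicator (ball q r) y :: real)"
    "integrable lborel (\<lambda>y. indicator (ball q r) y * \<phi> y)"
    "integrable lborel (\<lambda>y. indicator (ball q r) y * (\<phi> y)\<^sup>2)" for q r
    using emeasure_lborel_ball_finite[of q r] integrable_mult_indicator[OF _ integrable_test[OF \<phi>], of "ball q r"]
      integrable_mult_indicator[OF _ integrable_test_square[OF \<phi>], of "ball q r"]
    by auto
  have ex: "indicator (ball q r) y * (\<phi> y - c)\<^sup>2 =
      indicator (ball q r) y * (\<phi> y)\<^sup>2 - 2 * c * (indicator (ball q r) y * \<phi> y) + c\<^sup>2 * indicator (ball q r) y"
    for q r c y by (auto simp: power2_diff algebra_simps)
  have iq: "integrable lborel (\<lambda>y. indicator (ball q r) y * (\<phi> y - c)\<^sup>2)" for q r c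
    unfolding ex by (intro Bochner_Integration.integrable_add Bochner_Integration.integrable_diff integrable_mult_right i)
  have shift: "indicator (ball 0 (2 * h)) z = indicator ?B2 (z + x)" for z
    by (auto simp: indicator_def dist_norm norm_minus_commute)
  show "integrable lborel (\<lambda>z. indicator (ball 0 (2 * h)) z * (\<phi> (z + x) - \<phi> x)\<^sup>2)"
    unfolding shift by (rule integrable_translate[OF iq])
  have "(LINT z|lborel. indicator (ball 0 (2 * h)) z * (\<phi> (z + x) - \<phi> x)\<^sup>2)
      = (LINT y|lborel. indicator ?B2 y * (\<phi> y - \<phi> x)\<^sup>2)"
    unfolding shift
    by (rule integral_translate[of "\<lambda>y. indicator ?B2 y * (\<phi> y - \<phi> x)\<^sup>2"])
       (use borel_measurable_integrable[OF iq] in simp)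
  moreover have "(LINT y|lborel. indicator ?B y * (\<phi> y - \<phi> x)\<^sup>2) \<le> (LINT y|lborel. indicator ?B2 y * (\<phi> y - \<phi> x)\<^sup>2)"
  proof (rule integral_mono[OF iq iq])
    have "dist x y < 2 * h" if "y \<in> ?B" for y using x that dist_triangle[of x y p] by (simp add: dist_commute)
    then show "indicator ?B y * (\<phi> y - \<phi> x)\<^sup>2 \<le> indicator ?B2 y * (\<phi> y - \<phi> x)\<^sup>2" for y
      by (intro mult_right_mono) (auto simp: indicator_def)
  qed
  moreover have "(LINT y|lborel. indicator ?B y * (\<phi> y - \<phi> x)\<^sup>2) = ?J - 2 * \<phi> x * ?I + (\<phi> x)\<^sup>2 * b"
    unfolding ex using i[of p h] by (simp add: b)
  moreover have "?J \<ge> 0" by (rule integral_nonneg_AE) auto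
  ultimately have 1: "(\<phi> x)\<^sup>2 * b \<le> (LINT z|lborel. indicator (ball 0 (2 * h)) z * (\<phi> (z + x) - \<phi> x)\<^sup>2) + 2 * \<phi> x * ?I" (is "_ \<le> ?q + _")
    by argo
  \<comment> \<open>Young's inequality, weighted so that half of
    \<open>b\<^sup>2 * (\<phi> x)\<^sup>2\<close> is absorbed on the left.\<close>
  have "2 * (b * \<phi> x * ?I) \<le> (b * \<phi> x)\<^sup>2 / 2 + 2 * ?I\<^sup>2"
    using zero_le_power2[of "b * \<phi> x - 2 * ?I"] by (simp add: power2_diff power_mult_distrib)
  moreover have "b * (b * (\<phi> x)\<^sup>2) \<le> b * (?q + 2 * \<phi> x * ?I)" using 1 b(2) by (intro mult_left_mono) (auto simp: mult.commute)
  ultimately have "b\<^sup>2 * (\<phi> x)\<^sup>2 \<le> 2 * b * ?q + 4 * ?I\<^sup>2"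
    by (simp add: power2_eq_square algebra_simps)
  then show "(\<phi> x)\<^sup>2 \<le> 2 / b * ?q + 4 / b\<^sup>2 * ?I\<^sup>2"
    using b(2) by (simp add: field_simps power2_eq_square)
qed

text \<open>Tonelli puts the integration over x inside, where \<open>translation_energy\<close>
  applies for each fixed z.\<close>

lemma mean_oscillation_energy:
  assumes \<phi>: "\<phi> \<in> test_functions (\<Omega> :: (real^'n::finite) set)" and r: "r > 0"
  shows "(\<integral>\<^sup>+x. \<integral>\<^sup>+z. ennreal (indicator (ball 0 r) z * (\<phi> (z + x) - \<phi> x)\<^sup>2) \<partial>lborel \<partial>lborel)
     \<le> ennreal (r\<^sup>2 * dirichlet_energy \<phi> * measure lborel (ball (0 :: real^'n) r))"
proof -
  have [measurable]: "\<phi> \<in> borel_measurable borel" "ball (0 :: real^'n) r \<in> sets borel"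
    using borel_measurable_test[OF \<phi>] by auto
  have meas: "(\<lambda>(x, z). ennreal (indicator (ball 0 r) z * (\<phi> (z + x) - \<phi> x)\<^sup>2))
      \<in> borel_measurable ((lborel :: (real^'n) measure) \<Otimes>\<^sub>M lborel)"
    by measurable
  have "(\<integral>\<^sup>+x. \<integral>\<^sup>+z. ennreal (indicator (ball 0 r) z * (\<phi> (z + x) - \<phi> x)\<^sup>2) \<partial>lborel \<partial>lborel)
     = (\<integral>\<^sup>+z. \<integral>\<^sup>+x. ennreal (indicator (ball 0 r) z * (\<phi> (z + x) - \<phi> x)\<^sup>2) \<partial>lborel \<partial>lborel)"
    using lborel_pair.Fubini'[OF meas] by simp
  also have "\<dots> \<le> (\<integral>\<^sup>+z. ennreal (r\<^sup>2 * dirichlet_energy \<phi>) * indicator (ball (0 :: real^'n) r) z \<partial>lborel)"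
  proof (rule nn_integral_mono)
    fix z :: "real^'n"
    show "(\<integral>\<^sup>+x. ennreal (indicator (ball 0 r) z * (\<phi> (z + x) - \<phi> x)\<^sup>2) \<partial>lborel)
       \<le> ennreal (r\<^sup>2 * dirichlet_energy \<phi>) * indicator (ball 0 r) z"
    proof (cases "z \<in> ball 0 r")
      case True
      have "(\<integral>\<^sup>+x. ennreal (indicator (ball 0 r) z * (\<phi> (z + x) - \<phi> x)\<^sup>2) \<partial>lborel)
          = ennreal (LINT x|lborel. (\<phi> (x + z) - \<phi> x)\<^sup>2)"
        using True translation_energy(2)[OF \<phi>, of z] by (simp add: nn_integral_eq_integral add.commute)
      also have "(LINT x|lborel. (\<phi> (x + z) - \<phi> x)\<^sup>2) \<le> (norm z)\<^sup>2 * dirichlet_energy \<phi>"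
        by (rule translation_energy[OF \<phi>])
      also have "\<dots> \<le> r\<^sup>2 * dirichlet_energy \<phi>"
        using True by (intro mult_right_mono power_mono dirichlet_energy_nonneg) auto
      finally show ?thesis using True by (simp add: ennreal_leI)
    qed simp
  qed
  also have "\<dots> = ennreal (r\<^sup>2 * dirichlet_energy \<phi> * measure lborel (ball (0 :: real^'n) r))"
    using emeasure_lborel_ball_finite[of "0 :: real^'n" r]
    by (subst nn_integral_cmult_indicator)
       (auto simp: emeasure_eq_ennreal_measure ennreal_mult dirichlet_energy_nonneg)
  finally show ?thesis .
qed

text \<open>The functionals are multiples of the means over finitely many small balls covering the domain.\<close>

lemma Rellich:
  fixes R \<epsilon> :: real
  assumes R: "R > 0" and \<epsilon>: "\<epsilon> > 0"
  shows "\<exists>N (l :: nat \<Rightarrow> (real^'n::finite \<Rightarrow> real) \<Rightarrow> real) K. K \<ge> 0 \<and>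
     (\<forall>i. \<forall>\<phi>\<in>test_functions (ball 0 R). (l i \<phi>)\<^sup>2 \<le> K * (LINT x|lborel. (\<phi> x)\<^sup>2)) \<and>
     (\<forall>i. \<forall>\<phi>\<in>test_functions (ball 0 R). \<forall>\<psi>\<in>test_functions (ball 0 R). l i (\<phi> + \<psi>) = l i \<phi> + l i \<psi>) \<and>
     (\<forall>i. \<forall>\<phi>\<in>test_functions (ball 0 R). \<forall>r. l i (r *\<^sub>R \<phi>) = r * l i \<phi>) \<and>
     (\<forall>\<phi>\<in>test_functions (ball 0 R).
        (LINT x|lborel. (\<phi> x)\<^sup>2) \<le> \<epsilon> * dirichlet_energy \<phi> + (\<Sum>i<N. (l i \<phi>)\<^sup>2))"
proof -
  \<comment> \<open>In the final estimate the energy has the coefficient (2 / b) (2 h)^2 2^n b = 8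
    2^n h^2, which this choice makes equal to \<epsilon>.\<close>
  define h where "h = sqrt (\<epsilon> / (8 * 2 ^ CARD('n)))"
  have h: "h > 0" "h\<^sup>2 = \<epsilon> / (8 * 2 ^ CARD('n))" using \<epsilon> by (auto simp: h_def)
  define b where "b = measure lborel (ball (0 :: real^'n) h)"
  have b: "b > 0" using content_ball_pos[OF h(1), of "0 :: real^'n"] by (simp add: b_def)
  have bp: "measure lborel (ball p h) = b" for p :: "real^'n"
    using measure_ball_eq[of h p] measure_ball_eq[of h "0 :: real^'n"] h(1) by (simp add: b_def)
  have b2: "measure lborel (ball (0 :: real^'n) (2 * h)) = 2 ^ CARD('n) * b"
    using measure_ball_eq[of "2 * h" "0 :: real^'n"] measure_ball_eq[of h "0 :: real^'n"] h(1)
    by (simp add: b_def power_mult_distrib)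
  define v where "v = measure lborel (ball (0 :: real^'n) R)"
  have v: "v \<ge> 0" by (simp add: v_def)
  have cov: "cball (0 :: real^'n) R \<subseteq> (\<Union>p\<in>UNIV. ball p h)" using h(1) centre_in_ball by blast
  obtain C where "C \<subseteq> UNIV" and C: "finite C" "cball (0 :: real^'n) R \<subseteq> (\<Union>p\<in>C. ball p h)"
    by (rule compactE_image[OF compact_cball _ cov]) (rule open_ball)
  obtain p where p: "bij_betw p {..<card C} C"
    using ex_bij_betw_nat_finite[OF C(1)] by (auto simp: atLeast0LessThan)
  define N where "N = card C"
  have cover: "\<exists>i<N. x \<in> ball (p i) h" if "x \<in> ball 0 R" for x
  proof -
    have "x \<in> cball 0 R" using that by simp
    then have "x \<in> (\<Union>p\<in>C. ball p h)" using C(2) by blast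
    then obtain q where "q \<in> C" "x \<in> ball q h" by blast
    moreover from this(1) have "q \<in> p ` {..<N}" using p by (simp add: bij_betw_def N_def)
    ultimately show ?thesis by auto
  qed
  \<comment> \<open>Each mean enters as a constant, 4 / b^2 times its square, integrated over the
    ball of volume \<open>v\<close>; this factor is moved into the functional.\<close>
  define s where "s = sqrt (4 / b\<^sup>2 * v)"
  have s: "s\<^sup>2 = 4 / b\<^sup>2 * v" using v by (simp add: s_def)
  define l where "l i \<phi> = s * (LINT y|lborel. indicator (ball (p i) h) y * \<phi> y)" for i and \<phi> :: "real^'n \<Rightarrow> real"
  have ii: "integrable lborel (\<lambda>y. indicator (ball (p i) h) y * \<phi> y)" if "\<phi> \<in> test_functions (ball 0 R)" for i \<phi>
    using integrable_mult_indicator[OF _ integrable_test[OF that], of "ball (p i) h"] by simp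
  show ?thesis
  proof (intro exI[of _ N] exI[of _ l] exI[of _ "s\<^sup>2 * b"] conjI allI ballI)
    show "0 \<le> s\<^sup>2 * b" using b by simp
  next
    fix i \<phi> assume \<phi>: "\<phi> \<in> test_functions (ball (0 :: real^'n) R)"
    show "(l i \<phi>)\<^sup>2 \<le> s\<^sup>2 * b * (LINT x|lborel. (\<phi> x)\<^sup>2)"
      unfolding l_def power_mult_distrib mult.assoc
      using mean_functional_bound[OF \<phi>, of "p i" h] b by (intro mult_left_mono) (auto simp: bp)
    show "l i (r *\<^sub>R \<phi>) = r * l i \<phi>" for r
      by (simp add: l_def mult.left_commute)
    show "l i (\<phi> + \<psi>) = l i \<phi> + l i \<psi>" if "\<psi> \<in> test_functions (ball 0 R)" for \<psi>
      using ii[OF \<phi>] ii[OF that] by (simp add: l_def distrib_left)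
  next
    fix \<phi> assume \<phi>: "\<phi> \<in> test_functions (ball (0 :: real^'n) R)"
    define S where "S = (\<Sum>i<N. 4 / b\<^sup>2 * (LINT y|lborel. indicator (ball (p i) h) y * \<phi> y)\<^sup>2)"
    have S0: "S \<ge> 0" unfolding S_def by (intro sum_nonneg) auto
    have Sv: "S * v = (\<Sum>i<N. (l i \<phi>)\<^sup>2)"
      unfolding S_def sum_distrib_right l_def power_mult_distrib s by (intro sum.cong) auto
    let ?G = "\<lambda>x. \<integral>\<^sup>+z. ennreal (indicator (ball 0 (2 * h)) z * (\<phi> (z + x) - \<phi> x)\<^sup>2) \<partial>lborel"
    \<comment> \<open>\<open>S\<close> sums over all small balls, not only the one containing x, so
      they may overlap and no partition has to be chosen.\<close>
    have pw: "ennreal ((\<phi> x)\<^sup>2) \<le> ennreal (2 / b) * ?G x + ennreal S * indicator (ball 0 R) x" for x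
    proof (cases "x \<in> ball 0 R")
      case True
      then obtain i where i: "i < N" "x \<in> ball (p i) h" using cover by blast
      note est = pointwise_mean_estimate[OF \<phi> _ b i(2), unfolded bp, OF refl]
      let ?q = "LINT z|lborel. indicator (ball 0 (2 * h)) z * (\<phi> (z + x) - \<phi> x)\<^sup>2"
      have q0: "?q \<ge> 0" by (rule integral_nonneg_AE) auto
      have G: "?G x = ennreal ?q" using est(2) by (intro nn_integral_eq_integral) auto
      have "4 / b\<^sup>2 * (LINT y|lborel. indicator (ball (p i) h) y * \<phi> y)\<^sup>2 \<le> S"
        unfolding S_def using i by (intro member_le_sum) auto
      then have "(\<phi> x)\<^sup>2 \<le> 2 / b * ?q + S" using est(1) by linarith
      then have "ennreal ((\<phi> x)\<^sup>2) \<le> ennreal (2 / b * ?q + S)" by (rule ennreal_leI)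
      also have "\<dots> = ennreal (2 / b) * ennreal ?q + ennreal S"
        using q0 S0 b by (simp only: ennreal_mult[symmetric] ennreal_plus[symmetric] divide_nonneg_pos zero_le_numeral mult_nonneg_nonneg)
      finally show ?thesis using True by (simp add: G)
    next
      case False
      then show ?thesis using test_functions_eq_0[OF \<phi>] by simp
    qed
    have "ennreal (LINT x|lborel. (\<phi> x)\<^sup>2) = (\<integral>\<^sup>+x. ennreal ((\<phi> x)\<^sup>2) \<partial>lborel)"
      using integrable_test_square[OF \<phi>] by (intro nn_integral_eq_integral[symmetric]) auto
    also have "\<dots> \<le> (\<integral>\<^sup>+x. ennreal (2 / b) * ?G x + ennreal S * indicator (ball 0 R) x \<partial>lborel)"
      by (intro nn_integral_mono pw)
    also have "\<dots> = ennreal (2 / b) * (\<integral>\<^sup>+x. ?G x \<partial>lborel) + ennreal S * emeasure lborel (ball (0 :: real^'n) R)"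
    proof -
      have [measurable]: "\<phi> \<in> borel_measurable borel" "ball (0 :: real^'n) (2 * h) \<in> sets borel"
        using borel_measurable_test[OF \<phi>] by auto
      have [measurable]: "?G \<in> borel_measurable lborel" by measurable
      have "(\<integral>\<^sup>+x. ennreal (2 / b) * ?G x + ennreal S * indicator (ball 0 R) x \<partial>lborel)
          = (\<integral>\<^sup>+x. ennreal (2 / b) * ?G x \<partial>lborel) + (\<integral>\<^sup>+x. ennreal S * indicator (ball (0 :: real^'n) R) x \<partial>lborel)"
        by (rule nn_integral_add) (measurable, simp)
      also have "(\<integral>\<^sup>+x. ennreal (2 / b) * ?G x \<partial>lborel) = ennreal (2 / b) * (\<integral>\<^sup>+x. ?G x \<partial>lborel)"
        by (rule nn_integral_cmult) measurable
      also have "(\<integral>\<^sup>+x. ennreal S * indicator (ball (0 :: real^'n) R) x \<partial>lborel)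
          = ennreal S * emeasure lborel (ball (0 :: real^'n) R)"
        by (rule nn_integral_cmult_indicator) simp
      finally show ?thesis .
    qed
    also have "\<dots> \<le> ennreal (2 / b) * ennreal ((2 * h)\<^sup>2 * dirichlet_energy \<phi> * (2 ^ CARD('n) * b)) + ennreal S * ennreal v"
    proof (intro add_mono mult_left_mono)
      show "(\<integral>\<^sup>+x. ?G x \<partial>lborel) \<le> ennreal ((2 * h)\<^sup>2 * dirichlet_energy \<phi> * (2 ^ CARD('n) * b))"
        using mean_oscillation_energy[OF \<phi>, of "2 * h"] h(1) by (simp add: b2)
      show "emeasure lborel (ball (0 :: real^'n) R) \<le> ennreal v"
        using emeasure_lborel_ball_finite[of "0 :: real^'n" R] by (simp add: v_def emeasure_eq_ennreal_measure)
    qed auto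
    also have "\<dots> = ennreal (2 / b * ((2 * h)\<^sup>2 * dirichlet_energy \<phi> * (2 ^ CARD('n) * b)) + S * v)"
      using b S0 v dirichlet_energy_nonneg[of \<phi>]
      by (simp only: ennreal_mult[symmetric] ennreal_plus[symmetric] divide_nonneg_pos zero_le_numeral
          zero_le_power zero_le_power2 less_imp_le mult_nonneg_nonneg)
    also have "2 / b * ((2 * h)\<^sup>2 * dirichlet_energy \<phi> * (2 ^ CARD('n) * b)) = \<epsilon> * dirichlet_energy \<phi>"
      using b by (simp add: power_mult_distrib h(2))
    finally show "(LINT x|lborel. (\<phi> x)\<^sup>2) \<le> \<epsilon> * dirichlet_energy \<phi> + (\<Sum>i<N. (l i \<phi>)\<^sup>2)"
      unfolding Sv using \<epsilon> dirichlet_energy_nonneg[of \<phi>]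
      by (subst (asm) ennreal_le_iff) (auto intro!: add_nonneg_nonneg sum_nonneg)
  qed
qed

section \<open>Square integrable functions\<close>

definition square_integrable :: "'a measure \<Rightarrow> ('a \<Rightarrow> real) set" where
  "square_integrable M = {u \<in> borel_measurable M. integrable M (\<lambda>x. (u x)\<^sup>2)}"

definition l2_form :: "'a measure \<Rightarrow> ('a \<Rightarrow> real) \<Rightarrow> ('a \<Rightarrow> real) \<Rightarrow> real" where
  "l2_form M u v = (LINT x|M. u x * v x)"

lemma square_integrable_mult:
  assumes "u \<in> square_integrable M" "v \<in> square_integrable M"
  shows "integrable M (\<lambda>x. u x * v x)"
proof (rule Bochner_Integration.integrable_bound)
  show "integrable M (\<lambda>x. (u x)\<^sup>2 + (v x)\<^sup>2)"
    using assms by (auto simp: square_integrable_def)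
  have [measurable]: "u \<in> borel_measurable M" "v \<in> borel_measurable M"
    using assms by (auto simp: square_integrable_def)
  show "(\<lambda>x. u x * v x) \<in> borel_measurable M" by measurable
  have "\<bar>a * b\<bar> \<le> a\<^sup>2 + b\<^sup>2" for a b :: real
  proof -
    have "2 * (\<bar>a\<bar> * \<bar>b\<bar>) \<le> a\<^sup>2 + b\<^sup>2"
      using zero_le_power2[of "\<bar>a\<bar> - \<bar>b\<bar>"] by (simp add: power2_diff)
    moreover have "0 \<le> \<bar>a\<bar> * \<bar>b\<bar>" by simp
    ultimately show ?thesis unfolding abs_mult by argo
  qed
  then show "AE x in M. norm (u x * v x) \<le> norm ((u x)\<^sup>2 + (v x)\<^sup>2)" by simp
qed

lemma square_integrable_add:
  assumes "u \<in> square_integrable M" "v \<in> square_integrable M"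
  shows "(\<lambda>x. u x + v x) \<in> square_integrable M"
  using assms square_integrable_mult[OF assms]
  by (auto simp: square_integrable_def power2_sum mult.assoc)

lemma semi_inner_l2: "semi_inner (square_integrable M) (l2_form M)"
proof
  show "subspace (square_integrable M)"
  proof (rule subspaceI)
    show "0 \<in> square_integrable M" by (simp add: square_integrable_def zero_fun_def)
    show "u + v \<in> square_integrable M" if "u \<in> square_integrable M" "v \<in> square_integrable M" for u v
      using square_integrable_add[OF that] by (simp only: plus_fun_def)
    show "r *\<^sub>R u \<in> square_integrable M" if u: "u \<in> square_integrable M" for r u
    proof -
      have [measurable]: "u \<in> borel_measurable M" and "integrable M (\<lambda>x. (u x)\<^sup>2)"
        using u by (simp_all add: square_integrable_def)
      from this(2) have "integrable M (\<lambda>x. r\<^sup>2 * (u x)\<^sup>2)" by (rule integrable_mult_right)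
      moreover have "(\<lambda>x. r * u x) \<in> borel_measurable M" by measurable
      ultimately show ?thesis
        unfolding square_integrable_def scaleR_fun_def real_scaleR_def mem_Collect_eq power_mult_distrib by blast
    qed
  qed
  fix u v assume uv: "u \<in> square_integrable M" "v \<in> square_integrable M"
  show "l2_form M u v = l2_form M v u" by (simp add: l2_form_def mult.commute)
  show "l2_form M (u + v) w = l2_form M u w + l2_form M v w" if "w \<in> square_integrable M" for w
    unfolding l2_form_def plus_fun_apply distrib_right
    by (rule Bochner_Integration.integral_add) (intro square_integrable_mult uv that)+
  show "l2_form M (r *\<^sub>R u) v = r * l2_form M u v" for r
    by (simp add: l2_form_def mult.assoc)
  show "0 \<le> l2_form M u u" by (simp add: l2_form_def)
qed

lemma l2_form_eq_0_iff:
  assumes "u \<in> square_integrable M"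
  shows "l2_form M u u = 0 \<longleftrightarrow> (AE x in M. u x = 0)"
  unfolding l2_form_def
  using integral_nonneg_eq_0_iff_AE[OF square_integrable_mult[OF assms assms]] by simp

text \<open>Finiteness of the measure turns Cauchy in L2 into Cauchy in L1, which supplies a
  subsequence converging almost everywhere; Fatou's lemma carries the L2 bounds over to its
  limit.\<close>

lemma l2_complete:
  assumes "finite_measure M" and s: "s \<in> semi_inner.cauchy_seqs (square_integrable M) (l2_form M)"
  shows "\<exists>u\<in>square_integrable M. (\<lambda>j. l2_form M (s j - u) (s j - u)) \<longlonglongrightarrow> 0"
proof -
  interpret finite_measure M by fact
  interpret L: semi_inner "square_integrable M" "l2_form M" by (rule semi_inner_l2)
  note sL = L.cauchy_seqs_V[OF s]
  have [measurable]: "s j \<in> borel_measurable M" for j using sL[of j] by (simp add: square_integrable_def)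
  have one: "(\<lambda>_. 1) \<in> square_integrable M" by (simp add: square_integrable_def)
  have int: "integrable M (s j)" for j using square_integrable_mult[OF sL one] by simp
  have absL: "(\<lambda>x. \<bar>f x\<bar>) \<in> square_integrable M" if "f \<in> square_integrable M" for f
    using that by (auto simp: square_integrable_def)
  define V where "V = l2_form M (\<lambda>_. 1) (\<lambda>_. 1)"
  have V: "V \<ge> 0" unfolding V_def by (rule L.nonneg[OF one])
  have L1: "\<exists>N. \<forall>i\<ge>N. \<forall>j\<ge>N. (LINT x|M. norm (s i x - s j x)) < \<epsilon>" if "\<epsilon> > 0" for \<epsilon>
  proof -
    have "\<epsilon>\<^sup>2 / (V + 1) > 0" using that V by simp
    from L.cauchy_seqsD[OF s this] obtain N where
      N: "\<forall>i\<ge>N. \<forall>j\<ge>N. l2_form M (s i - s j) (s i - s j) < \<epsilon>\<^sup>2 / (V + 1)" by blast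
    have "(LINT x|M. norm (s i x - s j x)) < \<epsilon>" if ij: "i \<ge> N" "j \<ge> N" for i j
    proof -
      have mem: "s i - s j \<in> square_integrable M" by (intro L.closed sL)
      let ?f = "\<lambda>x. \<bar>(s i - s j) x\<bar>"
      have "(l2_form M ?f (\<lambda>_. 1))\<^sup>2 \<le> l2_form M ?f ?f * V"
        unfolding V_def by (rule L.Cauchy_Schwarz[OF absL[OF mem] one])
      also have "l2_form M ?f ?f = l2_form M (s i - s j) (s i - s j)" by (simp add: l2_form_def)
      also have "l2_form M (s i - s j) (s i - s j) * V \<le> l2_form M (s i - s j) (s i - s j) * (V + 1)"
        using L.nonneg[OF mem] by (intro mult_left_mono) auto
      also have "\<dots> < \<epsilon>\<^sup>2" using N ij V by (simp add: field_simps)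
      finally have "l2_form M ?f (\<lambda>_. 1) < \<epsilon>"
        by (rule power_less_imp_less_base) (use \<open>\<epsilon> > 0\<close> in simp)
      then show ?thesis by (simp add: l2_form_def)
    qed
    then show ?thesis by blast
  qed
  obtain r where r: "strict_mono r" "AE x in M. Cauchy (\<lambda>i. s (r i) x)"
    using cauchy_L1_AE_cauchy_subseq[OF int L1] by blast
  define u where "u x = lim (\<lambda>i. s (r i) x)" for x
  have [measurable]: "u \<in> borel_measurable M" unfolding u_def[abs_def] by measurable
  have lim: "AE x in M. (\<lambda>i. s (r i) x) \<longlonglongrightarrow> u x"
    using r(2) by eventually_elim (simp add: u_def convergent_LIMSEQ_iff[symmetric] Cauchy_convergent)
  have nn: "(\<integral>\<^sup>+x. ennreal ((s i x - s j x)\<^sup>2) \<partial>M) = ennreal (l2_form M (s i - s j) (s i - s j))" for i j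
  proof -
    have "s i - s j \<in> square_integrable M" by (intro L.closed sL)
    then have "integrable M (\<lambda>x. (s i x - s j x)\<^sup>2)" by (simp add: square_integrable_def)
    then show ?thesis by (simp add: nn_integral_eq_integral l2_form_def power2_eq_square)
  qed
  have fatou: "(\<integral>\<^sup>+x. ennreal ((s i x - u x)\<^sup>2) \<partial>M) \<le> ennreal \<epsilon>"
    if "\<And>j. j \<ge> N \<Longrightarrow> l2_form M (s i - s j) (s i - s j) \<le> \<epsilon>" for i N \<epsilon>
  proof -
    have "(\<integral>\<^sup>+x. ennreal ((s i x - u x)\<^sup>2) \<partial>M) = (\<integral>\<^sup>+x. liminf (\<lambda>j. ennreal ((s i x - s (r j) x)\<^sup>2)) \<partial>M)"
    proof (rule nn_integral_cong_AE)
      show "AE x in M. ennreal ((s i x - u x)\<^sup>2) = liminf (\<lambda>j. ennreal ((s i x - s (r j) x)\<^sup>2))"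
        using lim
      proof eventually_elim
        fix x assume "(\<lambda>j. s (r j) x) \<longlonglongrightarrow> u x"
        then have "(\<lambda>j. ennreal ((s i x - s (r j) x)\<^sup>2)) \<longlonglongrightarrow> ennreal ((s i x - u x)\<^sup>2)"
          by (intro tendsto_ennrealI tendsto_intros)
        then show "ennreal ((s i x - u x)\<^sup>2) = liminf (\<lambda>j. ennreal ((s i x - s (r j) x)\<^sup>2))"
          using lim_imp_Liminf[OF trivial_limit_sequentially] by metis
      qed
    qed
    also have "\<dots> \<le> liminf (\<lambda>j. \<integral>\<^sup>+x. ennreal ((s i x - s (r j) x)\<^sup>2) \<partial>M)"
      by (rule nn_integral_liminf) measurable
    also have "\<dots> \<le> liminf (\<lambda>j. ennreal \<epsilon>)"
    proof (rule Liminf_mono)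
      have "j \<ge> N \<Longrightarrow> (\<integral>\<^sup>+x. ennreal ((s i x - s (r j) x)\<^sup>2) \<partial>M) \<le> ennreal \<epsilon>" for j
        unfolding nn using that[of "r j"] seq_suble[OF r(1), of j] by (intro ennreal_leI) simp
      then show "\<forall>\<^sub>F j in sequentially. (\<integral>\<^sup>+x. ennreal ((s i x - s (r j) x)\<^sup>2) \<partial>M) \<le> ennreal \<epsilon>"
        by (auto simp: eventually_sequentially)
    qed
    also have "\<dots> = ennreal \<epsilon>" by (simp add: Liminf_const)
    finally show ?thesis .
  qed
  have diffL: "s i - u \<in> square_integrable M" if "\<And>j. j \<ge> N \<Longrightarrow> l2_form M (s i - s j) (s i - s j) \<le> \<epsilon>" for i N \<epsilon>
  proof -
    have "(\<integral>\<^sup>+x. ennreal ((s i x - u x)\<^sup>2) \<partial>M) < \<infinity>"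
      using fatou[of N i \<epsilon>, OF that] by (simp add: le_less_trans ennreal_less_top)
    then have "integrable M (\<lambda>x. (s i x - u x)\<^sup>2)"
      by (intro integrableI_bounded) auto
    moreover have "s i - u \<in> borel_measurable M" unfolding fun_diff_def by measurable
    ultimately show ?thesis by (simp add: square_integrable_def)
  qed
  obtain N1 where N1: "\<forall>i\<ge>N1. \<forall>j\<ge>N1. l2_form M (s i - s j) (s i - s j) < 1"
    using L.cauchy_seqsD[OF s, of 1] by auto
  \<comment> \<open>Square integrability of \<open>u\<close> itself is read off from
    \<open>s N1\<close> and the difference \<open>s N1 - u\<close>.\<close>
  have "s N1 - u \<in> square_integrable M"
    by (rule diffL[of N1 _ 1]) (use N1 in \<open>auto intro: less_imp_le\<close>)
  from L.closed(3)[OF sL[of N1] this] have u: "u \<in> square_integrable M" by simp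
  have "(\<lambda>j. l2_form M (s j - u) (s j - u)) \<longlonglongrightarrow> 0"
  proof (rule LIMSEQ_I)
    fix \<epsilon> :: real assume e: "\<epsilon> > 0"
    then have "\<epsilon> / 2 > 0" by simp
    from L.cauchy_seqsD[OF s this] obtain N where
      N: "\<forall>i\<ge>N. \<forall>j\<ge>N. l2_form M (s i - s j) (s i - s j) < \<epsilon> / 2" by blast
    have "norm (l2_form M (s i - u) (s i - u) - 0) < \<epsilon>" if i: "i \<ge> N" for i
    proof -
      have mem: "s i - u \<in> square_integrable M" by (intro L.closed sL u)
      then have "integrable M (\<lambda>x. (s i x - u x)\<^sup>2)" by (simp add: square_integrable_def)
      then have "ennreal (l2_form M (s i - u) (s i - u)) = (\<integral>\<^sup>+x. ennreal ((s i x - u x)\<^sup>2) \<partial>M)"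
        by (simp add: nn_integral_eq_integral l2_form_def power2_eq_square)
      also have "\<dots> \<le> ennreal (\<epsilon> / 2)"
        by (rule fatou[of N]) (use N i in \<open>auto intro: less_imp_le\<close>)
      finally have "l2_form M (s i - u) (s i - u) \<le> \<epsilon> / 2" using e by simp
      then show ?thesis using L.nonneg[OF mem] e by simp
    qed
    then show "\<exists>no. \<forall>n\<ge>no. norm (l2_form M (s n - u) (s n - u) - 0) < \<epsilon>" by blast
  qed
  then show ?thesis using u by blast
qed

section \<open>The Dirichlet spectrum of a conformally flat metric on a ball\<close>

lemma matrix_vector_mult_mat: "mat a *v x = a *\<^sub>R (x :: real^'n::finite)"
proof -
  have "(\<Sum>j\<in>UNIV. (if i = j then a else 0) * x $ j) = a * x $ i" for i
    by (simp add: if_distrib[of "\<lambda>y. y * _"] cong: if_cong)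
  then show ?thesis by (simp add: vec_eq_iff matrix_vector_mult_def mat_def)
qed

lemma det_mat: "det (mat a :: real^'n::finite^'n) = a ^ CARD('n)"
  by (subst det_diagonal) (auto simp: mat_def)

lemma matrix_inv_mat:
  assumes "a \<noteq> 0"
  shows "matrix_inv (mat a :: real^'n::finite^'n) = mat (1 / a)"
proof -
  have mul: "(mat c :: real^'n^'n) ** mat d = mat (c * d)" for c d :: real
  proof -
    have "(mat c :: real^'n^'n) ** mat d *v x = mat (c * d) *v x" for x :: "real^'n"
      by (simp only: matrix_vector_mul_assoc[symmetric] matrix_vector_mult_mat scaleR_scaleR)
    then show ?thesis by (simp add: matrix_eq)
  qed
  have i: "(mat a :: real^'n^'n) ** mat (1 / a) = mat 1" "(mat (1 / a) :: real^'n^'n) ** mat a = mat 1"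
    using assms by (simp_all add: mul)
  have "\<exists>A. (mat a :: real^'n^'n) ** A = mat 1 \<and> A ** mat a = mat 1" using i by blast
  from someI_ex[OF this] have "matrix_inv (mat a :: real^'n^'n) ** mat a = mat 1"
    unfolding matrix_inv_def by blast
  then have "matrix_inv (mat a :: real^'n^'n) ** (mat a ** mat (1 / a)) = mat (1 / a)"
    by (simp add: matrix_mul_assoc)
  then show ?thesis by (simp add: i)
qed

text \<open>\<open>G\<close> is \<rho>^2 times the Euclidean metric, prescribed on the ball only.
  The bounds make its mass and energy comparable with the Euclidean ones; \<open>dim\<close> keeps
  the exponent \<open>CARD('n) - 2\<close> from being truncated.\<close>

locale conformal =
  fixes G :: "real^'n::finite \<Rightarrow> real^'n^'n" and R lo hi :: real and \<rho> :: "real^'n \<Rightarrow> real"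
  assumes dim: "CARD('n) \<ge> 2" and R: "R > 0" and lo: "lo > 0"
    and G: "x \<in> ball 0 R \<Longrightarrow> G x = mat ((\<rho> x)\<^sup>2)"
    and smooth: "cont_diff_on m (ball 0 R) \<rho>"
    and bounds: "x \<in> ball 0 R \<Longrightarrow> lo \<le> \<rho> x \<and> \<rho> x \<le> hi"
begin

abbreviation "\<Omega> \<equiv> ball (0 :: real^'n) R"
abbreviation "\<D> \<equiv> test_functions \<Omega>"
abbreviation "\<V> \<equiv> metric_volume G \<Omega>"

definition vol_weight :: "real^'n \<Rightarrow> real" where
  "vol_weight x = indicator \<Omega> x * \<rho> x ^ CARD('n)"

text \<open>The weight is the volume density \<rho>^n times the inverse metric \<rho>^-2. Outside
  the ball \<rho> is arbitrary, but gradients of test functions vanish there.\<close>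

definition energy :: "(real^'n \<Rightarrow> real) \<Rightarrow> (real^'n \<Rightarrow> real) \<Rightarrow> real" where
  "energy \<phi> \<psi> = (LINT x|lborel. \<rho> x ^ (CARD('n) - 2) * (coord_grad \<phi> x \<bullet> coord_grad \<psi> x))"

lemma \<rho>_pos: "x \<in> \<Omega> \<Longrightarrow> \<rho> x > 0"
  using bounds[of x] lo by linarith

lemma hi: "hi > 0"
  using bounds[of 0] R lo by force

lemma smooth_power: "cont_diff_on m \<Omega> (\<lambda>x. \<rho> x ^ k)"
  by (induction k) (auto intro!: cont_diff_on_mult smooth)

lemma continuous_power: "continuous_on \<Omega> (\<lambda>x. \<rho> x ^ k)"
  using cont_diff_on_continuous[OF smooth_power] .

lemma \<rho>_power_bounds:
  assumes "x \<in> \<Omega>" shows "lo ^ k \<le> \<rho> x ^ k" "\<rho> x ^ k \<le> hi ^ k"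
  using bounds[OF assms] lo by (auto intro: power_mono)

lemma vol_weight_measurable [measurable]: "vol_weight \<in> borel_measurable borel"
  using borel_measurable_continuous_on_indicator[OF _ continuous_power[of "CARD('n)"]]
  by (simp add: vol_weight_def[abs_def])

lemma vol_weight_nonneg: "vol_weight x \<ge> 0"
  using \<rho>_pos by (auto simp: vol_weight_def indicator_def intro: less_imp_le)

lemma vol_weight_le: "vol_weight x \<le> hi ^ CARD('n) * indicator \<Omega> x"
  using \<rho>_power_bounds(2)[of x] by (auto simp: vol_weight_def indicator_def)

lemma sqrt_det:
  assumes "x \<in> \<Omega>"
  shows "sqrt (det (G x)) = \<rho> x ^ CARD('n)"
  unfolding G[OF assms] det_mat real_sqrt_power using \<rho>_pos[OF assms] by simp

lemma metric_volume_eq: "\<V> = density lborel (\<lambda>x. ennreal (vol_weight x))"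
proof -
  have "indicator \<Omega> x * ennreal (sqrt (det (G x))) = ennreal (vol_weight x)" for x
    by (auto simp: vol_weight_def indicator_def sqrt_det)
  then show ?thesis unfolding metric_volume_def by simp
qed

lemma LINT_metric: "f \<in> borel_measurable borel \<Longrightarrow> (LINT x|\<V>. f x) = (LINT x|lborel. vol_weight x * f x)"
  unfolding metric_volume_eq
  using integral_density[of f lborel vol_weight] vol_weight_nonneg by simp

lemma integrable_metric_iff:
  "f \<in> borel_measurable borel \<Longrightarrow> integrable \<V> f \<longleftrightarrow> integrable lborel (\<lambda>x. vol_weight x * f x)"
  unfolding metric_volume_eq
  using integrable_density[of f lborel vol_weight] vol_weight_nonneg by simp

lemma measurable_metric: "borel_measurable \<V> = borel_measurable borel"
  by (rule measurable_cong_sets) (simp_all add: metric_volume_eq)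

lemma finite_measure_metric: "finite_measure \<V>"
proof
  have "emeasure \<V> (space \<V>) = (\<integral>\<^sup>+x. ennreal (vol_weight x) \<partial>lborel)"
    by (simp add: metric_volume_eq emeasure_density)
  also have "\<dots> \<le> (\<integral>\<^sup>+x. ennreal (hi ^ CARD('n)) * indicator \<Omega> x \<partial>lborel)"
  proof (rule nn_integral_mono)
    show "ennreal (vol_weight x) \<le> ennreal (hi ^ CARD('n)) * indicator \<Omega> x" for x
      using ennreal_leI[OF vol_weight_le[of x]] by (auto simp: indicator_def split: if_splits)
  qed
  also have "\<dots> = ennreal (hi ^ CARD('n)) * emeasure lborel \<Omega>"
    by (rule nn_integral_cmult_indicator) simp
  also have "\<dots> < \<infinity>"
    using emeasure_lborel_ball_finite[of "0 :: real^'n" R] by (simp add: ennreal_mult_less_top)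
  finally show "emeasure \<V> (space \<V>) \<noteq> \<infinity>" by simp
qed

lemma test_square_integrable: "\<D> \<subseteq> square_integrable \<V>"
proof
  fix \<phi> assume \<phi>: "\<phi> \<in> \<D>"
  have [measurable]: "\<phi> \<in> borel_measurable borel" using \<phi> by (rule borel_measurable_test)
  have "integrable lborel (\<lambda>x. vol_weight x * (\<phi> x)\<^sup>2)"
  proof (rule Bochner_Integration.integrable_bound)
    show "integrable lborel (\<lambda>x. hi ^ CARD('n) * (\<phi> x)\<^sup>2)"
      by (intro integrable_mult_right integrable_test_square[OF \<phi>])
    have "vol_weight x * (\<phi> x)\<^sup>2 \<le> hi ^ CARD('n) * (\<phi> x)\<^sup>2" for x
    proof (rule mult_right_mono)
      show "vol_weight x \<le> hi ^ CARD('n)"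
        using vol_weight_le[of x] hi by (auto simp: indicator_def split: if_splits intro: order_trans)
    qed simp
    then show "AE x in lborel. norm (vol_weight x * (\<phi> x)\<^sup>2) \<le> norm (hi ^ CARD('n) * (\<phi> x)\<^sup>2)"
      using hi vol_weight_nonneg by (simp add: abs_mult)
  qed measurable
  then show "\<phi> \<in> square_integrable \<V>"
    by (simp add: square_integrable_def measurable_metric integrable_metric_iff)
qed

sublocale m: semi_inner \<D> "l2_form \<V>"
  by (rule semi_inner_subset[OF semi_inner_l2 subspace_test_functions test_square_integrable])

lemma coord_grad_outside: "\<phi> \<in> \<D> \<Longrightarrow> x \<notin> \<Omega> \<Longrightarrow> coord_grad \<phi> x = 0"
proof -
  assume \<phi>: "\<phi> \<in> \<D>" and x: "x \<notin> \<Omega>"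
  obtain K where K: "compact K" "K \<subseteq> \<Omega>" "\<And>x. x \<notin> K \<Longrightarrow> \<phi> x = 0"
    using \<phi> by (metis test_functionsE)
  show "coord_grad \<phi> x = 0"
    by (rule coord_grad_eq_0[OF K(1,3)]) (use x K(2) in auto)
qed

lemma integrable_energy:
  "\<phi> \<in> \<D> \<Longrightarrow> \<psi> \<in> \<D> \<Longrightarrow> integrable lborel (\<lambda>x. \<rho> x ^ k * (coord_grad \<phi> x \<bullet> coord_grad \<psi> x))"
  by (rule integrable_grad_grad[OF _ _ continuous_power])

lemma coord_grad_add: "\<phi> \<in> \<D> \<Longrightarrow> \<psi> \<in> \<D> \<Longrightarrow> coord_grad (\<phi> + \<psi>) x = coord_grad \<phi> x + coord_grad \<psi> x"
  by (simp add: coord_grad_def vec_eq_iff plus_fun_def partial_deriv_add test_functions_differentiable)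

lemma coord_grad_scale: "\<phi> \<in> \<D> \<Longrightarrow> coord_grad (r *\<^sub>R \<phi>) x = r *\<^sub>R coord_grad \<phi> x"
  using partial_deriv_mult[of "\<lambda>_. r" x \<phi>] test_functions_differentiable[of \<phi>]
  by (simp add: coord_grad_def vec_eq_iff scaleR_fun_def partial_deriv_const)

sublocale e: semi_inner \<D> energy
proof
  show "subspace \<D>" by (rule subspace_test_functions)
  fix \<phi> \<psi> assume p: "\<phi> \<in> \<D>" "\<psi> \<in> \<D>"
  show "energy \<phi> \<psi> = energy \<psi> \<phi>" by (simp add: energy_def inner_commute)
  show "energy (\<phi> + \<psi>) \<xi> = energy \<phi> \<xi> + energy \<psi> \<xi>" if "\<xi> \<in> \<D>" for \<xi>
    unfolding energy_def coord_grad_add[OF p] inner_add_left distrib_left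
    by (rule Bochner_Integration.integral_add) (intro integrable_energy p that)+
  show "energy (r *\<^sub>R \<phi>) \<psi> = r * energy \<phi> \<psi>" for r
    by (simp add: energy_def coord_grad_scale[OF p(1)] mult.left_commute)
  show "0 \<le> energy \<phi> \<phi>"
    unfolding energy_def
  proof (rule integral_nonneg_AE, rule AE_I2)
    show "0 \<le> \<rho> x ^ (CARD('n) - 2) * (coord_grad \<phi> x \<bullet> coord_grad \<phi> x)" for x
      using \<rho>_pos[of x] coord_grad_outside[OF p(1), of x] by (cases "x \<in> \<Omega>") auto
  qed
qed

lemma energy_lower:
  assumes \<phi>: "\<phi> \<in> \<D>"
  shows "lo ^ (CARD('n) - 2) * dirichlet_energy \<phi> \<le> energy \<phi> \<phi>"
proof -
  have "(LINT x|lborel. lo ^ (CARD('n) - 2) * (coord_grad \<phi> x \<bullet> coord_grad \<phi> x)) \<le> energy \<phi> \<phi>"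
    unfolding energy_def
  proof (rule integral_mono)
    show "lo ^ (CARD('n) - 2) * (coord_grad \<phi> x \<bullet> coord_grad \<phi> x)
      \<le> \<rho> x ^ (CARD('n) - 2) * (coord_grad \<phi> x \<bullet> coord_grad \<phi> x)" for x
      using \<rho>_power_bounds(1)[of x] coord_grad_outside[OF \<phi>, of x]
      by (cases "x \<in> \<Omega>") (auto intro: mult_right_mono)
  qed (intro integrable_energy integrable_mult_right integrable_grad_sq[OF \<phi>] \<phi>)+
  then show ?thesis by (simp add: dirichlet_energy_def)
qed

lemma l2_form_test: "\<phi> \<in> \<D> \<Longrightarrow> l2_form \<V> \<phi> \<phi> = (LINT x|lborel. vol_weight x * (\<phi> x)\<^sup>2)"
  unfolding l2_form_def using borel_measurable_test[of \<phi> \<Omega>]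
  by (subst LINT_metric) (auto simp: power2_eq_square)

lemma l2_form_bounds:
  assumes \<phi>: "\<phi> \<in> \<D>"
  shows "l2_form \<V> \<phi> \<phi> \<le> hi ^ CARD('n) * (LINT x|lborel. (\<phi> x)\<^sup>2)"
    and "lo ^ CARD('n) * (LINT x|lborel. (\<phi> x)\<^sup>2) \<le> l2_form \<V> \<phi> \<phi>"
proof -
  have i: "integrable lborel (\<lambda>x. vol_weight x * (\<phi> x)\<^sup>2)"
    using test_square_integrable \<phi> borel_measurable_test[OF \<phi>]
    by (auto simp: square_integrable_def integrable_metric_iff)
  have "(LINT x|lborel. vol_weight x * (\<phi> x)\<^sup>2) \<le> (LINT x|lborel. hi ^ CARD('n) * (\<phi> x)\<^sup>2)"
  proof (rule integral_mono[OF i])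
    show "vol_weight x * (\<phi> x)\<^sup>2 \<le> hi ^ CARD('n) * (\<phi> x)\<^sup>2" for x
      using vol_weight_le[of x] test_functions_eq_0[OF \<phi>, of x] by (cases "x \<in> \<Omega>") (auto intro: mult_right_mono)
  qed (intro integrable_mult_right integrable_test_square[OF \<phi>])
  then show "l2_form \<V> \<phi> \<phi> \<le> hi ^ CARD('n) * (LINT x|lborel. (\<phi> x)\<^sup>2)"
    by (simp add: l2_form_test[OF \<phi>])
  have "(LINT x|lborel. lo ^ CARD('n) * (\<phi> x)\<^sup>2) \<le> (LINT x|lborel. vol_weight x * (\<phi> x)\<^sup>2)"
  proof (rule integral_mono[OF _ i])
    show "lo ^ CARD('n) * (\<phi> x)\<^sup>2 \<le> vol_weight x * (\<phi> x)\<^sup>2" for x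
      using \<rho>_power_bounds(1)[of x "CARD('n)"] test_functions_eq_0[OF \<phi>, of x]
      by (cases "x \<in> \<Omega>") (auto simp: vol_weight_def intro: mult_right_mono)
  qed (intro integrable_mult_right integrable_test_square[OF \<phi>])
  then show "lo ^ CARD('n) * (LINT x|lborel. (\<phi> x)\<^sup>2) \<le> l2_form \<V> \<phi> \<phi>"
    by (simp add: l2_form_test[OF \<phi>])
qed

text \<open>The set where a continuous function is nonzero is open, hence not negligible unless it
  is empty.\<close>

lemma integral_square_pos:
  assumes "\<phi> \<in> \<D>" "\<phi> x \<noteq> 0"
  shows "0 < (LINT x|lborel. (\<phi> x)\<^sup>2)"
proof (rule ccontr)
  have nn: "0 \<le> (LINT x|lborel. (\<phi> x)\<^sup>2)" by simp
  assume "\<not> 0 < (LINT x|lborel. (\<phi> x)\<^sup>2)"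
  then have "(LINT x|lborel. (\<phi> x)\<^sup>2) = 0" using nn by linarith
  then have "AE x in lborel. (\<phi> x)\<^sup>2 = 0"
    using integral_nonneg_eq_0_iff_AE[OF integrable_test_square[OF assms(1)]] by simp
  then have ae: "AE x in lborel. \<not> \<phi> x \<noteq> 0" by simp
  have op: "open {x. \<phi> x \<noteq> 0}"
    by (rule open_Collect_neq[OF test_functions_continuous[OF assms(1)] continuous_on_const])
  have "{x. \<phi> x \<noteq> 0} \<in> null_sets lborel"
  proof -
    have "{x. \<phi> x \<noteq> 0} \<in> sets lborel" using borel_open[OF op] by (simp only: sets_lborel)
    moreover have "AE x in lborel. x \<notin> {x. \<phi> x \<noteq> 0}" using ae by (simp only: mem_Collect_eq)
    ultimately show ?thesis by (simp only: AE_iff_null_sets)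
  qed
  then have "negligible {x. \<phi> x \<noteq> 0}"
    unfolding negligible_iff_null_sets by (rule null_sets_completionI)
  then show False using open_not_negligible[OF op] assms(2) by blast
qed

text \<open>The constant combines the Poincare constant 4 R^2 with the comparison factors
  \<open>lo ^ (CARD('n) - 2)\<close> for the energy and \<open>hi ^ CARD('n)\<close> for the
  mass.\<close>

sublocale pre_form \<D> "l2_form \<V>" energy "lo ^ (CARD('n) - 2) / (4 * R\<^sup>2 * hi ^ CARD('n))"
proof
  have pos: "lo ^ (CARD('n) - 2) > 0" "hi ^ CARD('n) > 0" "R\<^sup>2 > 0" using lo hi R by auto
  then show "0 < lo ^ (CARD('n) - 2) / (4 * R\<^sup>2 * hi ^ CARD('n))" by simp
  have l2_le: "(LINT x|lborel. (\<phi> x)\<^sup>2) \<le> 4 * R\<^sup>2 / lo ^ (CARD('n) - 2) * energy \<phi> \<phi>" if \<phi>: "\<phi> \<in> \<D>" for \<phi>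
  proof -
    have "(LINT x|lborel. (\<phi> x)\<^sup>2) \<le> 4 * R\<^sup>2 * dirichlet_energy \<phi>" by (rule Poincare_inequality[OF \<phi>])
    also have "\<dots> \<le> 4 * R\<^sup>2 * (energy \<phi> \<phi> / lo ^ (CARD('n) - 2))"
      using energy_lower[OF \<phi>] pos by (intro mult_left_mono) (auto simp: field_simps)
    finally show ?thesis by simp
  qed
  show "lo ^ (CARD('n) - 2) / (4 * R\<^sup>2 * hi ^ CARD('n)) * l2_form \<V> \<phi> \<phi> \<le> energy \<phi> \<phi>" if \<phi>: "\<phi> \<in> \<D>" for \<phi>
  proof -
    have "l2_form \<V> \<phi> \<phi> \<le> hi ^ CARD('n) * (LINT x|lborel. (\<phi> x)\<^sup>2)" by (rule l2_form_bounds[OF \<phi>])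
    also have "\<dots> \<le> hi ^ CARD('n) * (4 * R\<^sup>2 / lo ^ (CARD('n) - 2) * energy \<phi> \<phi>)"
      using l2_le[OF \<phi>] pos by (intro mult_left_mono) auto
    finally show ?thesis using pos by (simp add: field_simps)
  qed
  obtain f :: "nat \<Rightarrow> real^'n \<Rightarrow> real" where f: "\<And>i. f i \<in> \<D>" "\<And>i. \<exists>x. f i x \<noteq> 0"
    "\<And>i j x. i \<noteq> j \<Longrightarrow> f i x * f j x = 0"
    using ex_disjoint_test_functions[OF R] by metis
  show "\<exists>f :: nat \<Rightarrow> real^'n \<Rightarrow> real. (\<forall>i. f i \<in> \<D>) \<and> (\<forall>i j. i \<noteq> j \<longrightarrow> l2_form \<V> (f i) (f j) = 0) \<and>
      (\<forall>i. 0 < l2_form \<V> (f i) (f i))"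
  proof (intro exI[of _ f] conjI allI impI)
    show "f i \<in> \<D>" for i by (rule f)
    show "l2_form \<V> (f i) (f j) = 0" if "i \<noteq> j" for i j
      unfolding l2_form_def f(3)[OF that] by simp
    show "0 < l2_form \<V> (f i) (f i)" for i
    proof -
      obtain x where "f i x \<noteq> 0" using f(2) by blast
      then have "0 < lo ^ CARD('n) * (LINT x|lborel. (f i x)\<^sup>2)"
        using integral_square_pos[OF f(1)] lo by simp
      then show ?thesis using l2_form_bounds(2)[OF f(1)] by (rule less_le_trans)
    qed
  qed
  fix \<epsilon> :: real assume e: "\<epsilon> > 0"
  define h where "h = hi ^ CARD('n)"
  \<comment> \<open>The parameter for the Euclidean Rellich inequality, corrected by the comparison
    factors; the mass factor \<open>h\<close> also enters the functionals, as
    \<open>sqrt h\<close>.\<close>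
  define \<epsilon>' where "\<epsilon>' = \<epsilon> * lo ^ (CARD('n) - 2) / h"
  have h: "h > 0" using pos by (simp add: h_def)
  have e': "\<epsilon>' > 0" using e pos h by (simp add: \<epsilon>'_def)
  from Rellich[OF R e', where 'n = 'n]
  obtain N and l :: "nat \<Rightarrow> (real^'n \<Rightarrow> real) \<Rightarrow> real" and K where K: "K \<ge> 0"
    and l1: "\<forall>i. \<forall>\<phi>\<in>\<D>. (l i \<phi>)\<^sup>2 \<le> K * (LINT x|lborel. (\<phi> x)\<^sup>2)"
    and l2: "\<forall>i. \<forall>\<phi>\<in>\<D>. \<forall>\<psi>\<in>\<D>. l i (\<phi> + \<psi>) = l i \<phi> + l i \<psi>"
    and l3: "\<forall>i. \<forall>\<phi>\<in>\<D>. \<forall>r. l i (r *\<^sub>R \<phi>) = r * l i \<phi>"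
    and l4: "\<forall>\<phi>\<in>\<D>. (LINT x|lborel. (\<phi> x)\<^sup>2) \<le> \<epsilon>' * dirichlet_energy \<phi> + (\<Sum>i<N. (l i \<phi>)\<^sup>2)"
    by (elim exE conjE) (rule that)
  note l = l1[rule_format] l2[rule_format] l3[rule_format] l4[rule_format]
  show "\<exists>N (l :: nat \<Rightarrow> (real^'n \<Rightarrow> real) \<Rightarrow> real) K.
      (\<forall>i. \<forall>x\<in>\<D>. (l i x)\<^sup>2 \<le> K * energy x x) \<and>
      (\<forall>i. \<forall>x\<in>\<D>. \<forall>y\<in>\<D>. l i (x + y) = l i x + l i y) \<and>
      (\<forall>i. \<forall>x\<in>\<D>. \<forall>r. l i (r *\<^sub>R x) = r * l i x) \<and>
      (\<forall>x\<in>\<D>. l2_form \<V> x x \<le> \<epsilon> * energy x x + (\<Sum>i<N. (l i x)\<^sup>2))"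
  proof (intro exI[of _ N] exI[of _ "\<lambda>i \<phi>. sqrt h * l i \<phi>"] exI[of _ "h * (K * (4 * R\<^sup>2 / lo ^ (CARD('n) - 2)))"] conjI allI ballI)
    fix i \<phi> assume \<phi>: "\<phi> \<in> \<D>"
    have "(l i \<phi>)\<^sup>2 \<le> K * (4 * R\<^sup>2 / lo ^ (CARD('n) - 2) * energy \<phi> \<phi>)"
      by (rule order_trans[OF l(1)[OF \<phi>] mult_left_mono[OF l2_le[OF \<phi>] K]])
    then have "h * (l i \<phi>)\<^sup>2 \<le> h * (K * (4 * R\<^sup>2 / lo ^ (CARD('n) - 2) * energy \<phi> \<phi>))"
      using h by (intro mult_left_mono) auto
    then show "(sqrt h * l i \<phi>)\<^sup>2 \<le> h * (K * (4 * R\<^sup>2 / lo ^ (CARD('n) - 2))) * energy \<phi> \<phi>"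
      using h by (simp add: power_mult_distrib mult.assoc)
    show "sqrt h * l i (\<phi> + \<psi>) = sqrt h * l i \<phi> + sqrt h * l i \<psi>" if "\<psi> \<in> \<D>" for \<psi>
      by (simp add: l(2)[OF \<phi> that] distrib_left)
    show "sqrt h * l i (r *\<^sub>R \<phi>) = r * (sqrt h * l i \<phi>)" for r
      by (simp add: l(3)[OF \<phi>])
  next
    fix \<phi> assume \<phi>: "\<phi> \<in> \<D>"
    have "l2_form \<V> \<phi> \<phi> \<le> h * (LINT x|lborel. (\<phi> x)\<^sup>2)"
      using l2_form_bounds(1)[OF \<phi>] by (simp add: h_def)
    also have "\<dots> \<le> h * (\<epsilon>' * dirichlet_energy \<phi> + (\<Sum>i<N. (l i \<phi>)\<^sup>2))"
      using l(4)[OF \<phi>] h by (intro mult_left_mono) auto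
    also have "\<dots> = \<epsilon> * (lo ^ (CARD('n) - 2) * dirichlet_energy \<phi>) + (\<Sum>i<N. (sqrt h * l i \<phi>)\<^sup>2)"
      using h by (simp add: \<epsilon>'_def distrib_left sum_distrib_left power_mult_distrib)
    also have "\<dots> \<le> \<epsilon> * energy \<phi> \<phi> + (\<Sum>i<N. (sqrt h * l i \<phi>)\<^sup>2)"
      using energy_lower[OF \<phi>] e by (intro add_right_mono mult_left_mono) auto
    finally show "l2_form \<V> \<phi> \<phi> \<le> \<epsilon> * energy \<phi> \<phi> + (\<Sum>i<N. (sqrt h * l i \<phi>)\<^sup>2)" .
  qed
qed

end

section \<open>Green's identity for the conformal metric\<close>

context conformal
begin

definition flux :: "'n \<Rightarrow> (real^'n \<Rightarrow> real) \<Rightarrow> real^'n \<Rightarrow> real" where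
  "flux i \<phi> x = partial_deriv i \<phi> x * \<rho> x ^ (CARD('n) - 2)"

lemma flux_test: "\<phi> \<in> \<D> \<Longrightarrow> flux i \<phi> \<in> \<D>"
  unfolding flux_def[abs_def]
  by (rule test_functions_mult[OF test_functions_partial_deriv open_ball smooth_power])

definition flux_divergence :: "(real^'n \<Rightarrow> real) \<Rightarrow> real^'n \<Rightarrow> real" where
  "flux_divergence \<phi> x = (\<Sum>i\<in>UNIV. partial_deriv i (flux i \<phi>) x)"

lemma test_sum: "finite I \<Longrightarrow> (\<And>i. i \<in> I \<Longrightarrow> f i \<in> \<D>) \<Longrightarrow> (\<lambda>x. \<Sum>i\<in>I. f i x) \<in> \<D>"
  by (induction I rule: finite_induct) (auto intro: test_functions_add test_functions_zero)

lemma flux_divergence_test: "\<phi> \<in> \<D> \<Longrightarrow> flux_divergence \<phi> \<in> \<D>"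
  unfolding flux_divergence_def[abs_def]
  by (intro test_sum test_functions_partial_deriv flux_test) auto

lemma power_dim_minus_2: "x \<in> \<Omega> \<Longrightarrow> \<rho> x ^ CARD('n) * (1 / (\<rho> x)\<^sup>2) = \<rho> x ^ (CARD('n) - 2)"
  using \<rho>_pos[of x] dim by (simp add: power_diff)

lemma matrix_inv_G: "x \<in> \<Omega> \<Longrightarrow> matrix_inv (G x) *v v = (1 / (\<rho> x)\<^sup>2) *\<^sub>R v"
  using \<rho>_pos[of x] by (simp add: G matrix_inv_mat matrix_vector_mult_mat)

text \<open>A test function times a real power of \<rho>: in this form the Laplacian of a test
  function is seen to be a test function. Off the ball both sides vanish, since \<phi> is zero near
  such points.\<close>

lemma laplace_beltrami_eq:
  assumes \<phi>: "\<phi> \<in> \<D>"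
  shows "laplace_beltrami G \<phi> x = flux_divergence \<phi> x * \<rho> x powr (- real CARD('n))"
proof (cases "x \<in> \<Omega>")
  case True
  have "partial_deriv i (\<lambda>y. sqrt (det (G y)) * (matrix_inv (G y) *v coord_grad \<phi> y) $ i) x
      = partial_deriv i (flux i \<phi>) x" for i
  proof (rule partial_deriv_cong[OF open_ball True])
    fix y assume y: "y \<in> \<Omega>"
    have "sqrt (det (G y)) * (matrix_inv (G y) *v coord_grad \<phi> y) $ i
        = (\<rho> y ^ CARD('n) * (1 / (\<rho> y)\<^sup>2)) * partial_deriv i \<phi> y"
      by (simp add: sqrt_det[OF y] matrix_inv_G[OF y] coord_grad_def)
    then show "sqrt (det (G y)) * (matrix_inv (G y) *v coord_grad \<phi> y) $ i = flux i \<phi> y"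
      unfolding power_dim_minus_2[OF y] flux_def by (simp add: mult.commute)
  qed
  then show ?thesis
    using \<rho>_pos[OF True]
    by (simp add: laplace_beltrami_def flux_divergence_def sqrt_det[OF True] powr_minus powr_realpow field_simps)
next
  case False
  obtain K where K: "compact K" "K \<subseteq> \<Omega>" "\<And>x. x \<notin> K \<Longrightarrow> \<phi> x = 0"
    using \<phi> by (metis test_functionsE)
  have opK: "open (- K)" using compact_imp_closed[OF K(1)] by (rule open_Compl)
  have xK: "x \<in> - K" using K(2) False by blast
  have "partial_deriv i (\<lambda>y. sqrt (det (G y)) * (matrix_inv (G y) *v coord_grad \<phi> y) $ i) x
      = partial_deriv i (\<lambda>_. 0) x" for i
  proof (rule partial_deriv_cong[OF opK xK])
    fix y assume "y \<in> - K"
    then have "coord_grad \<phi> y = 0" by (intro coord_grad_eq_0[OF K(1,3)]) auto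
    then show "sqrt (det (G y)) * (matrix_inv (G y) *v coord_grad \<phi> y) $ i = 0" by simp
  qed
  then have "laplace_beltrami G \<phi> x = 0" by (simp add: laplace_beltrami_def partial_deriv_const)
  moreover have "flux_divergence \<phi> x = 0"
    using test_functions_eq_0[OF flux_divergence_test[OF \<phi>] False] .
  ultimately show ?thesis by simp
qed

lemma laplace_beltrami_test:
  assumes \<phi>: "\<phi> \<in> \<D>"
  shows "(\<lambda>x. - laplace_beltrami G \<phi> x) \<in> \<D>"
proof -
  have "(\<lambda>x. flux_divergence \<phi> x * \<rho> x powr (- real CARD('n))) \<in> \<D>"
    by (rule test_functions_mult[OF flux_divergence_test[OF \<phi>] open_ball])
       (rule cont_diff_on_powr[OF open_ball smooth \<rho>_pos])
  then have "laplace_beltrami G \<phi> \<in> \<D>" by (simp only: laplace_beltrami_eq[OF \<phi>, symmetric])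
  from test_functions_cmult[OF this, of "-1"] show ?thesis by simp
qed

text \<open>Componentwise integration by parts of \<psi> against the flux of \<phi>. It turns the
  distributional eigenvalue equation into one between the two forms.\<close>

lemma green_identity:
  assumes \<phi>: "\<phi> \<in> \<D>" and \<psi>: "\<psi> \<in> \<D>"
  shows "l2_form \<V> \<psi> (\<lambda>x. - laplace_beltrami G \<phi> x) = energy \<psi> \<phi>"
proof -
  note L = laplace_beltrami_test[OF \<phi>]
  have meas: "(\<lambda>x. \<psi> x * - laplace_beltrami G \<phi> x) \<in> borel_measurable borel"
    using borel_measurable_test[OF \<psi>] borel_measurable_test[OF L] by (rule borel_measurable_times)
  have mult_test: "(\<lambda>x. \<psi> x * flux i \<phi> x) \<in> \<D>" for i
    by (rule test_functions_mult[OF \<psi> open_ball])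
       (use cont_diff_on_subset[OF test_functions_cont_diff[OF flux_test[OF \<phi>]]] in blast)
  have i1: "integrable lborel (\<lambda>x. \<psi> x * partial_deriv i (flux i \<phi>) x)" for i
    by (rule integrable_test_test[OF \<psi> test_functions_partial_deriv[OF flux_test[OF \<phi>]]])
  have i2: "integrable lborel (\<lambda>x. partial_deriv i \<psi> x * flux i \<phi> x)" for i
    by (rule integrable_test_test[OF test_functions_partial_deriv[OF \<psi>] flux_test[OF \<phi>]])
  have parts: "(LINT x|lborel. \<psi> x * partial_deriv i (flux i \<phi>) x) = - (LINT x|lborel. partial_deriv i \<psi> x * flux i \<phi> x)" for i
  proof -
    have "0 = (LINT x|lborel. partial_deriv i (\<lambda>x. \<psi> x * flux i \<phi> x) x)"
      by (rule integral_partial_deriv[OF mult_test, symmetric])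
    also have "\<dots> = (LINT x|lborel. \<psi> x * partial_deriv i (flux i \<phi>) x + partial_deriv i \<psi> x * flux i \<phi> x)"
      by (rule Bochner_Integration.integral_cong[OF refl])
         (rule partial_deriv_mult[OF test_functions_differentiable[OF \<psi>] test_functions_differentiable[OF flux_test[OF \<phi>]]])
    also have "\<dots> = (LINT x|lborel. \<psi> x * partial_deriv i (flux i \<phi>) x) + (LINT x|lborel. partial_deriv i \<psi> x * flux i \<phi> x)"
      by (rule Bochner_Integration.integral_add[OF i1 i2])
    finally show ?thesis by linarith
  qed
  have "l2_form \<V> \<psi> (\<lambda>x. - laplace_beltrami G \<phi> x) = (LINT x|lborel. vol_weight x * (\<psi> x * - laplace_beltrami G \<phi> x))"
    unfolding l2_form_def by (rule LINT_metric[OF meas])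
  also have "\<dots> = (LINT x|lborel. - (\<Sum>i\<in>UNIV. \<psi> x * partial_deriv i (flux i \<phi>) x))"
  proof (rule Bochner_Integration.integral_cong[OF refl])
    fix x
    show "vol_weight x * (\<psi> x * - laplace_beltrami G \<phi> x) = - (\<Sum>i\<in>UNIV. \<psi> x * partial_deriv i (flux i \<phi>) x)"
    proof (cases "x \<in> \<Omega>")
      case True
      then have "\<rho> x ^ CARD('n) * \<rho> x powr (- real CARD('n)) = 1"
        using \<rho>_pos[OF True] by (simp add: powr_minus powr_realpow)
      then have "vol_weight x * (\<psi> x * - laplace_beltrami G \<phi> x) = - (\<psi> x * flux_divergence \<phi> x)"
        using True by (simp add: vol_weight_def laplace_beltrami_eq[OF \<phi>] mult_ac)
      then show ?thesis by (simp add: flux_divergence_def sum_distrib_left)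
    next
      case False
      then show ?thesis using test_functions_eq_0[OF \<psi>] by simp
    qed
  qed
  also have "\<dots> = - (\<Sum>i\<in>UNIV. LINT x|lborel. \<psi> x * partial_deriv i (flux i \<phi>) x)"
    using i1 by simp
  also have "\<dots> = (\<Sum>i\<in>UNIV. LINT x|lborel. partial_deriv i \<psi> x * flux i \<phi> x)"
    by (simp add: parts sum_negf)
  also have "\<dots> = (LINT x|lborel. (\<Sum>i\<in>UNIV. partial_deriv i \<psi> x * flux i \<phi> x))"
    using i2 by simp
  also have "\<dots> = energy \<psi> \<phi>"
    unfolding energy_def by (rule Bochner_Integration.integral_cong[OF refl])
      (simp add: flux_def inner_vec_def coord_grad_def sum_distrib_left mult_ac)
  finally show ?thesis .
qed

text \<open>Makes the Cauchy condition in \<open>sobolev_H10\<close> that of the energy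
  form.\<close>

lemma LINT_grad_norm_sq:
  assumes \<phi>: "\<phi> \<in> \<D>"
  shows "(LINT x|\<V>. grad_norm_sq G \<phi> x) = energy \<phi> \<phi>"
proof -
  have eq: "grad_norm_sq G \<phi> x = indicator \<Omega> x * \<rho> x powr (- 2) * (coord_grad \<phi> x \<bullet> coord_grad \<phi> x)" for x
    using coord_grad_outside[OF \<phi>, of x] \<rho>_pos[of x]
    by (cases "x \<in> \<Omega>") (auto simp: grad_norm_sq_def matrix_inv_G powr_minus powr_numeral divide_inverse)
  have [measurable]: "coord_grad \<phi> \<in> borel_measurable borel" by (rule borel_measurable_coord_grad[OF \<phi>])
  have [measurable]: "(\<lambda>x. indicator \<Omega> x * \<rho> x powr (- 2)) \<in> borel_measurable borel"
    using borel_measurable_continuous_on_indicator[OF _ cont_diff_on_continuous[OF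
        cont_diff_on_powr[OF open_ball smooth \<rho>_pos, of 0 "-2"]]] by simp
  have "(LINT x|\<V>. grad_norm_sq G \<phi> x) = (LINT x|lborel. vol_weight x * grad_norm_sq G \<phi> x)"
    unfolding eq by (rule LINT_metric) measurable
  also have "\<dots> = energy \<phi> \<phi>"
    unfolding energy_def
  proof (rule Bochner_Integration.integral_cong[OF refl])
    fix x
    show "vol_weight x * grad_norm_sq G \<phi> x = \<rho> x ^ (CARD('n) - 2) * (coord_grad \<phi> x \<bullet> coord_grad \<phi> x)"
    proof (cases "x \<in> \<Omega>")
      case True
      then show ?thesis
        using power_dim_minus_2[OF True] \<rho>_pos[OF True]
        by (simp add: eq vol_weight_def powr_minus powr_numeral divide_inverse mult.assoc[symmetric])
    next
      case False
      then show ?thesis using coord_grad_outside[OF \<phi>] by (simp add: vol_weight_def)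
    qed
  qed
  finally show ?thesis .
qed

section \<open>Identification of the abstract spectrum with the Dirichlet spectrum\<close>

interpretation L2: semi_inner "square_integrable \<V>" "l2_form \<V>"
  by (rule semi_inner_l2)

lemma test_L2: "\<phi> \<in> \<D> \<Longrightarrow> \<phi> \<in> square_integrable \<V>"
  using test_square_integrable by blast

text \<open>Vectors of the abstract completion are Cauchy sequences; this relates them to functions.\<close>

definition represents :: "(nat \<Rightarrow> real^'n \<Rightarrow> real) \<Rightarrow> (real^'n \<Rightarrow> real) \<Rightarrow> bool" where
  "represents s u \<longleftrightarrow> s \<in> e.cauchy_seqs \<and> u \<in> square_integrable \<V> \<and>
     (\<lambda>j. l2_form \<V> (s j - u) (s j - u)) \<longlonglongrightarrow> 0"

lemma representsD:
  "represents s u \<Longrightarrow> s \<in> e.cauchy_seqs" "represents s u \<Longrightarrow> u \<in> square_integrable \<V>"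
  "represents s u \<Longrightarrow> s j \<in> square_integrable \<V>"
  "represents s u \<Longrightarrow> (\<lambda>j. l2_form \<V> (s j - u) (s j - u)) \<longlonglongrightarrow> 0"
  by (auto simp: represents_def test_L2 e.cauchy_seqs_V)

lemma sobolev_iff: "u \<in> sobolev_H10 G \<Omega> \<longleftrightarrow> (\<exists>s. represents s u)"
proof -
  have l2: "(LINT x|\<V>. (\<phi> x - u x)\<^sup>2) = l2_form \<V> (\<phi> - u) (\<phi> - u)" for \<phi>
    by (simp add: l2_form_def power2_eq_square)
  have en: "(LINT x|\<V>. grad_norm_sq G (\<lambda>y. \<phi> y - \<psi> y) x) = energy (\<phi> - \<psi>) (\<phi> - \<psi>)"
    if "\<phi> \<in> \<D>" "\<psi> \<in> \<D>" for \<phi> \<psi>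
    using LINT_grad_norm_sq[OF m.closed(3)[OF that]] by (simp only: fun_diff_def)
  have "(\<forall>m. \<phi> m \<in> \<D>) \<and> (\<lambda>m. LINT x|\<V>. (\<phi> m x - u x)\<^sup>2) \<longlonglongrightarrow> 0 \<and>
      (\<forall>\<epsilon>>0. \<exists>M. \<forall>m\<ge>M. \<forall>l\<ge>M. (LINT x|\<V>. grad_norm_sq G (\<lambda>y. \<phi> m y - \<phi> l y) x) < \<epsilon>)
    \<longleftrightarrow> \<phi> \<in> e.cauchy_seqs \<and> (\<lambda>j. l2_form \<V> (\<phi> j - u) (\<phi> j - u)) \<longlonglongrightarrow> 0" for \<phi>
  proof (cases "\<forall>m. \<phi> m \<in> \<D>")
    case True
    then have "(LINT x|\<V>. grad_norm_sq G (\<lambda>y. \<phi> m y - \<phi> l y) x) = energy (\<phi> m - \<phi> l) (\<phi> m - \<phi> l)" for m l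
      using en by blast
    then show ?thesis using True unfolding l2 e.cauchy_seqs_def by auto
  next
    case False
    then show ?thesis unfolding e.cauchy_seqs_def by blast
  qed
  then show ?thesis
    unfolding sobolev_H10_def represents_def square_integrable_def by blast
qed

lemma ex_represented:
  assumes "s \<in> e.cauchy_seqs"
  shows "\<exists>u. represents s u"
proof -
  have "s \<in> m.cauchy_seqs" using assms cauchy_seqs_subset by blast
  then have "s \<in> L2.cauchy_seqs" by (simp add: m.cauchy_seqs_def L2.cauchy_seqs_def test_L2)
  from l2_complete[OF finite_measure_metric this] show ?thesis
    using assms by (auto simp: represents_def)
qed

lemma squeeze_0:
  fixes a b :: "nat \<Rightarrow> real"
  assumes "\<And>j. a j \<le> b j" "\<And>j. 0 \<le> a j" "b \<longlonglongrightarrow> 0"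
  shows "a \<longlonglongrightarrow> 0"
  using assms(3) by (rule tendsto_sandwich[OF _ _ tendsto_const, rotated 2]) (auto simp: assms)

lemma represents_add:
  assumes "represents s u" "represents t v"
  shows "represents (s + t) (u + v)"
  unfolding represents_def
proof (intro conjI)
  note D = representsD
  show "s + t \<in> e.cauchy_seqs" by (rule subspace_add[OF e.subspace_cauchy_seqs D(1)[OF assms(1)] D(1)[OF assms(2)]])
  show "u + v \<in> square_integrable \<V>" by (rule L2.closed(2)[OF D(2)[OF assms(1)] D(2)[OF assms(2)]])
  have "l2_form \<V> ((s + t) j - (u + v)) ((s + t) j - (u + v))
      \<le> 2 * l2_form \<V> (s j - u) (s j - u) + 2 * l2_form \<V> (t j - v) (t j - v)" for j
  proof -
    have "(s + t) j - (u + v) = (s j - u) + (t j - v)" by simp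
    then show ?thesis
      using L2.quad_add_le[OF L2.closed(3)[OF D(3)[OF assms(1), of j] D(2)[OF assms(1)]] L2.closed(3)[OF D(3)[OF assms(2), of j] D(2)[OF assms(2)]]]
      by (simp only:)
  qed
  moreover have "0 \<le> l2_form \<V> ((s + t) j - (u + v)) ((s + t) j - (u + v))" for j
    by (simp add: l2_form_def)
  moreover have "(\<lambda>j. 2 * l2_form \<V> (s j - u) (s j - u) + 2 * l2_form \<V> (t j - v) (t j - v)) \<longlonglongrightarrow> 2 * 0 + 2 * 0"
    by (intro tendsto_add tendsto_mult_left D(4) assms)
  then have "(\<lambda>j. 2 * l2_form \<V> (s j - u) (s j - u) + 2 * l2_form \<V> (t j - v) (t j - v)) \<longlonglongrightarrow> 0" by simp
  ultimately show "(\<lambda>j. l2_form \<V> ((s + t) j - (u + v)) ((s + t) j - (u + v))) \<longlonglongrightarrow> 0"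
    by (rule squeeze_0)
qed

lemma represents_scale:
  assumes "represents s u"
  shows "represents (r *\<^sub>R s) (r *\<^sub>R u)"
  unfolding represents_def
proof (intro conjI)
  note D = representsD[OF assms]
  show "r *\<^sub>R s \<in> e.cauchy_seqs" by (rule subspace_scale[OF e.subspace_cauchy_seqs D(1)])
  show "r *\<^sub>R u \<in> square_integrable \<V>" by (rule L2.closed(4)[OF D(2)])
  have "l2_form \<V> ((r *\<^sub>R s) j - r *\<^sub>R u) ((r *\<^sub>R s) j - r *\<^sub>R u) = r\<^sup>2 * l2_form \<V> (s j - u) (s j - u)" for j
    using L2.quad_scale[OF L2.closed(3)[OF D(3)[of j] D(2)], of r] by (simp only: scaleR_fun_apply scaleR_diff_right)
  then show "(\<lambda>j. l2_form \<V> ((r *\<^sub>R s) j - r *\<^sub>R u) ((r *\<^sub>R s) j - r *\<^sub>R u)) \<longlonglongrightarrow> 0"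
    using tendsto_mult_left[OF D(4), of "r\<^sup>2"] by (simp only: mult_zero_right)
qed

lemma represents_zero: "represents 0 0"
  unfolding represents_def
  using subspace_0[OF e.subspace_cauchy_seqs] L2.closed(1) by (simp add: l2_form_def)

lemma represents_lincomb:
  assumes "finite I" "\<And>i. i \<in> I \<Longrightarrow> represents (s i) (u i)"
  shows "represents (\<Sum>i\<in>I. c i *\<^sub>R s i) (\<Sum>i\<in>I. c i *\<^sub>R u i)"
  using assms
proof (induction I rule: finite_induct)
  case empty
  show ?case unfolding sum.empty by (rule represents_zero)
next
  case (insert i I)
  show ?case unfolding sum.insert[OF insert(1,2)]
    by (rule represents_add[OF represents_scale insert.IH]) (use insert.prems in auto)
qed

lemma represents_quad:
  assumes "represents s u"
  shows "lim_form (l2_form \<V>) s s = l2_form \<V> u u"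
  using m_LIMSEQ[OF representsD(1)[OF assms] representsD(1)[OF assms]]
    L2.tendsto_quad[OF representsD(3)[OF assms] representsD(2)[OF assms] representsD(4)[OF assms]]
  by (rule LIMSEQ_unique)

text \<open>For constant sequences of test functions the two equations coincide, by
  \<open>green_identity\<close> and L2 convergence. Constant sequences are dense in the completion,
  which extends the weak equation to every \<open>t\<close>.\<close>

lemma dirichlet_eigenspace_iff:
  assumes su: "represents s u"
  shows "u \<in> dirichlet_eigenspace G \<Omega> \<mu> \<longleftrightarrow>
     (\<forall>t\<in>e.cauchy_seqs. lim_form energy s t = \<mu> * lim_form (l2_form \<V>) s t)"
proof -
  interpret S: spectral_form e.cauchy_seqs "lim_form (l2_form \<V>)" "lim_form energy"
    "lo ^ (CARD('n) - 2) / (4 * R\<^sup>2 * hi ^ CARD('n))"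
    by (rule completion_spectral_form)
  note D = representsD[OF su]
  have lims: "lim_form energy s (\<lambda>_. \<phi>) = (LINT x|\<V>. u x * - laplace_beltrami G \<phi> x)"
    "lim_form (l2_form \<V>) s (\<lambda>_. \<phi>) = l2_form \<V> u \<phi>" if \<phi>: "\<phi> \<in> \<D>" for \<phi>
  proof -
    note C = e.const_cauchy_seqs[OF \<phi>]
    note L = laplace_beltrami_test[OF \<phi>]
    have "(\<lambda>j. l2_form \<V> (s j) (\<lambda>x. - laplace_beltrami G \<phi> x)) \<longlonglongrightarrow> l2_form \<V> u (\<lambda>x. - laplace_beltrami G \<phi> x)"
      by (rule L2.tendsto_left[OF D(3) D(2) test_L2[OF L] D(4)])
    then have "(\<lambda>j. energy (s j) \<phi>) \<longlonglongrightarrow> l2_form \<V> u (\<lambda>x. - laplace_beltrami G \<phi> x)"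
      by (simp only: green_identity[OF \<phi> e.cauchy_seqs_V[OF D(1)]])
    from LIMSEQ_unique[OF e.lim_form_LIMSEQ[OF D(1) C] this]
    show "lim_form energy s (\<lambda>_. \<phi>) = (LINT x|\<V>. u x * - laplace_beltrami G \<phi> x)"
      by (simp only: l2_form_def)
    have "(\<lambda>j. l2_form \<V> (s j) \<phi>) \<longlonglongrightarrow> l2_form \<V> u \<phi>"
      by (rule L2.tendsto_left[OF D(3) D(2) test_L2[OF \<phi>] D(4)])
    from LIMSEQ_unique[OF m_LIMSEQ[OF D(1) C] this]
    show "lim_form (l2_form \<V>) s (\<lambda>_. \<phi>) = l2_form \<V> u \<phi>" .
  qed
  have mu: "(LINT x|\<V>. \<mu> * u x * \<phi> x) = \<mu> * l2_form \<V> u \<phi>" for \<phi>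
    by (simp add: l2_form_def mult.assoc)
  have "u \<in> dirichlet_eigenspace G \<Omega> \<mu> \<longleftrightarrow>
      (\<forall>\<phi>\<in>\<D>. lim_form energy s (\<lambda>_. \<phi>) = \<mu> * lim_form (l2_form \<V>) s (\<lambda>_. \<phi>))"
    using sobolev_iff su by (auto simp: dirichlet_eigenspace_def lims mu)
  also have "\<dots> \<longleftrightarrow> (\<forall>t\<in>e.cauchy_seqs. lim_form energy s t = \<mu> * lim_form (l2_form \<V>) s t)"
  proof
    assume "\<forall>t\<in>e.cauchy_seqs. lim_form energy s t = \<mu> * lim_form (l2_form \<V>) s t"
    then show "\<forall>\<phi>\<in>\<D>. lim_form energy s (\<lambda>_. \<phi>) = \<mu> * lim_form (l2_form \<V>) s (\<lambda>_. \<phi>)"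
      using e.const_cauchy_seqs by blast
  next
    assume eq: "\<forall>\<phi>\<in>\<D>. lim_form energy s (\<lambda>_. \<phi>) = \<mu> * lim_form (l2_form \<V>) s (\<lambda>_. \<phi>)"
    show "\<forall>t\<in>e.cauchy_seqs. lim_form energy s t = \<mu> * lim_form (l2_form \<V>) s t"
    proof
      fix t assume t: "t \<in> e.cauchy_seqs"
      have C: "(\<lambda>_. t J) \<in> e.cauchy_seqs" for J
        by (rule e.const_cauchy_seqs[OF e.cauchy_seqs_V[OF t]])
      have e0: "(\<lambda>J. lim_form energy ((\<lambda>_. t J) - t) ((\<lambda>_. t J) - t)) \<longlonglongrightarrow> 0"
        using e.const_dense[OF t] by (simp only: S.e.quad_diff_commute[OF t C])
      have m0: "(\<lambda>J. lim_form (l2_form \<V>) ((\<lambda>_. t J) - t) ((\<lambda>_. t J) - t)) \<longlonglongrightarrow> 0"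
        by (rule S.m_tendsto_0[OF S.m.closed(3)[OF C t] e0])
      have "(\<lambda>J. lim_form energy (\<lambda>_. t J) s) \<longlonglongrightarrow> lim_form energy t s"
        by (rule S.e.tendsto_left[OF C t D(1) e0])
      moreover have "(\<lambda>J. \<mu> * lim_form (l2_form \<V>) (\<lambda>_. t J) s) \<longlonglongrightarrow> \<mu> * lim_form (l2_form \<V>) t s"
        by (intro tendsto_mult_left S.m.tendsto_left[OF C t D(1) m0])
      moreover have "lim_form energy (\<lambda>_. t J) s = \<mu> * lim_form (l2_form \<V>) (\<lambda>_. t J) s" for J
        using eq e.cauchy_seqs_V[OF t, of J] S.e.sym[OF C D(1), of J] S.m.sym[OF C D(1), of J] by metis
      ultimately have "lim_form energy t s = \<mu> * lim_form (l2_form \<V>) t s"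
        using LIMSEQ_unique by (simp only:) blast
      then show "lim_form energy s t = \<mu> * lim_form (l2_form \<V>) s t"
        using S.e.sym[OF t D(1)] S.m.sym[OF t D(1)] by metis
    qed
  qed
  finally show ?thesis .
qed

text \<open>Multiplicities match. Functions represented by the eigenvectors for \<mu> are
  independent because representation preserves mass; one more independent eigenfunction would,
  through \<open>eigenspace_dim_le\<close>, give a nontrivial combination of zero mass, that is, one
  equal to zero almost everywhere.\<close>

theorem lists_dirichlet_spectrum_form_eigval: "lists_dirichlet_spectrum G \<Omega> form_eigval"
proof -
  interpret S: spectral_form e.cauchy_seqs "lim_form (l2_form \<V>)" "lim_form energy"
    "lo ^ (CARD('n) - 2) / (4 * R\<^sup>2 * hi ^ CARD('n))"
    by (rule completion_spectral_form)
  have ev: "form_eigval = S.eigval" by (simp only: form_eigval_def)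
  have dim: "has_dim_ae \<V> (dirichlet_eigenspace G \<Omega> \<mu>) (card {j. S.eigval j = \<mu>})" for \<mu>
  proof -
    let ?J = "{j. S.eigval j = \<mu>}"
    let ?n = "card ?J"
    obtain g where g: "bij_betw g {..<?n} ?J"
      using ex_bij_betw_nat_finite[OF S.finite_eigval[of \<mu>]] by (auto simp: atLeast0LessThan)
    have gJ: "S.eigval (g i) = \<mu>" if "i < ?n" for i using g that by (auto simp: bij_betw_def)
    have ginj: "g i = g j \<longleftrightarrow> i = j" if "i < ?n" "j < ?n" for i j
      using g that by (auto simp: bij_betw_def inj_on_def)
    have "\<forall>k. \<exists>u. represents (S.eigvec k) u" using ex_represented[OF S.eigvec_V] by blast
    then obtain u where u: "\<And>k. represents (S.eigvec k) (u k)" by metis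
    have mem: "u (g i) \<in> dirichlet_eigenspace G \<Omega> \<mu>" if "i < ?n" for i
      using dirichlet_eigenspace_iff[OF u, of "g i" \<mu>] S.eigvec_weak gJ[OF that] by simp
    have indep: "lin_indep_ae \<V> ?n (\<lambda>i. u (g i))"
      unfolding lin_indep_ae_def
    proof (intro allI impI)
      fix c :: "nat \<Rightarrow> real" and i
      assume ae: "AE x in \<V>. (\<Sum>i<?n. c i * u (g i) x) = 0" and i: "i < ?n"
      let ?w = "\<Sum>i<?n. c i *\<^sub>R u (g i)" and ?s = "\<Sum>i<?n. c i *\<^sub>R S.eigvec (g i)"
      have r: "represents ?s ?w" by (rule represents_lincomb) (auto intro: u)
      have "AE x in \<V>. ?w x = 0"
        unfolding sum_fun_apply scaleR_fun_apply real_scaleR_def by (rule ae)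
      then have "l2_form \<V> ?w ?w = 0" using l2_form_eq_0_iff[OF representsD(2)[OF r]] by blast
      then have "lim_form (l2_form \<V>) ?s ?s = 0" using represents_quad[OF r] by simp
      moreover have "lim_form (l2_form \<V>) ?s ?s = (\<Sum>i<?n. \<Sum>j<?n. c i * c j * lim_form (l2_form \<V>) (S.eigvec (g i)) (S.eigvec (g j)))"
        by (rule S.m.lincomb_quad) (rule S.eigvec_V)
      moreover have "\<dots> = (\<Sum>i<?n. \<Sum>j<?n. if i = j then c i * c j else 0)"
        by (intro sum.cong refl) (auto simp: S.eigvec_orthonormal ginj)
      moreover have "\<dots> = (\<Sum>i<?n. c i * c i)" by simp
      ultimately have "(\<Sum>i<?n. c i * c i) = 0" by argo
      then show "c i = 0" using i by (subst (asm) sum_nonneg_eq_0_iff) auto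
    qed
    have ex: "\<exists>u. (\<forall>i<?n. u i \<in> dirichlet_eigenspace G \<Omega> \<mu>) \<and> lin_indep_ae \<V> ?n u"
      by (intro exI[of _ "\<lambda>i. u (g i)"] conjI allI impI mem indep)
    have "\<not> (\<exists>u. (\<forall>i<Suc ?n. u i \<in> dirichlet_eigenspace G \<Omega> \<mu>) \<and> lin_indep_ae \<V> (Suc ?n) u)"
    proof
      assume "\<exists>u. (\<forall>i<Suc ?n. u i \<in> dirichlet_eigenspace G \<Omega> \<mu>) \<and> lin_indep_ae \<V> (Suc ?n) u"
      then obtain u where u: "\<And>i. i \<le> ?n \<Longrightarrow> u i \<in> dirichlet_eigenspace G \<Omega> \<mu>" "lin_indep_ae \<V> (Suc ?n) u"
        by (auto simp: less_Suc_eq_le)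
      have "\<forall>i. \<exists>s. i \<le> ?n \<longrightarrow> represents s (u i)"
        using u(1) sobolev_iff by (auto simp: dirichlet_eigenspace_def)
      then obtain s where s: "\<And>i. i \<le> ?n \<Longrightarrow> represents (s i) (u i)" by metis
      have "\<exists>c. (\<exists>i\<le>?n. c i \<noteq> 0) \<and>
          lim_form (l2_form \<V>) (\<Sum>i\<le>?n. c i *\<^sub>R s i) (\<Sum>i\<le>?n. c i *\<^sub>R s i) = 0"
      proof (rule S.eigenspace_dim_le)
        show "s i \<in> e.cauchy_seqs" if "i \<le> ?n" for i using representsD(1)[OF s[OF that]] .
        show "lim_form energy (s i) z = \<mu> * lim_form (l2_form \<V>) (s i) z"
          if "i \<le> ?n" "z \<in> e.cauchy_seqs" for i z
          using dirichlet_eigenspace_iff[OF s[OF that(1)]] u(1)[OF that(1)] that(2) by blast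
      qed
      then obtain c where c: "\<exists>i\<le>?n. c i \<noteq> 0"
        "lim_form (l2_form \<V>) (\<Sum>i\<le>?n. c i *\<^sub>R s i) (\<Sum>i\<le>?n. c i *\<^sub>R s i) = 0" by blast
      have r: "represents (\<Sum>i\<le>?n. c i *\<^sub>R s i) (\<Sum>i\<le>?n. c i *\<^sub>R u i)"
        by (rule represents_lincomb) (auto intro: s)
      have "l2_form \<V> (\<Sum>i\<le>?n. c i *\<^sub>R u i) (\<Sum>i\<le>?n. c i *\<^sub>R u i) = 0"
        using c(2) represents_quad[OF r] by argo
      then have "AE x in \<V>. (\<Sum>i\<le>?n. c i *\<^sub>R u i) x = 0"
        using l2_form_eq_0_iff[OF representsD(2)[OF r]] by blast
      then have "AE x in \<V>. (\<Sum>i\<le>?n. c i * u i x) = 0"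
        unfolding sum_fun_apply scaleR_fun_apply real_scaleR_def .
      then have "AE x in \<V>. (\<Sum>i<Suc ?n. c i * u i x) = 0" by (simp only: lessThan_Suc_atMost)
      then have "\<forall>i<Suc ?n. c i = 0" 
        using u(2)[unfolded lin_indep_ae_def, THEN spec, of c] by (rule mp[rotated])
      then show False using c(1) by (auto simp: less_Suc_eq_le)
    qed
    then show ?thesis using ex unfolding has_dim_ae_def by blast
  qed
  show ?thesis
    unfolding lists_dirichlet_spectrum_def ev using S.eigval_mono S.finite_eigval dim by blast
qed

corollary dirichlet_eigenvalue_eq: "dirichlet_eigenvalue G \<Omega> k = form_eigval (k - 1)"
proof -
  have "(THE ev. lists_dirichlet_spectrum G \<Omega> ev) = form_eigval"
    by (rule the_equality) (auto intro: lists_dirichlet_spectrum_form_eigval lists_dirichlet_spectrum_unique)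
  then show ?thesis by (simp only: dirichlet_eigenvalue_def)
qed

end

section \<open>Reduction to a weighted problem on the unit ball\<close>

text \<open>Squared L2 norm with the weight \<open>w\<^sub>a\<^sup>2\<close> stripped of its
  constant numerator (1 + a)^2.\<close>

definition unit_mass :: "real \<Rightarrow> (real^'n::finite \<Rightarrow> real) \<Rightarrow> real" where
  "unit_mass a v = (LINT y|lborel. (v y / (1 + a * (y \<bullet> y)))\<^sup>2)"

lemma one_plus_pos:
  fixes y :: "real^'n::finite"
  assumes "1 + a > 0" "y \<in> ball 0 1"
  shows "1 + a * (y \<bullet> y) > 0"
proof -
  have yy: "y \<bullet> y < 1" "0 \<le> y \<bullet> y"
    using assms(2) by (auto simp: norm_eq_sqrt_inner)
  show ?thesis
  proof (cases "a \<ge> 0")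
    case True
    then show ?thesis using yy by (intro add_pos_nonneg) auto
  next
    case False
    then have "a * (y \<bullet> y) \<ge> a" using yy mult_left_mono_neg[of "y \<bullet> y" 1 a] by simp
    then show ?thesis using assms(1) by linarith
  qed
qed

lemma one_plus_bounds:
  fixes y :: "real^'n::finite"
  assumes "R > 0" "y \<in> ball 0 R"
  shows "min 1 (1 + \<kappa> * R\<^sup>2) \<le> 1 + \<kappa> * (y \<bullet> y)" "1 + \<kappa> * (y \<bullet> y) \<le> max 1 (1 + \<kappa> * R\<^sup>2)"
proof -
  have "norm y \<le> R" using assms by simp
  then have "(norm y)\<^sup>2 \<le> R\<^sup>2" by (intro power_mono) auto
  then have yy: "y \<bullet> y \<le> R\<^sup>2" "0 \<le> y \<bullet> y" by (auto simp: power2_norm_eq_inner)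
  have "\<kappa> \<ge> 0 \<Longrightarrow> 0 \<le> \<kappa> * (y \<bullet> y) \<and> \<kappa> * (y \<bullet> y) \<le> \<kappa> * R\<^sup>2"
    using yy by (simp add: mult_left_mono)
  moreover have "\<kappa> \<le> 0 \<Longrightarrow> \<kappa> * (y \<bullet> y) \<le> 0 \<and> \<kappa> * R\<^sup>2 \<le> \<kappa> * (y \<bullet> y)"
    using yy by (simp add: mult_left_mono_neg mult_nonpos_nonneg)
  ultimately show "min 1 (1 + \<kappa> * R\<^sup>2) \<le> 1 + \<kappa> * (y \<bullet> y)" "1 + \<kappa> * (y \<bullet> y) \<le> max 1 (1 + \<kappa> * R\<^sup>2)"
    by linarith+
qed

lemma cont_diff_on_one_plus: "open S \<Longrightarrow> cont_diff_on m S (\<lambda>y. 1 + a * (y \<bullet> y))"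
  by (intro cont_diff_on_add cont_diff_on_mult cont_diff_on_inner_self) auto

lemma cont_diff_on_one_plus_powr:
  fixes a R :: real
  assumes "R > 0" "1 + a * R\<^sup>2 > 0"
  shows "cont_diff_on m (ball (0 :: real^'n::finite) R) (\<lambda>y. (1 + a * (y \<bullet> y)) powr q)"
proof (rule cont_diff_on_powr[OF open_ball cont_diff_on_one_plus[OF open_ball]])
  show "0 < 1 + a * (y \<bullet> y)" if "y \<in> ball 0 R" for y :: "real^'n"
    using one_plus_bounds(1)[OF assms(1) that, of a] assms(2) by (auto simp: min_def split: if_splits)
qed

lemma partial_deriv_one_plus_powr:
  fixes y :: "real^'n::finite"
  assumes "1 + a * (y \<bullet> y) > 0"
  shows "partial_deriv i (\<lambda>y. (1 + a * (y \<bullet> y)) powr q) y = q * (1 + a * (y \<bullet> y)) powr (q - 1) * (2 * a * y $ i)"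
    and "(\<lambda>y. (1 + a * (y \<bullet> y)) powr q) differentiable (at y)"
proof -
  have d: "((\<lambda>y. 1 + a * (y \<bullet> y)) has_derivative (\<lambda>h. a * (2 * (y \<bullet> h)))) (at y)"
    using has_derivative_add[OF has_derivative_const has_derivative_mult_right[OF has_derivative_inner_self]]
    by simp
  have "((\<lambda>t. t powr q) has_real_derivative q * (1 + a * (y \<bullet> y)) powr (q - 1)) (at (1 + a * (y \<bullet> y)))"
    using assms by (auto intro!: derivative_eq_intros)
  from DERIV_compose_FDERIV[OF this d]
  have D: "((\<lambda>y. (1 + a * (y \<bullet> y)) powr q) has_derivative
      (\<lambda>h. a * (2 * (y \<bullet> h)) * (q * (1 + a * (y \<bullet> y)) powr (q - 1)))) (at y)" .
  then show "(\<lambda>y. (1 + a * (y \<bullet> y)) powr q) differentiable (at y)" by (auto simp: differentiable_def)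
  show "partial_deriv i (\<lambda>y. (1 + a * (y \<bullet> y)) powr q) y = q * (1 + a * (y \<bullet> y)) powr (q - 1) * (2 * a * y $ i)"
    using partial_deriv_eqI[OF D, of i] by (simp add: inner_axis mult_ac)
qed

text \<open>\<open>(1 + a |y|\<^sup>2)\<^bsup>p\<^esup>\<close> solves the Yamabe equation; the identity holds pointwise up to the divergence
  of the field \<open>F\<close> of the proof.\<close>

lemma conformal_energy_identity:
  fixes \<psi> :: "real^'n::finite \<Rightarrow> real"
  assumes a: "1 + a > 0" and dim: "CARD('n) \<ge> 2" and \<psi>: "\<psi> \<in> test_functions (ball 0 1)"
  defines "p \<equiv> - (real CARD('n) - 2) / 2"
  defines "v \<equiv> (\<lambda>y. \<psi> y * (1 + a * (y \<bullet> y)) powr p)"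
  shows "dirichlet_energy v = (LINT y|lborel. (1 / (1 + a * (y \<bullet> y))) ^ (CARD('n) - 2) * (coord_grad \<psi> y \<bullet> coord_grad \<psi> y))
     + real CARD('n) * (real CARD('n) - 2) * a * unit_mass a v"
    and "unit_mass a v = (LINT y|lborel. (1 / (1 + a * (y \<bullet> y))) ^ CARD('n) * (\<psi> y)\<^sup>2)"
    and "v \<in> test_functions (ball 0 1)"
proof -
  let ?n = "real CARD('n)" and ?B = "ball (0 :: real^'n) 1"
  let ?s = "\<lambda>y :: real^'n. 1 + a * (y \<bullet> y)"
  let ?H = "\<lambda>y. ?s y powr (p - 1)"
  note spos = one_plus_pos[OF a]
  have smooth: "cont_diff_on m ?B (\<lambda>y. ?s y powr q)" for m q
    using cont_diff_on_one_plus_powr[of 1 a] a by simp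
  show v: "v \<in> test_functions ?B"
    unfolding v_def by (rule test_functions_mult[OF \<psi> open_ball smooth])
  \<comment> \<open>With h = (1 + a |y|^2)^p this is the i-th component of \<psi>^2 h grad h. Indeed
    |grad (\<psi> h)|^2 - h^2 |grad \<psi>|^2 is the divergence of that field minus \<psi>^2 h
    Laplace(h), and -h Laplace(h) is n (n - 2) a (1 + a |y|^2)^-n.\<close>
  define F where "F i y = \<psi> y * (\<psi> y * (2 * a * p * (y $ i * ?s y powr (2 * p - 1))))" for i y
  have cd\<psi>: "cont_diff_on m ?B \<psi>" for m
    using test_functions_cont_diff[OF \<psi>] cont_diff_on_subset by blast
  have F: "F i \<in> test_functions ?B" for i
    unfolding F_def[abs_def] by (intro test_functions_mult[OF \<psi>] cont_diff_on_mult cd\<psi> smooth) auto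
  \<comment> \<open>Since 2 (p - 1) = -n, the square of \<open>?H\<close> is the volume
    density.\<close>
  have H2: "(?H y)\<^sup>2 = (1 / ?s y) ^ CARD('n)" if "y \<in> ?B" for y
  proof -
    have "(?H y)\<^sup>2 = ?s y powr (- ?n)"
      using spos[OF that] by (simp add: p_def powr_power field_simps)
    then show ?thesis using spos[OF that] by (simp add: powr_minus powr_realpow power_one_over inverse_eq_divide)
  qed
  have h: "?s y powr p = ?H y * ?s y" if "y \<in> ?B" for y
    using spos[OF that] powr_mult_base[of "?s y" "p - 1"] by (simp add: mult.commute)
  have h2: "?s y powr (2 * p - 1) = (?H y)\<^sup>2 * ?s y" "?s y powr (2 * p - 2) = (?H y)\<^sup>2" if "y \<in> ?B" for y
    using spos[OF that] powr_mult_base[of "?s y" "2 * p - 2"]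
    by (simp_all add: powr_power mult.commute algebra_simps)
  have mass: "(v y / ?s y)\<^sup>2 = (1 / ?s y) ^ CARD('n) * (\<psi> y)\<^sup>2" for y
  proof (cases "y \<in> ?B")
    case True
    then have "v y / ?s y = \<psi> y * ?H y" using spos[OF True] by (simp add: v_def h)
    then show ?thesis using H2[OF True] by (simp add: power_mult_distrib)
  next
    case False
    then show ?thesis using test_functions_eq_0[OF \<psi>] by (simp add: v_def)
  qed
  then show "unit_mass a v = (LINT y|lborel. (1 / ?s y) ^ CARD('n) * (\<psi> y)\<^sup>2)"
    by (simp add: unit_mass_def)
  have diff\<psi>: "\<psi> differentiable (at y)" for y by (rule test_functions_differentiable[OF \<psi>])
  have pw: "coord_grad v y \<bullet> coord_grad v y =
      (1 / ?s y) ^ (CARD('n) - 2) * (coord_grad \<psi> y \<bullet> coord_grad \<psi> y)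
      + (\<Sum>i\<in>UNIV. partial_deriv i (F i) y) + ?n * (?n - 2) * a * (v y / ?s y)\<^sup>2" for y
  proof (cases "y \<in> ?B")
    case True
    note s = spos[OF True]
    let ?d = "\<lambda>i. partial_deriv i \<psi> y"
    have dv: "partial_deriv i v y = ?d i * (?H y * ?s y) + \<psi> y * (2 * a * p * (y $ i) * ?H y)" for i
      unfolding v_def using s
      by (subst partial_deriv_mult[OF diff\<psi> partial_deriv_one_plus_powr(2)])
         (auto simp: partial_deriv_one_plus_powr(1) h[OF True])
    have dg: "partial_deriv i (\<lambda>y. 2 * a * p * (y $ i * ?s y powr (2 * p - 1))) y
        = 2 * a * p * ((?H y)\<^sup>2 * ?s y + y $ i * ((2 * p - 1) * (?H y)\<^sup>2 * (2 * a * y $ i)))"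
      and dgd: "(\<lambda>y. 2 * a * p * (y $ i * ?s y powr (2 * p - 1))) differentiable (at y)" for i
    proof -
      have 1: "(\<lambda>y. y $ i * ?s y powr (2 * p - 1)) differentiable (at y)"
        by (intro differentiable_mult differentiable_component partial_deriv_one_plus_powr(2) s)
      show "(\<lambda>y. 2 * a * p * (y $ i * ?s y powr (2 * p - 1))) differentiable (at y)"
        by (rule differentiable_mult[OF differentiable_const 1])
      have "partial_deriv i (\<lambda>y. y $ i * ?s y powr (2 * p - 1)) y =
          y $ i * ((2 * p - 1) * ?s y powr (2 * p - 2) * (2 * a * y $ i)) + ?s y powr (2 * p - 1)"
        using partial_deriv_mult[OF differentiable_component partial_deriv_one_plus_powr(2)[OF s], of i i "2 * p - 1"]
        by (simp add: partial_deriv_component partial_deriv_one_plus_powr(1)[OF s])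
      then show "partial_deriv i (\<lambda>y. 2 * a * p * (y $ i * ?s y powr (2 * p - 1))) y
        = 2 * a * p * ((?H y)\<^sup>2 * ?s y + y $ i * ((2 * p - 1) * (?H y)\<^sup>2 * (2 * a * y $ i)))"
        using partial_deriv_mult[OF differentiable_const 1, of i "2 * a * p"]
        by (simp add: partial_deriv_const h2[OF True] add.commute)
    qed
    have dF: "partial_deriv i (F i) y = 4 * a * p * (y $ i) * ((?H y)\<^sup>2 * ?s y) * (\<psi> y * ?d i)
        + (\<psi> y)\<^sup>2 * (2 * a * p * ((?H y)\<^sup>2 * ?s y + (2 * p - 1) * (?H y)\<^sup>2 * (2 * a * (y $ i)\<^sup>2)))" for i
    proof -
      let ?g = "\<lambda>y. 2 * a * p * (y $ i * ?s y powr (2 * p - 1))"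
      have gy: "?g y = 2 * a * p * (y $ i * ((?H y)\<^sup>2 * ?s y))" by (simp only: h2[OF True])
      have 2: "(\<lambda>y. \<psi> y * ?g y) differentiable (at y)" by (intro differentiable_mult diff\<psi> dgd)
      have "partial_deriv i (F i) y = \<psi> y * partial_deriv i (\<lambda>y. \<psi> y * ?g y) y + ?d i * (\<psi> y * ?g y)"
        unfolding F_def[abs_def] by (rule partial_deriv_mult[OF diff\<psi> 2])
      also have "partial_deriv i (\<lambda>y. \<psi> y * ?g y) y = \<psi> y * partial_deriv i ?g y + ?d i * ?g y"
        by (rule partial_deriv_mult[OF diff\<psi> dgd])
      finally show ?thesis unfolding dg gy by (simp add: power2_eq_square algebra_simps)
    qed
    have each: "(partial_deriv i v y)\<^sup>2 - partial_deriv i (F i) y =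
       (?H y)\<^sup>2 * (?s y)\<^sup>2 * (?d i)\<^sup>2 + (\<psi> y)\<^sup>2 * (?H y)\<^sup>2 * (2 * a * p) * ((2 * a * p - 2 * a * (2 * p - 1)) * (y $ i)\<^sup>2 - ?s y)" for i
      unfolding dv dF by (simp add: power2_eq_square algebra_simps)
    have yy: "(\<Sum>i\<in>UNIV. (y $ i)\<^sup>2) = y \<bullet> y" by (simp add: inner_vec_def power2_eq_square)
    have gg: "(\<Sum>i\<in>UNIV. (partial_deriv i f y)\<^sup>2) = coord_grad f y \<bullet> coord_grad f y" for f
      by (simp add: inner_vec_def coord_grad_def power2_eq_square)
    have "coord_grad v y \<bullet> coord_grad v y - (\<Sum>i\<in>UNIV. partial_deriv i (F i) y)
        = (\<Sum>i\<in>UNIV. (partial_deriv i v y)\<^sup>2 - partial_deriv i (F i) y)"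
      by (simp add: sum_subtractf gg)
    also have "\<dots> = (?H y)\<^sup>2 * (?s y)\<^sup>2 * (coord_grad \<psi> y \<bullet> coord_grad \<psi> y)
        + (\<psi> y)\<^sup>2 * (?H y)\<^sup>2 * (2 * a * p) * ((2 * a * p - 2 * a * (2 * p - 1)) * (y \<bullet> y) - ?n * ?s y)"
      unfolding each by (simp only: sum.distrib sum_distrib_left[symmetric] sum_subtractf gg yy sum_constant)
         (simp only: distrib_left mult_1_right mult.left_commute)
    \<comment> \<open>Here the exponent matters: 2 a p - 2 a (2 p - 1) = a n, so the terms in |y|^2
      cancel.\<close>
    also have "(2 * a * p - 2 * a * (2 * p - 1)) * (y \<bullet> y) - ?n * ?s y = - ?n"
      by (simp add: p_def field_simps)
    also have "(\<psi> y)\<^sup>2 * (?H y)\<^sup>2 * (2 * a * p) * - ?n = ?n * (?n - 2) * a * ((?H y)\<^sup>2 * (\<psi> y)\<^sup>2)"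
      by (simp add: p_def field_simps)
    also have "(?H y)\<^sup>2 * (\<psi> y)\<^sup>2 = (v y / ?s y)\<^sup>2" using mass[of y] H2[OF True] by simp
    also have "(?H y)\<^sup>2 * (?s y)\<^sup>2 = (1 / ?s y) ^ (CARD('n) - 2)"
    proof -
      have "CARD('n) = (CARD('n) - 2) + 2" using dim by simp
      then have "(1 / ?s y) ^ CARD('n) = (1 / ?s y) ^ (CARD('n) - 2) * (1 / ?s y)\<^sup>2" by (metis power_add)
      then show ?thesis using s H2[OF True] by (simp add: power_one_over)
    qed
    finally show ?thesis by argo
  next
    case False
    have "coord_grad f y = 0" if f: "f \<in> test_functions ?B" for f
    proof -
      obtain K where "compact K" "K \<subseteq> ?B" "\<And>x. x \<notin> K \<Longrightarrow> f x = 0" using f by (metis test_functionsE)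
      then show ?thesis using False by (intro coord_grad_eq_0[of K]) auto
    qed
    moreover have "partial_deriv i (F i) y = 0" for i
      using test_functions_eq_0[OF test_functions_partial_deriv[OF F] False] .
    ultimately show ?thesis using v \<psi> test_functions_eq_0[OF v False] by simp
  qed
  have cont: "continuous_on ?B (\<lambda>y. (1 / ?s y) ^ k)" for k
  proof (intro continuous_intros ballI)
    show "1 + a * (y \<bullet> y) \<noteq> 0" if "y \<in> ?B" for y using spos[OF that] by linarith
  qed
  have i1: "integrable lborel (\<lambda>y. (1 / ?s y) ^ (CARD('n) - 2) * (coord_grad \<psi> y \<bullet> coord_grad \<psi> y))"
    by (rule integrable_grad_grad[OF \<psi> \<psi> cont])
  have i2: "integrable lborel (\<lambda>y. partial_deriv i (F i) y)" for i
    by (rule integrable_test[OF test_functions_partial_deriv[OF F]])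
  have i3: "integrable lborel (\<lambda>y. (v y / ?s y)\<^sup>2)"
    unfolding mass
    using integrable_test_mult[OF \<psi> continuous_on_mult[OF cont[of "CARD('n)"] cont_diff_on_continuous[OF cd\<psi>[of 0]]]]
    by (simp add: power2_eq_square mult_ac)
  have "dirichlet_energy v = (LINT y|lborel. (1 / ?s y) ^ (CARD('n) - 2) * (coord_grad \<psi> y \<bullet> coord_grad \<psi> y))
     + (\<Sum>i\<in>UNIV. (LINT y|lborel. partial_deriv i (F i) y)) + ?n * (?n - 2) * a * unit_mass a v"
    unfolding dirichlet_energy_def pw unit_mass_def using i1 i2 i3
    by (simp add: Bochner_Integration.integral_add Bochner_Integration.integral_sum)
  then show "dirichlet_energy v = (LINT y|lborel. (1 / ?s y) ^ (CARD('n) - 2) * (coord_grad \<psi> y \<bullet> coord_grad \<psi> y))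
     + ?n * (?n - 2) * a * unit_mass a v"
    by (simp add: integral_partial_deriv[OF F])
qed

lemma integral_scaled:
  fixes f :: "real^'n::finite \<Rightarrow> real"
  assumes "R > 0" "f \<in> borel_measurable borel"
  shows "(LINT x|lborel. f x) = R ^ CARD('n) * (LINT y|lborel. f (R *\<^sub>R y))"
proof -
  have "lborel = density (distr lborel borel (\<lambda>x :: real^'n. 0 + R *\<^sub>R x)) (\<lambda>_. ennreal (\<bar>R\<bar> ^ DIM(real^'n)))"
    using lborel_affine[of R "0 :: real^'n"] assms(1) by (simp add: ennreal_power)
  then have "(LINT x|lborel. f x) = (LINT x|density (distr lborel borel (\<lambda>x :: real^'n. 0 + R *\<^sub>R x)) (\<lambda>_. ennreal (\<bar>R\<bar> ^ DIM(real^'n))). f x)"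
    by simp
  also have "\<dots> = (LINT x|distr lborel borel (\<lambda>x :: real^'n. 0 + R *\<^sub>R x). (\<bar>R\<bar> ^ DIM(real^'n)) *\<^sub>R f x)"
    using assms by (intro integral_density) auto
  also have "\<dots> = (LINT x|lborel. (\<bar>R\<bar> ^ DIM(real^'n)) *\<^sub>R f (0 + R *\<^sub>R x))"
    using assms by (intro integral_distr) auto
  also have "\<dots> = R ^ CARD('n) * (LINT y|lborel. f (R *\<^sub>R y))"
    using assms(1) by simp
  finally show ?thesis .
qed

text \<open>\<open>\<nu>\<close> is the \<open>(k+1)\<close>-st eigenvalue of \<open>-\<Delta> v = \<nu> (1 + a |y|\<^sup>2)\<^bsup>-2\<^esup> v\<close> on the unit ball,
  characterised by the min-max principle over test functions.\<close>

definition unit_minmax :: "'n::finite itself \<Rightarrow> real \<Rightarrow> nat \<Rightarrow> real \<Rightarrow> bool" where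
  "unit_minmax _ a k \<nu> \<longleftrightarrow>
    (\<forall>(f :: nat \<Rightarrow> real^'n \<Rightarrow> real) N. (\<forall>i\<le>k. f i \<in> test_functions (ball 0 1)) \<and>
       (\<forall>c. (\<exists>i\<le>k. c i \<noteq> 0) \<longrightarrow> 0 < unit_mass a (\<Sum>i\<le>k. c i *\<^sub>R f i) \<and>
          dirichlet_energy (\<Sum>i\<le>k. c i *\<^sub>R f i) \<le> N * unit_mass a (\<Sum>i\<le>k. c i *\<^sub>R f i)) \<longrightarrow> \<nu> \<le> N) \<and>
    (\<forall>\<delta>>0. \<exists>f :: nat \<Rightarrow> real^'n \<Rightarrow> real. (\<forall>i\<le>k. f i \<in> test_functions (ball 0 1)) \<and>
       (\<forall>c. (\<exists>i\<le>k. c i \<noteq> 0) \<longrightarrow> 0 < unit_mass a (\<Sum>i\<le>k. c i *\<^sub>R f i) \<and>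
          dirichlet_energy (\<Sum>i\<le>k. c i *\<^sub>R f i) \<le> (\<nu> + \<delta>) * unit_mass a (\<Sum>i\<le>k. c i *\<^sub>R f i)))"

lemma test_lincomb:
  "(\<And>i. i \<in> I \<Longrightarrow> f i \<in> test_functions S) \<Longrightarrow> (\<Sum>i\<in>I. c i *\<^sub>R f i) \<in> test_functions S"
  by (intro subspace_sum subspace_scale subspace_test_functions)

lemma unit_minmax_upper:
  fixes f :: "nat \<Rightarrow> real^'n::finite \<Rightarrow> real"
  assumes "unit_minmax TYPE('n) a k \<nu>" "\<And>i. i \<le> k \<Longrightarrow> f i \<in> test_functions (ball 0 1)"
    and "\<And>c. \<exists>i\<le>k. c i \<noteq> 0 \<Longrightarrow> 0 < unit_mass a (\<Sum>i\<le>k. c i *\<^sub>R f i) \<and>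
          dirichlet_energy (\<Sum>i\<le>k. c i *\<^sub>R f i) \<le> N * unit_mass a (\<Sum>i\<le>k. c i *\<^sub>R f i)"
  shows "\<nu> \<le> N"
  using assms(1)[unfolded unit_minmax_def, THEN conjunct1, THEN spec[of _ f], THEN spec[of _ N]] assms(2,3) by blast

lemma unit_minmax_lower:
  assumes "unit_minmax TYPE('n::finite) a k \<nu>" "\<delta> > 0"
  shows "\<exists>f :: nat \<Rightarrow> real^'n \<Rightarrow> real. (\<forall>i\<le>k. f i \<in> test_functions (ball 0 1)) \<and>
       (\<forall>c. (\<exists>i\<le>k. c i \<noteq> 0) \<longrightarrow> 0 < unit_mass a (\<Sum>i\<le>k. c i *\<^sub>R f i) \<and>
          dirichlet_energy (\<Sum>i\<le>k. c i *\<^sub>R f i) \<le> (\<nu> + \<delta>) * unit_mass a (\<Sum>i\<le>k. c i *\<^sub>R f i))"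
  using assms(1)[unfolded unit_minmax_def, THEN conjunct2, THEN spec, THEN mp, OF assms(2)] .

lemma unit_minmax_nonneg:
  assumes "unit_minmax TYPE('n::finite) a k \<nu>"
  shows "\<nu> \<ge> 0"
proof (rule field_le_epsilon)
  fix \<delta> :: real assume "\<delta> > 0"
  from unit_minmax_lower[OF assms this] obtain f :: "nat \<Rightarrow> real^'n \<Rightarrow> real" where
    "\<forall>i\<le>k. f i \<in> test_functions (ball 0 1)" and
    f: "\<forall>c. (\<exists>i\<le>k. c i \<noteq> 0) \<longrightarrow> 0 < unit_mass a (\<Sum>i\<le>k. c i *\<^sub>R f i) \<and>
          dirichlet_energy (\<Sum>i\<le>k. c i *\<^sub>R f i) \<le> (\<nu> + \<delta>) * unit_mass a (\<Sum>i\<le>k. c i *\<^sub>R f i)"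
    by (elim exE conjE)
  \<comment> \<open>One nonzero combination suffices; all coefficients are taken to be 1.\<close>
  have "\<exists>i\<le>k. (1 :: real) \<noteq> 0" by auto
  from f[THEN spec[of _ "\<lambda>_. 1"], THEN mp, OF this] dirichlet_energy_nonneg[of "\<Sum>i\<le>k. 1 *\<^sub>R f i"]
  have "0 \<le> (\<nu> + \<delta>) * unit_mass a (\<Sum>i\<le>k. 1 *\<^sub>R f i)" "0 < unit_mass a (\<Sum>i\<le>k. 1 *\<^sub>R f i)" by linarith+
  then show "0 \<le> \<nu> + \<delta>" by (simp add: zero_le_mult_iff)
qed

text \<open>\<open>(1 + a) / (1 + a |y|\<^sup>2)\<close> increases with \<open>a\<close> for \<open>|y| < 1\<close>.\<close>

lemma unit_mass_mono:
  fixes v :: "real^'n::finite \<Rightarrow> real"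
  assumes a: "-1 < a" "a \<le> a'" and v: "v \<in> test_functions (ball 0 1)"
  shows "(1 + a)\<^sup>2 * unit_mass a v \<le> (1 + a')\<^sup>2 * unit_mass a' v"
proof -
  have pos: "1 + a > 0" "1 + a' > 0" using a by auto
  have int: "integrable lborel (\<lambda>y. (1 + t)\<^sup>2 * (v y / (1 + t * (y \<bullet> y)))\<^sup>2)" if "1 + t > 0" for t
  proof -
    have c: "continuous_on (ball (0 :: real^'n) 1) (\<lambda>y. 1 / (1 + t * (y \<bullet> y)))"
    proof (intro continuous_intros ballI)
      show "1 + t * (y \<bullet> y) \<noteq> 0" if y: "y \<in> ball 0 1" for y :: "real^'n"
        using one_plus_pos[OF \<open>1 + t > 0\<close> y] by linarith
    qed
    have cv: "continuous_on (ball (0 :: real^'n) 1) v"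
      using test_functions_continuous[OF v] continuous_on_subset by blast
    have "integrable lborel (\<lambda>y. v y * (v y * (1 / (1 + t * (y \<bullet> y)) * (1 / (1 + t * (y \<bullet> y))))))"
      by (intro integrable_test_mult[OF v] continuous_on_mult cv c)
    then have "integrable lborel (\<lambda>y. (v y / (1 + t * (y \<bullet> y)))\<^sup>2)" by (simp add: power2_eq_square)
    then show ?thesis by (rule integrable_mult_right)
  qed
  have "(LINT y|lborel. (1 + a)\<^sup>2 * (v y / (1 + a * (y \<bullet> y)))\<^sup>2) \<le> (LINT y|lborel. (1 + a')\<^sup>2 * (v y / (1 + a' * (y \<bullet> y)))\<^sup>2)"
  proof (rule integral_mono[OF int[OF pos(1)] int[OF pos(2)]])
    fix y :: "real^'n"
    show "(1 + a)\<^sup>2 * (v y / (1 + a * (y \<bullet> y)))\<^sup>2 \<le> (1 + a')\<^sup>2 * (v y / (1 + a' * (y \<bullet> y)))\<^sup>2"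
    proof (cases "y \<in> ball 0 1")
      case True
      have yy: "y \<bullet> y \<le> 1" using True by (simp add: norm_eq_sqrt_inner)
      note s = one_plus_pos[OF pos(1) True] one_plus_pos[OF pos(2) True]
      \<comment> \<open>The two sides of the cross-multiplied inequality differ by exactly this
        product.\<close>
      have "0 \<le> (a' - a) * (1 - y \<bullet> y)" using a yy by (intro mult_nonneg_nonneg) auto
      then have "(1 + a) * (1 + a' * (y \<bullet> y)) \<le> (1 + a') * (1 + a * (y \<bullet> y))" by (simp add: algebra_simps)
      then have le: "(1 + a) / (1 + a * (y \<bullet> y)) \<le> (1 + a') / (1 + a' * (y \<bullet> y))"
        using s by (simp add: divide_le_eq le_divide_eq mult.commute)
      have "((1 + a) / (1 + a * (y \<bullet> y)))\<^sup>2 \<le> ((1 + a') / (1 + a' * (y \<bullet> y)))\<^sup>2"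
        using pos s by (intro power_mono[OF le]) auto
      then have "((1 + a) / (1 + a * (y \<bullet> y)))\<^sup>2 * (v y)\<^sup>2 \<le> ((1 + a') / (1 + a' * (y \<bullet> y)))\<^sup>2 * (v y)\<^sup>2"
        by (rule mult_right_mono) simp
      then show ?thesis by (simp add: power_divide mult.commute)
    next
      case False
      then show ?thesis using test_functions_eq_0[OF v] by simp
    qed
  qed
  then show ?thesis by (simp add: unit_mass_def)
qed

text \<open>This is the monotonicity of \<open>K\<close>: near-optimal trial functions for
  \<open>a\<close> are used unchanged for \<open>a'\<close>, where the energy is the same and only
  the normalised mass may have grown.\<close>

lemma unit_minmax_mono:
  assumes a: "-1 < a" "a \<le> a'" and \<nu>: "unit_minmax TYPE('n::finite) a k \<nu>" and \<nu>': "unit_minmax TYPE('n) a' k \<nu>'"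
  shows "\<nu>' / (1 + a')\<^sup>2 \<le> \<nu> / (1 + a)\<^sup>2"
proof (rule field_le_epsilon)
  fix \<eta> :: real assume e: "\<eta> > 0"
  define q where "q = (1 + a)\<^sup>2"
  define q' where "q' = (1 + a')\<^sup>2"
  have q: "q > 0" "q' > 0" using a by (auto simp: q_def q'_def)
  have d: "\<eta> * q > 0" using e q by simp
  from unit_minmax_lower[OF \<nu> d] obtain f :: "nat \<Rightarrow> real^'n \<Rightarrow> real" where
    f1: "\<forall>i\<le>k. f i \<in> test_functions (ball 0 1)" and
    f2: "\<forall>c. (\<exists>i\<le>k. c i \<noteq> 0) \<longrightarrow> 0 < unit_mass a (\<Sum>i\<le>k. c i *\<^sub>R f i) \<and>
          dirichlet_energy (\<Sum>i\<le>k. c i *\<^sub>R f i) \<le> (\<nu> + \<eta> * q) * unit_mass a (\<Sum>i\<le>k. c i *\<^sub>R f i)"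
    by (elim exE conjE)
  note f = f1[rule_format] f2[THEN spec, THEN mp]
  have nn: "\<nu> + \<eta> * q \<ge> 0" using unit_minmax_nonneg[OF \<nu>] d by linarith
  have "\<nu>' \<le> (\<nu> + \<eta> * q) * q' / q"
  proof (rule unit_minmax_upper[OF \<nu>' f(1)])
    fix c :: "nat \<Rightarrow> real" assume c: "\<exists>i\<le>k. c i \<noteq> 0"
    let ?v = "\<Sum>i\<le>k. c i *\<^sub>R f i"
    have v: "?v \<in> test_functions (ball 0 1)" by (rule test_lincomb) (use f(1) in auto)
    note fc = f(2)[OF c]
    have m: "unit_mass a ?v \<le> q' / q * unit_mass a' ?v"
      using unit_mass_mono[OF a v] q by (simp add: q_def[symmetric] q'_def[symmetric] field_simps)
    have "0 < q' / q * unit_mass a' ?v" using fc m by linarith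
    then have p: "0 < unit_mass a' ?v" using q by (simp add: zero_less_mult_iff zero_less_divide_iff)
    have "dirichlet_energy ?v \<le> (\<nu> + \<eta> * q) * (q' / q * unit_mass a' ?v)"
      using fc mult_left_mono[OF m nn] by linarith
    then show "0 < unit_mass a' ?v \<and> dirichlet_energy ?v \<le> (\<nu> + \<eta> * q) * q' / q * unit_mass a' ?v"
      using p by (simp add: mult.assoc)
  qed
  then have "\<nu>' / q' \<le> \<nu> / q + \<eta>" using q by (simp add: field_simps)
  then show "\<nu>' / (1 + a')\<^sup>2 \<le> \<nu> / (1 + a)\<^sup>2 + \<eta>" by (simp add: q_def q'_def)
qed

text \<open>One family for three geometries: \<open>b = 2\<close> with \<kappa> = 1 or -1 for the
  sphere and hyperbolic space, \<open>b = 1\<close> with \<kappa> = 0 and R = 1 for the Euclidean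
  ball. The assumption \<open>\<kappa>R\<close> keeps the conformal factor bounded up to the
  boundary of the ball.\<close>

locale model =
  fixes G :: "real^'n::finite \<Rightarrow> real^'n^'n" and b \<kappa> R :: real
  assumes dim2: "CARD('n) \<ge> 2" and b: "b > 0" and R_pos: "R > 0" and \<kappa>R: "1 + \<kappa> * R\<^sup>2 > 0"
    and G_eq: "x \<in> ball 0 R \<Longrightarrow> G x = mat ((b / (1 + \<kappa> * (x \<bullet> x)))\<^sup>2)"
begin

sublocale conformal G R "b / max 1 (1 + \<kappa> * R\<^sup>2)" "b / min 1 (1 + \<kappa> * R\<^sup>2)" "\<lambda>x. b / (1 + \<kappa> * (x \<bullet> x))"
proof
  show "CARD('n) \<ge> 2" "R > 0" by (fact dim2 R_pos)+
  show "0 < b / max 1 (1 + \<kappa> * R\<^sup>2)" using b by simp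
  show "G x = mat ((b / (1 + \<kappa> * (x \<bullet> x)))\<^sup>2)" if "x \<in> ball 0 R" for x using that by (rule G_eq)
  have mp: "min 1 (1 + \<kappa> * R\<^sup>2) > 0" using \<kappa>R by simp
  have pos: "1 + \<kappa> * (x \<bullet> x) > 0" if "x \<in> ball 0 R" for x :: "real^'n"
    using one_plus_bounds(1)[OF R_pos that, of \<kappa>] mp by linarith
  show "b / max 1 (1 + \<kappa> * R\<^sup>2) \<le> b / (1 + \<kappa> * (x \<bullet> x)) \<and> b / (1 + \<kappa> * (x \<bullet> x)) \<le> b / min 1 (1 + \<kappa> * R\<^sup>2)"
    if "x \<in> ball 0 R" for x :: "real^'n"
    using one_plus_bounds[OF R_pos that, of \<kappa>] pos[OF that] mp b
    by (intro conjI divide_left_mono mult_pos_pos) auto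
  show "cont_diff_on m (ball (0 :: real^'n) R) (\<lambda>x. b / (1 + \<kappa> * (x \<bullet> x)))" for m
  proof (subst cont_diff_on_cong[OF open_ball])
    show "cont_diff_on m (ball (0 :: real^'n) R) (\<lambda>x. b * (1 + \<kappa> * (x \<bullet> x)) powr (-1))"
      by (intro cont_diff_on_mult cont_diff_on_one_plus_powr R_pos \<kappa>R) auto
    show "b / (1 + \<kappa> * (x \<bullet> x)) = b * (1 + \<kappa> * (x \<bullet> x)) powr (-1)" if "x \<in> ball 0 R" for x :: "real^'n"
      using pos[OF that] by (simp add: powr_minus_divide)
  qed
qed

abbreviation "a \<equiv> \<kappa> * R\<^sup>2"

definition to_unit :: "(real^'n \<Rightarrow> real) \<Rightarrow> real^'n \<Rightarrow> real" where
  "to_unit \<phi> y = \<phi> (R *\<^sub>R y) * (1 + a * (y \<bullet> y)) powr (- (real CARD('n) - 2) / 2)"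

text \<open>Inverse of \<open>to_unit\<close> on test functions: min-max compares trial spaces in
  both directions, so they have to be carried to the unit ball and back.\<close>

definition from_unit :: "(real^'n \<Rightarrow> real) \<Rightarrow> real^'n \<Rightarrow> real" where
  "from_unit v x = v ((1 / R) *\<^sub>R x) * (1 + \<kappa> * (x \<bullet> x)) powr ((real CARD('n) - 2) / 2)"

lemma to_unit_sum: "to_unit (\<Sum>i\<in>I. c i *\<^sub>R f i) = (\<Sum>i\<in>I. c i *\<^sub>R to_unit (f i))"
  by (rule ext) (simp add: to_unit_def sum_fun_apply sum_distrib_right mult.assoc)

lemma from_unit_sum: "from_unit (\<Sum>i\<in>I. c i *\<^sub>R f i) = (\<Sum>i\<in>I. c i *\<^sub>R from_unit (f i))"
  by (rule ext) (simp add: from_unit_def sum_fun_apply sum_distrib_right mult.assoc)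

lemma power_dim_split: "x ^ CARD('n) = x ^ (CARD('n) - 2) * (x :: real)\<^sup>2"
proof -
  have "CARD('n) = (CARD('n) - 2) + 2" using dim2 by simp
  then show ?thesis by (metis power_add)
qed

lemma scaled_test: "\<phi> \<in> \<D> \<Longrightarrow> (\<lambda>y. \<phi> (R *\<^sub>R y)) \<in> test_functions (ball 0 1)"
  using test_functions_scaled[of \<phi> R R] R_pos by simp

lemma to_unit_test: "\<phi> \<in> \<D> \<Longrightarrow> to_unit \<phi> \<in> test_functions (ball 0 1)"
  unfolding to_unit_def[abs_def]
  by (rule conformal_energy_identity(3)[OF \<kappa>R dim2 scaled_test])

lemma from_unit_test:
  assumes "v \<in> test_functions (ball 0 1)"
  shows "from_unit v \<in> \<D>"
  unfolding from_unit_def[abs_def]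
proof (rule test_functions_mult[OF _ open_ball cont_diff_on_one_plus_powr[OF R_pos \<kappa>R]])
  show "(\<lambda>x. v ((1 / R) *\<^sub>R x)) \<in> \<D>"
    using test_functions_scaled[OF assms, of "1 / R"] R_pos by simp
qed

lemma to_unit_from_unit:
  assumes "v \<in> test_functions (ball 0 1)"
  shows "to_unit (from_unit v) = v"
proof
  fix y
  show "to_unit (from_unit v) y = v y"
  proof (cases "y \<in> ball 0 1")
    case True
    have s: "1 + a * (y \<bullet> y) > 0" by (rule one_plus_pos[OF \<kappa>R True])
    have e: "\<kappa> * ((R *\<^sub>R y) \<bullet> (R *\<^sub>R y)) = a * (y \<bullet> y)" by (simp add: power2_eq_square)
    have "(1 + a * (y \<bullet> y)) powr ((real CARD('n) - 2) / 2) * (1 + a * (y \<bullet> y)) powr (- (real CARD('n) - 2) / 2) = 1"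
    proof -
      have "(real CARD('n) - 2) / 2 + - (real CARD('n) - 2) / 2 = 0" by (simp add: field_simps)
      then show ?thesis unfolding powr_add[symmetric] using s by simp
    qed
    then show ?thesis
      unfolding to_unit_def from_unit_def e using R_pos by (simp add: mult.assoc)
  next
    case False
    then show ?thesis
      using test_functions_eq_0[OF assms False] test_functions_eq_0[OF to_unit_test[OF from_unit_test[OF assms]] False]
      by simp
  qed
qed

lemma l2_form_to_unit:
  assumes \<phi>: "\<phi> \<in> \<D>"
  shows "l2_form \<V> \<phi> \<phi> = (b * R) ^ CARD('n) * unit_mass a (to_unit \<phi>)"
proof -
  let ?w = "\<lambda>x :: real^'n. b / (1 + \<kappa> * (x \<bullet> x))"
  have meas: "(\<lambda>x. vol_weight x * (\<phi> x)\<^sup>2) \<in> borel_measurable borel"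
    using borel_measurable_test[OF \<phi>] vol_weight_measurable by measurable
  have "l2_form \<V> \<phi> \<phi> = R ^ CARD('n) * (LINT y|lborel. vol_weight (R *\<^sub>R y) * (\<phi> (R *\<^sub>R y))\<^sup>2)"
    unfolding l2_form_test[OF \<phi>] by (rule integral_scaled[OF R_pos meas])
  also have "(LINT y|lborel. vol_weight (R *\<^sub>R y) * (\<phi> (R *\<^sub>R y))\<^sup>2)
      = (LINT y|lborel. b ^ CARD('n) * ((1 / (1 + a * (y \<bullet> y))) ^ CARD('n) * (\<phi> (R *\<^sub>R y))\<^sup>2))"
  proof (rule Bochner_Integration.integral_cong[OF refl])
    fix y :: "real^'n"
    have e: "\<kappa> * ((R *\<^sub>R y) \<bullet> (R *\<^sub>R y)) = a * (y \<bullet> y)" by (simp add: power2_eq_square)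
    show "vol_weight (R *\<^sub>R y) * (\<phi> (R *\<^sub>R y))\<^sup>2 = b ^ CARD('n) * ((1 / (1 + a * (y \<bullet> y))) ^ CARD('n) * (\<phi> (R *\<^sub>R y))\<^sup>2)"
    proof (cases "R *\<^sub>R y \<in> \<Omega>")
      case True
      then show ?thesis unfolding vol_weight_def e by (simp add: power_divide)
    next
      case False
      then show ?thesis using test_functions_eq_0[OF \<phi>] by simp
    qed
  qed
  also have "\<dots> = b ^ CARD('n) * unit_mass a (to_unit \<phi>)"
    unfolding to_unit_def[abs_def] conformal_energy_identity(2)[OF \<kappa>R dim2 scaled_test[OF \<phi>]] by simp
  finally show ?thesis by (simp add: power_mult_distrib)
qed

lemma energy_to_unit:
  assumes \<phi>: "\<phi> \<in> \<D>"
  shows "energy \<phi> \<phi> = (b * R) ^ (CARD('n) - 2) *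
    (dirichlet_energy (to_unit \<phi>) - real CARD('n) * (real CARD('n) - 2) * a * unit_mass a (to_unit \<phi>))"
proof -
  let ?\<psi> = "\<lambda>y. \<phi> (R *\<^sub>R y)"
  have grad: "coord_grad ?\<psi> y = R *\<^sub>R coord_grad \<phi> (R *\<^sub>R y)" for y
    using test_functions_differentiable[OF \<phi>] by (simp add: coord_grad_def vec_eq_iff partial_deriv_scaled)
  have meas: "(\<lambda>x. (b / (1 + \<kappa> * (x \<bullet> x))) ^ (CARD('n) - 2) * (coord_grad \<phi> x \<bullet> coord_grad \<phi> x)) \<in> borel_measurable borel"
    using borel_measurable_integrable[OF integrable_energy[OF \<phi> \<phi>]] by (simp only: measurable_lborel2)
  have "energy \<phi> \<phi> = R ^ CARD('n) * (LINT y|lborel. (b / (1 + \<kappa> * ((R *\<^sub>R y) \<bullet> (R *\<^sub>R y)))) ^ (CARD('n) - 2) * (coord_grad \<phi> (R *\<^sub>R y) \<bullet> coord_grad \<phi> (R *\<^sub>R y)))"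
    unfolding energy_def by (rule integral_scaled[OF R_pos meas])
  also have "\<dots> = R ^ CARD('n) * (LINT y|lborel. b ^ (CARD('n) - 2) / R\<^sup>2 * ((1 / (1 + a * (y \<bullet> y))) ^ (CARD('n) - 2) * (coord_grad ?\<psi> y \<bullet> coord_grad ?\<psi> y)))"
  proof -
    have e: "\<kappa> * ((R *\<^sub>R y) \<bullet> (R *\<^sub>R y)) = a * (y \<bullet> y)" for y :: "real^'n" by (simp add: power2_eq_square)
    show ?thesis unfolding e grad using R_pos by (simp add: power_divide power2_eq_square)
  qed
  also have "\<dots> = R ^ CARD('n) * (b ^ (CARD('n) - 2) / R\<^sup>2 * (LINT y|lborel. (1 / (1 + a * (y \<bullet> y))) ^ (CARD('n) - 2) * (coord_grad ?\<psi> y \<bullet> coord_grad ?\<psi> y)))"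
    by (simp only: integral_mult_right_zero)
  also have "(LINT y|lborel. (1 / (1 + a * (y \<bullet> y))) ^ (CARD('n) - 2) * (coord_grad ?\<psi> y \<bullet> coord_grad ?\<psi> y))
      = dirichlet_energy (to_unit \<phi>) - real CARD('n) * (real CARD('n) - 2) * a * unit_mass a (to_unit \<phi>)"
    unfolding to_unit_def[abs_def] using conformal_energy_identity(1)[OF \<kappa>R dim2 scaled_test[OF \<phi>]] by linarith
  also have "R ^ CARD('n) * (b ^ (CARD('n) - 2) / R\<^sup>2 * X) = (b * R) ^ (CARD('n) - 2) * X" for X
    unfolding power_dim_split[of R] using R_pos by (simp add: power_mult_distrib)
  finally show ?thesis .
qed

text \<open>Because the conformal change adds a multiple of the mass to the energy, Rayleigh bounds
  correspond by an affine map of \<Lambda>.\<close>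

lemma energy_le_iff:
  assumes \<phi>: "\<phi> \<in> \<D>"
  shows "energy \<phi> \<phi> \<le> \<Lambda> * l2_form \<V> \<phi> \<phi> \<longleftrightarrow>
     dirichlet_energy (to_unit \<phi>) \<le> (\<Lambda> * (b * R)\<^sup>2 + real CARD('n) * (real CARD('n) - 2) * a) * unit_mass a (to_unit \<phi>)"
proof -
  have pos: "(b * R) ^ (CARD('n) - 2) > 0" using b R_pos by simp
  have e1: "\<Lambda> * l2_form \<V> \<phi> \<phi> = (b * R) ^ (CARD('n) - 2) * (\<Lambda> * (b * R)\<^sup>2 * unit_mass a (to_unit \<phi>))"
    unfolding l2_form_to_unit[OF \<phi>] power_dim_split by simp
  have "energy \<phi> \<phi> \<le> \<Lambda> * l2_form \<V> \<phi> \<phi> \<longleftrightarrow>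
      dirichlet_energy (to_unit \<phi>) - real CARD('n) * (real CARD('n) - 2) * a * unit_mass a (to_unit \<phi>) \<le> \<Lambda> * (b * R)\<^sup>2 * unit_mass a (to_unit \<phi>)"
    unfolding energy_to_unit[OF \<phi>] e1 by (rule mult_le_cancel_left_pos[OF pos])
  then show ?thesis by (simp only: distrib_right diff_le_eq)
qed

lemma l2_form_pos_iff: "\<phi> \<in> \<D> \<Longrightarrow> 0 < l2_form \<V> \<phi> \<phi> \<longleftrightarrow> 0 < unit_mass a (to_unit \<phi>)"
proof -
  assume \<phi>: "\<phi> \<in> \<D>"
  have pos: "0 < (b * R) ^ CARD('n)" using b R_pos by simp
  show ?thesis
    unfolding l2_form_to_unit[OF \<phi>] using mult_less_cancel_left_pos[OF pos, of 0] by (simp only: mult_zero_right)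
qed

text \<open>Trial spaces on the unit ball go back through \<open>from_unit\<close> for the first
  half of min-max; near-optimal ones on \<open>\<Omega>\<close> go forward through
  \<open>to_unit\<close> for the second.\<close>

lemma unit_minmax_form_eigval: "unit_minmax TYPE('n) a k (form_eigval k * (b * R)\<^sup>2 + real CARD('n) * (real CARD('n) - 2) * a)"
  unfolding unit_minmax_def
proof (intro conjI allI impI)
  have bR2: "(b * R)\<^sup>2 > 0" using b R_pos by simp
  fix f :: "nat \<Rightarrow> real^'n \<Rightarrow> real" and N
  assume H: "(\<forall>i\<le>k. f i \<in> test_functions (ball 0 1)) \<and>
       (\<forall>c. (\<exists>i\<le>k. c i \<noteq> 0) \<longrightarrow> 0 < unit_mass a (\<Sum>i\<le>k. c i *\<^sub>R f i) \<and>
          dirichlet_energy (\<Sum>i\<le>k. c i *\<^sub>R f i) \<le> N * unit_mass a (\<Sum>i\<le>k. c i *\<^sub>R f i))"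
  define \<Lambda> where "\<Lambda> = (N - real CARD('n) * (real CARD('n) - 2) * a) / (b * R)\<^sup>2"
  have \<Lambda>: "\<Lambda> * (b * R)\<^sup>2 + real CARD('n) * (real CARD('n) - 2) * a = N" using bR2 by (simp add: \<Lambda>_def)
  have T: "from_unit (f i) \<in> \<D>" if "i \<le> k" for i using H that by (intro from_unit_test) auto
  have TS: "(\<Sum>i\<le>k. c i *\<^sub>R from_unit (f i)) \<in> \<D>" for c by (rule test_lincomb) (use T in auto)
  have inv_eq: "to_unit (\<Sum>i\<le>k. c i *\<^sub>R from_unit (f i)) = (\<Sum>i\<le>k. c i *\<^sub>R f i)" for c
    unfolding from_unit_sum[symmetric] by (rule to_unit_from_unit[OF test_lincomb]) (use H in auto)
  have "form_eigval k \<le> \<Lambda>"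
  proof (rule form_eigval_le[of k "\<lambda>i. from_unit (f i)", OF T])
    fix c :: "nat \<Rightarrow> real"
    let ?\<phi> = "\<Sum>i\<le>k. c i *\<^sub>R from_unit (f i)"
    show "0 < l2_form \<V> ?\<phi> ?\<phi>" if "\<exists>i\<le>k. c i \<noteq> 0"
      unfolding l2_form_pos_iff[OF TS] inv_eq using H that by blast
    show "energy ?\<phi> ?\<phi> \<le> \<Lambda> * l2_form \<V> ?\<phi> ?\<phi>"
    proof (cases "\<exists>i\<le>k. c i \<noteq> 0")
      case True
      then show ?thesis unfolding energy_le_iff[OF TS] inv_eq \<Lambda> using H by blast
    next
      \<comment> \<open>\<open>form_eigval_le\<close> asks for the energy bound at the zero
        combination too, which \<open>unit_minmax\<close> leaves out.\<close>
      case False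
      then have "?\<phi> = 0" by (intro sum.neutral) auto
      then show ?thesis by (simp only: e.zero(1)[OF e.closed(1)] m.zero(1)[OF m.closed(1)])
    qed
  qed
  then have "form_eigval k * (b * R)\<^sup>2 \<le> \<Lambda> * (b * R)\<^sup>2" using bR2 by (intro mult_right_mono) auto
  then show "form_eigval k * (b * R)\<^sup>2 + real CARD('n) * (real CARD('n) - 2) * a \<le> N" using \<Lambda> by linarith
next
  fix \<delta> :: real assume d: "\<delta> > 0"
  have bR2: "(b * R)\<^sup>2 > 0" using b R_pos by simp
  then have "\<delta> / (b * R)\<^sup>2 > 0" using d by simp
  from form_eigval_approx[OF this, of k] obtain f where f1: "\<forall>i\<le>k. f i \<in> \<D>"
    and f2: "\<forall>c. (\<exists>i\<le>k. c i \<noteq> 0) \<longrightarrow> 0 < l2_form \<V> (\<Sum>i\<le>k. c i *\<^sub>R f i) (\<Sum>i\<le>k. c i *\<^sub>R f i)"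
    and f3: "\<forall>c. energy (\<Sum>i\<le>k. c i *\<^sub>R f i) (\<Sum>i\<le>k. c i *\<^sub>R f i) \<le>
       (form_eigval k + \<delta> / (b * R)\<^sup>2) * l2_form \<V> (\<Sum>i\<le>k. c i *\<^sub>R f i) (\<Sum>i\<le>k. c i *\<^sub>R f i)"
    by (elim exE conjE)
  note f = f1[rule_format] f2[THEN spec, THEN mp] f3[THEN spec]
  have TS: "(\<Sum>i\<le>k. c i *\<^sub>R f i) \<in> \<D>" for c by (rule test_lincomb) (use f(1) in auto)
  have eq: "(form_eigval k + \<delta> / (b * R)\<^sup>2) * (b * R)\<^sup>2 + real CARD('n) * (real CARD('n) - 2) * a = form_eigval k * (b * R)\<^sup>2 + real CARD('n) * (real CARD('n) - 2) * a + \<delta>"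
    using bR2 by (simp add: distrib_right)
  show "\<exists>f :: nat \<Rightarrow> real^'n \<Rightarrow> real. (\<forall>i\<le>k. f i \<in> test_functions (ball 0 1)) \<and>
       (\<forall>c. (\<exists>i\<le>k. c i \<noteq> 0) \<longrightarrow> 0 < unit_mass a (\<Sum>i\<le>k. c i *\<^sub>R f i) \<and>
          dirichlet_energy (\<Sum>i\<le>k. c i *\<^sub>R f i) \<le> (form_eigval k * (b * R)\<^sup>2 + real CARD('n) * (real CARD('n) - 2) * a + \<delta>) * unit_mass a (\<Sum>i\<le>k. c i *\<^sub>R f i))"
  proof (intro exI[of _ "\<lambda>i. to_unit (f i)"] conjI allI impI)
    show "to_unit (f i) \<in> test_functions (ball 0 1)" if "i \<le> k" for i by (rule to_unit_test[OF f(1)[OF that]])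
    fix c :: "nat \<Rightarrow> real" assume c: "\<exists>i\<le>k. c i \<noteq> 0"
    show "0 < unit_mass a (\<Sum>i\<le>k. c i *\<^sub>R to_unit (f i))"
      unfolding to_unit_sum[symmetric] l2_form_pos_iff[OF TS, symmetric] by (rule f(2)[OF c])
    show "dirichlet_energy (\<Sum>i\<le>k. c i *\<^sub>R to_unit (f i)) \<le>
        (form_eigval k * (b * R)\<^sup>2 + real CARD('n) * (real CARD('n) - 2) * a + \<delta>) * unit_mass a (\<Sum>i\<le>k. c i *\<^sub>R to_unit (f i))"
      unfolding to_unit_sum[symmetric] eq[symmetric] energy_le_iff[OF TS, symmetric] by (rule f(3))
  qed
qed

end

text \<open>Test functions of the smaller ball serve on the larger one. \<open>energy\<close> does
  not involve the radius, so only the masses have to be compared.\<close>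

lemma model_eigval_antimono:
  fixes G :: "real^'n::finite \<Rightarrow> real^'n^'n"
  assumes "model G b \<kappa> R" "model G b \<kappa> R'" "R \<le> R'"
  shows "dirichlet_eigenvalue G (ball 0 R') k \<le> dirichlet_eigenvalue G (ball 0 R) k"
proof -
  interpret A: model G b \<kappa> R by fact
  interpret B: model G b \<kappa> R' by fact
  have sub: "A.\<D> \<subseteq> B.\<D>" using assms(3) by (intro test_functions_mono subset_ball)
  have l2: "l2_form A.\<V> \<phi> \<phi> = l2_form B.\<V> \<phi> \<phi>" if \<phi>: "\<phi> \<in> A.\<D>" for \<phi>
  proof -
    have \<phi>': "\<phi> \<in> B.\<D>" using \<phi> sub by blast
    have "A.vol_weight x * (\<phi> x)\<^sup>2 = B.vol_weight x * (\<phi> x)\<^sup>2" for x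
      using test_functions_eq_0[OF \<phi>, of x] assms(3)
      by (cases "x \<in> ball 0 R") (auto simp: A.vol_weight_def B.vol_weight_def indicator_def)
    then show ?thesis unfolding A.l2_form_test[OF \<phi>] B.l2_form_test[OF \<phi>'] by (simp only:)
  qed
  have "B.form_eigval j \<le> A.form_eigval j" for j
  proof (rule field_le_epsilon)
    fix \<delta> :: real assume "\<delta> > 0"
    from A.form_eigval_approx[OF this, of j] obtain f where f1: "\<forall>i\<le>j. f i \<in> A.\<D>"
      and f2: "\<forall>c. (\<exists>i\<le>j. c i \<noteq> 0) \<longrightarrow> 0 < l2_form A.\<V> (\<Sum>i\<le>j. c i *\<^sub>R f i) (\<Sum>i\<le>j. c i *\<^sub>R f i)"
      and f3: "\<forall>c. A.energy (\<Sum>i\<le>j. c i *\<^sub>R f i) (\<Sum>i\<le>j. c i *\<^sub>R f i) \<le>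
         (A.form_eigval j + \<delta>) * l2_form A.\<V> (\<Sum>i\<le>j. c i *\<^sub>R f i) (\<Sum>i\<le>j. c i *\<^sub>R f i)"
      by (elim exE conjE)
    note f = f1[rule_format] f2[THEN spec, THEN mp] f3[THEN spec]
    have TS: "(\<Sum>i\<le>j. c i *\<^sub>R f i) \<in> A.\<D>" for c by (rule test_lincomb) (use f(1) in auto)
    show "B.form_eigval j \<le> A.form_eigval j + \<delta>"
    proof (rule B.form_eigval_le[of j f])
      show "f i \<in> B.\<D>" if "i \<le> j" for i using f(1)[OF that] sub by blast
      fix c :: "nat \<Rightarrow> real"
      let ?v = "\<Sum>i\<le>j. c i *\<^sub>R f i"
      show "0 < l2_form B.\<V> ?v ?v" if nz: "\<exists>i\<le>j. c i \<noteq> 0"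
        using f(2)[OF nz] unfolding l2[OF TS] .
      show "B.energy ?v ?v \<le> (A.form_eigval j + \<delta>) * l2_form B.\<V> ?v ?v"
        using f(3)[of c] unfolding l2[OF TS] .
    qed
  qed
  then show ?thesis by (simp only: A.dirichlet_eigenvalue_eq B.dirichlet_eigenvalue_eq)
qed

section \<open>Geodesic balls\<close>

lemma mem_ball_sqrt_iff: "x \<in> ball (0 :: real^'n::finite) (sqrt t) \<longleftrightarrow> x \<bullet> x < t"
  by (simp add: norm_eq_sqrt_inner)

text \<open>\<open>signed_radius\<close> is \<open>tan\<^sup>2 (\<Theta>/2)\<close>, respectively \<open>- tanh\<^sup>2 (\<Theta>/2)\<close>: the number \<open>a = \<kappa> R\<^sup>2\<close>.\<close>

definition gen_cos :: "real \<Rightarrow> real" where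
  "gen_cos \<Theta> = (if \<Theta> < 0 then cosh \<Theta> else cos \<Theta>)"

definition signed_radius :: "real \<Rightarrow> real" where
  "signed_radius \<Theta> = (1 - gen_cos \<Theta>) / (1 + gen_cos \<Theta>)"

text \<open>The two branches meet at the value 1: cosh exceeds it at negative arguments, cos never
  does.\<close>

lemma gen_cos_strict_antimono:
  assumes "\<Theta> < \<Theta>'" "\<Theta>' < pi"
  shows "gen_cos \<Theta>' < gen_cos \<Theta>"
proof -
  have hyp: "cosh t > 1" if "t < 0" for t :: real
    using cosh_real_nonneg_less_iff[of 0 "- t"] that by simp
  consider "\<Theta>' < 0" | "\<Theta> < 0" "\<Theta>' \<ge> 0" | "\<Theta> \<ge> 0" by linarith
  then show ?thesis
  proof cases
    case 1
    then show ?thesis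
      using assms cosh_real_nonneg_less_iff[of "- \<Theta>'" "- \<Theta>"] by (simp add: gen_cos_def)
  next
    case 2
    have "gen_cos \<Theta>' \<le> 1" using 2 by (simp add: gen_cos_def)
    moreover have "gen_cos \<Theta> > 1" using 2 hyp by (simp add: gen_cos_def)
    ultimately show ?thesis by linarith
  next
    case 3
    then show ?thesis using assms cos_mono_less_eq[of \<Theta>' \<Theta>] by (simp add: gen_cos_def)
  qed
qed

lemma gen_cos_gt:
  assumes "\<Theta> < pi"
  shows "gen_cos \<Theta> > -1"
proof -
  \<comment> \<open>The strict inequality at \<Theta> follows from the weak one at a point between
    \<Theta> and \<open>pi\<close>.\<close>
  define t where "t = (\<Theta> + pi) / 2"
  have "\<Theta> < t" "t < pi" using assms by (auto simp: t_def)
  then have "gen_cos t < gen_cos \<Theta>" by (rule gen_cos_strict_antimono)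
  moreover have "- 1 \<le> gen_cos t"
  proof (cases "t < 0")
    case True
    then show ?thesis using cosh_real_ge_1[of t] by (simp add: gen_cos_def)
  next
    case False
    then show ?thesis by (simp add: gen_cos_def)
  qed
  ultimately show ?thesis by linarith
qed

lemma one_plus_signed_radius: "\<Theta> < pi \<Longrightarrow> 1 + signed_radius \<Theta> = 2 / (1 + gen_cos \<Theta>)"
  using gen_cos_gt[of \<Theta>] by (simp add: signed_radius_def field_simps)

text \<open>The common value is sin^2 \<Theta> / 4, or - sinh^2 \<Theta> / 4 for negative \<Theta>:
  the shift in \<open>K\<close> becomes explicit in the angle.\<close>

lemma signed_radius_quotient:
  assumes "\<Theta> < pi"
  shows "signed_radius \<Theta> / (1 + signed_radius \<Theta>)\<^sup>2 = (1 - (gen_cos \<Theta>)\<^sup>2) / 4"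
proof -
  define C where "C = gen_cos \<Theta>"
  have "1 + C > 0" using gen_cos_gt[OF assms] by (simp add: C_def)
  then show ?thesis
    unfolding one_plus_signed_radius[OF assms] unfolding signed_radius_def C_def[symmetric]
    by (simp add: field_simps power2_eq_square)
qed

lemma signed_radius_mono:
  assumes "\<Theta> \<le> \<Theta>'" "\<Theta>' < pi"
  shows "-1 < signed_radius \<Theta>" "signed_radius \<Theta> \<le> signed_radius \<Theta>'"
proof -
  have pos: "1 + gen_cos \<Theta> > 0" "1 + gen_cos \<Theta>' > 0" using gen_cos_gt[of \<Theta>] gen_cos_gt[of \<Theta>'] assms by auto
  have "2 / (1 + gen_cos \<Theta>) > 0" using pos by simp
  then show "-1 < signed_radius \<Theta>" using one_plus_signed_radius[of \<Theta>] assms by linarith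
  have "gen_cos \<Theta>' \<le> gen_cos \<Theta>"
    using gen_cos_strict_antimono[of \<Theta> \<Theta>'] assms by (cases "\<Theta> = \<Theta>'") auto
  then have "2 / (1 + gen_cos \<Theta>) \<le> 2 / (1 + gen_cos \<Theta>')"
    using pos by (intro divide_left_mono mult_pos_pos) auto
  then show "signed_radius \<Theta> \<le> signed_radius \<Theta>'"
    using one_plus_signed_radius[of \<Theta>] one_plus_signed_radius[of \<Theta>'] assms by linarith
qed

text \<open>Minus the Minkowski product with the pole is cosh of the distance, and in the ball model
  it equals (1 + q) / (1 - q) with q = |x|^2; solving for q gives the radius.\<close>

lemma hyperbolic_ball_coordinates:
  assumes "\<Theta> < 0"
  shows "{x :: real^'n::finite. x \<in> ball 0 1 \<and> hyperbolic_param x \<in> geodesic_cap \<Theta>}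
    = ball 0 (sqrt (- signed_radius \<Theta>))"
proof (rule set_eqI)
  fix x :: "real^'n"
  define q where "q = x \<bullet> x"
  define C where "C = cosh \<Theta>"
  have C: "C > 1" using cosh_real_nonneg_less_iff[of 0 "- \<Theta>"] assms by (simp add: C_def)
  have t: "- signed_radius \<Theta> = (C - 1) / (C + 1)"
    using assms C by (simp add: signed_radius_def gen_cos_def C_def field_simps)
  have q0: "q \<ge> 0" by (simp add: q_def)
  have b: "x \<in> ball 0 1 \<longleftrightarrow> q < 1" by (simp add: q_def norm_eq_sqrt_inner)
  have "x \<in> {x. x \<in> ball 0 1 \<and> hyperbolic_param x \<in> geodesic_cap \<Theta>} \<longleftrightarrow> q < 1 \<and> q < (C - 1) / (C + 1)"
  proof (cases "q < 1")
    case True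
    then have "x \<in> ball 0 1" using b by blast
    then have H: "hyperbolic_param x \<in> hyperbolic_space"
      using bij_betwE[OF hyperbolic_param_bij] by blast
    have snd: "- minkowski (hyperbolic_param x) pole = (1 + q) / (1 - q)"
      by (simp add: minkowski_def pole_def hyperbolic_param_def q_def)
    have ge: "(1 + q) / (1 - q) \<ge> 1" using True q0 by (simp add: field_simps)
    have "arcosh ((1 + q) / (1 - q)) < \<bar>\<Theta>\<bar> \<longleftrightarrow> cosh (arcosh ((1 + q) / (1 - q))) < cosh \<bar>\<Theta>\<bar>"
      using ge by (intro cosh_real_nonneg_less_iff[symmetric]) auto
    also have "\<dots> \<longleftrightarrow> (1 + q) / (1 - q) < C"
      using ge by (simp add: C_def cosh_arcosh_real)
    also have "\<dots> \<longleftrightarrow> q < (C - 1) / (C + 1)"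
      using True C by (simp add: divide_less_eq less_divide_eq) (simp add: algebra_simps)
    finally show ?thesis
      using \<open>x \<in> ball 0 1\<close> True H assms by (simp add: geodesic_cap_def snd)
  next
    case False
    then show ?thesis using b by simp
  qed
  moreover have "(C - 1) / (C + 1) < 1" using C by simp
  ultimately show "x \<in> {x. x \<in> ball 0 1 \<and> hyperbolic_param x \<in> geodesic_cap \<Theta>} \<longleftrightarrow> x \<in> ball 0 (sqrt (- signed_radius \<Theta>))"
    unfolding mem_ball_sqrt_iff t q_def[symmetric] by linarith
qed

text \<open>As in the hyperbolic case, with cos of the distance, which in stereographic coordinates
  is (1 - q) / (1 + q) with q = |x|^2.\<close>

lemma spherical_cap_coordinates:
  assumes "0 < \<Theta>" "\<Theta> < pi"
  shows "{x :: real^'n::finite. sphere_param x \<in> geodesic_cap \<Theta>} = ball 0 (sqrt (signed_radius \<Theta>))"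
proof (rule set_eqI)
  fix x :: "real^'n"
  define q where "q = x \<bullet> x"
  define C where "C = cos \<Theta>"
  have C: "C > -1" using gen_cos_gt[of \<Theta>] assms by (simp add: C_def gen_cos_def)
  have t: "signed_radius \<Theta> = (1 - C) / (1 + C)"
    using assms by (simp add: signed_radius_def gen_cos_def C_def)
  have q0: "q \<ge> 0" by (simp add: q_def)
  have S: "sphere_param x \<in> sphere 0 1"
    using bij_betwE[OF sphere_param_bij] by blast
  have inn: "sphere_param x \<bullet> pole = (1 - q) / (1 + q)"
    by (simp add: pole_def sphere_param_def q_def inner_prod_def)
  have bd: "-1 \<le> (1 - q) / (1 + q)" "(1 - q) / (1 + q) \<le> 1" using q0 by (auto simp: field_simps)
  have "arccos ((1 - q) / (1 + q)) < \<Theta> \<longleftrightarrow> cos \<Theta> < cos (arccos ((1 - q) / (1 + q)))"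
    using assms bd by (intro cos_mono_less_eq[symmetric]) (auto intro: arccos_lbound arccos_ubound)
  also have "\<dots> \<longleftrightarrow> C < (1 - q) / (1 + q)"
    using bd by (simp add: C_def)
  also have "\<dots> \<longleftrightarrow> q < (1 - C) / (1 + C)"
    using q0 C by (simp add: divide_less_eq less_divide_eq) (simp add: algebra_simps)
  finally show "x \<in> {x. sphere_param x \<in> geodesic_cap \<Theta>} \<longleftrightarrow> x \<in> ball 0 (sqrt (signed_radius \<Theta>))"
    unfolding mem_ball_sqrt_iff t q_def[symmetric] using S assms by (simp add: geodesic_cap_def inn)
qed

section \<open>The three geometries as instances of the model\<close>

lemma hyperbolic_model:
  assumes "CARD('n::finite) \<ge> 2" "\<Theta> < 0"
  shows "model (pullback_metric minkowski hyperbolic_param :: real^'n \<Rightarrow> real^'n^'n) 2 (-1) (sqrt (- signed_radius \<Theta>))"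
proof
  have C: "gen_cos \<Theta> > 1"
    using cosh_real_nonneg_less_iff[of 0 "- \<Theta>"] assms by (simp add: gen_cos_def)
  then have neg: "- signed_radius \<Theta> > 0" by (simp add: signed_radius_def divide_less_0_iff)
  have gt: "-1 < signed_radius \<Theta>" by (rule signed_radius_mono(1)[OF order_refl]) (use assms pi_gt_zero in linarith)
  show "CARD('n) \<ge> 2" "(2 :: real) > 0" by (use assms in auto)
  show "sqrt (- signed_radius \<Theta>) > 0" "0 < 1 + - 1 * (sqrt (- signed_radius \<Theta>))\<^sup>2" using neg gt by auto
  fix x :: "real^'n" assume "x \<in> ball 0 (sqrt (- signed_radius \<Theta>))"
  then have "x \<bullet> x < 1" unfolding mem_ball_sqrt_iff using gt by linarith
  then have "x \<in> ball 0 1" by (simp add: norm_eq_sqrt_inner)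
  from hyperbolic_metric[OF this]
  show "pullback_metric minkowski hyperbolic_param x = mat ((2 / (1 + - 1 * (x \<bullet> x)))\<^sup>2)" by simp
qed

lemma spherical_model:
  assumes "CARD('n::finite) \<ge> 2" "0 < \<Theta>" "\<Theta> < pi"
  shows "model (pullback_metric inner sphere_param :: real^'n \<Rightarrow> real^'n^'n) 2 1 (sqrt (signed_radius \<Theta>))"
proof
  have C: "gen_cos \<Theta> < 1" using gen_cos_strict_antimono[of 0 \<Theta>] assms by (simp add: gen_cos_def)
  then have pos: "signed_radius \<Theta> > 0" using gen_cos_gt[of \<Theta>] assms by (simp add: signed_radius_def)
  show "CARD('n) \<ge> 2" "(2 :: real) > 0" by (use assms in auto)
  show "sqrt (signed_radius \<Theta>) > 0" "0 < 1 + 1 * (sqrt (signed_radius \<Theta>))\<^sup>2" using pos by auto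
  fix x :: "real^'n"
  show "pullback_metric inner sphere_param x = mat ((2 / (1 + 1 * (x \<bullet> x)))\<^sup>2)"
    using sphere_metric[of x] by simp
qed

lemma euclidean_model: "CARD('n::finite) \<ge> 2 \<Longrightarrow> model (\<lambda>x :: real^'n. mat 1) 1 0 1"
  by unfold_locales auto

text \<open>For nonzero \<Theta> the factor (b R)^2 is 4 |a|, which is (1 + a)^2 times sin^2
  \<Theta> or sinh^2 \<Theta>; this is how the scaling in the statement arises. The index
  \<open>k - 1\<close> passes from numbering that starts at 1 to numbering that starts at 0.\<close>

lemma unit_minmax_scaled_eigenvalue:
  assumes n: "CARD('n::finite) \<ge> 2" and \<Theta>: "\<Theta> < pi"
  shows "unit_minmax TYPE('n) (signed_radius \<Theta>) (k - 1)
    ((1 + signed_radius \<Theta>)\<^sup>2 * scaled_eigenvalue TYPE('n) k \<Theta> +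
      real CARD('n) * (real CARD('n) - 2) * signed_radius \<Theta>)"
proof -
  define C where "C = gen_cos \<Theta>"
  have C: "1 + C > 0" using gen_cos_gt[OF \<Theta>] by (simp add: C_def)
  have sr: "signed_radius \<Theta> = (1 - C) / (1 + C)" by (simp add: C_def signed_radius_def)
  have eq: "4 * signed_radius \<Theta> = (1 + signed_radius \<Theta>)\<^sup>2 * (1 - C\<^sup>2)"
  proof -
    define Q where "Q = (1 + signed_radius \<Theta>)\<^sup>2"
    have "Q > 0" using one_plus_signed_radius[OF \<Theta>] C by (simp add: Q_def C_def)
    then show ?thesis
      using signed_radius_quotient[OF \<Theta>] by (simp add: Q_def[symmetric] C_def[symmetric] field_simps)
  qed
  consider "\<Theta> < 0" | "\<Theta> = 0" | "0 < \<Theta>" by linarith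
  then show ?thesis
  proof cases
    case 1
    interpret M: model "pullback_metric minkowski hyperbolic_param :: real^'n \<Rightarrow> real^'n^'n" 2 "-1" "sqrt (- signed_radius \<Theta>)"
      by (rule hyperbolic_model[OF n 1])
    have "C > 1" using cosh_real_nonneg_less_iff[of 0 "- \<Theta>"] 1 by (simp add: C_def gen_cos_def)
    then have R2: "(sqrt (- signed_radius \<Theta>))\<^sup>2 = - signed_radius \<Theta>" by (simp add: sr divide_le_0_iff)
    have ev: "cap_eigenvalue TYPE('n) k \<Theta> = M.form_eigval (k - 1)"
      using 1 unfolding cap_eigenvalue_def hyperbolic_ball_coordinates[OF 1] M.dirichlet_eigenvalue_eq by simp
    have "1 - C\<^sup>2 = - (sinh \<Theta>)\<^sup>2" using 1 by (simp add: C_def gen_cos_def cosh_square_eq)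
    then have "4 * (- signed_radius \<Theta>) = (1 + signed_radius \<Theta>)\<^sup>2 * (sinh \<Theta>)\<^sup>2" using eq by simp
    then have "M.form_eigval (k - 1) * (2 * sqrt (- signed_radius \<Theta>))\<^sup>2
        = (1 + signed_radius \<Theta>)\<^sup>2 * scaled_eigenvalue TYPE('n) k \<Theta>"
      using 1 unfolding power_mult_distrib R2 by (simp add: scaled_eigenvalue_def ev)
    then show ?thesis using M.unit_minmax_form_eigval[of "k - 1"] by (simp add: R2)
  next
    case 2
    interpret M: model "\<lambda>x :: real^'n. mat 1" 1 0 1
      by (rule euclidean_model[OF n])
    have "signed_radius \<Theta> = 0" using 2 by (simp add: signed_radius_def gen_cos_def)
    then show ?thesis
      using M.unit_minmax_form_eigval[of "k - 1"] 2
      by (simp add: scaled_eigenvalue_def ball_eigenvalue_def M.dirichlet_eigenvalue_eq)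
  next
    case 3
    interpret M: model "pullback_metric inner sphere_param :: real^'n \<Rightarrow> real^'n^'n" 2 1 "sqrt (signed_radius \<Theta>)"
      by (rule spherical_model[OF n 3 \<Theta>])
    have R2: "(sqrt (signed_radius \<Theta>))\<^sup>2 = signed_radius \<Theta>" using M.R_pos by simp
    have ev: "cap_eigenvalue TYPE('n) k \<Theta> = M.form_eigval (k - 1)"
      using 3 unfolding cap_eigenvalue_def spherical_cap_coordinates[OF 3 \<Theta>] M.dirichlet_eigenvalue_eq by simp
    have "1 - C\<^sup>2 = (sin \<Theta>)\<^sup>2" using 3 by (simp add: C_def gen_cos_def sin_squared_eq)
    then have "M.form_eigval (k - 1) * (2 * sqrt (signed_radius \<Theta>))\<^sup>2
        = (1 + signed_radius \<Theta>)\<^sup>2 * scaled_eigenvalue TYPE('n) k \<Theta>"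
      using 3 eq unfolding power_mult_distrib R2 by (simp add: scaled_eigenvalue_def ev)
    then show ?thesis using M.unit_minmax_form_eigval[of "k - 1"] by (simp add: R2)
  qed
qed

lemma cap_eigenvalue_pos:
  assumes "CARD('n::finite) \<ge> 2" "0 < \<Theta>" "\<Theta> < pi"
  shows "cap_eigenvalue TYPE('n) k \<Theta> > 0"
proof -
  interpret M: model "pullback_metric inner sphere_param :: real^'n \<Rightarrow> real^'n^'n" 2 1 "sqrt (signed_radius \<Theta>)"
    by (rule spherical_model[OF assms])
  have "cap_eigenvalue TYPE('n) k \<Theta> = M.form_eigval (k - 1)"
    using assms(2) unfolding cap_eigenvalue_def spherical_cap_coordinates[OF assms(2,3)] M.dirichlet_eigenvalue_eq by simp
  then show ?thesis using less_le_trans[OF M.low_pos M.form_eigval_low[of "k - 1"]] by simp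
qed

lemma cap_eigenvalue_antimono:
  assumes n: "CARD('n::finite) \<ge> 2" and \<Theta>: "0 < \<Theta>" "\<Theta> \<le> \<Theta>'" "\<Theta>' < pi"
  shows "cap_eigenvalue TYPE('n) k \<Theta>' \<le> cap_eigenvalue TYPE('n) k \<Theta>"
proof -
  have \<Theta>': "0 < \<Theta>'" "\<Theta> < pi" using \<Theta> by auto
  have "sqrt (signed_radius \<Theta>) \<le> sqrt (signed_radius \<Theta>')"
    using signed_radius_mono(2)[OF \<Theta>(2,3)] by simp
  from model_eigval_antimono[OF spherical_model[OF n \<Theta>(1) \<Theta>'(2)] spherical_model[OF n \<Theta>'(1) \<Theta>(3)] this, of k]
  show ?thesis
    using \<Theta>(1) \<Theta>'(1) unfolding cap_eigenvalue_def spherical_cap_coordinates[OF \<Theta>(1) \<Theta>'(2)]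
      spherical_cap_coordinates[OF \<Theta>'(1) \<Theta>(3)] by simp
qed

section \<open>Strict decrease and the two limits\<close>

theorem theorem1p3:
  fixes k :: nat
  assumes "CARD('n::finite) \<ge> 3" and "k \<ge> 1"
  shows "strict_antimono_on {..<pi} (scaled_eigenvalue TYPE('n) k) \<and>
         filterlim (scaled_eigenvalue TYPE('n) k) at_top at_bot \<and>
         (scaled_eigenvalue TYPE('n) k \<longlongrightarrow> 0) (at_left pi)"
proof -
  let ?\<mu> = "scaled_eigenvalue TYPE('n) k"
  have n: "CARD('n) \<ge> 2" using assms(1) by simp
  define N where "N = real CARD('n) * (real CARD('n) - 2)"
  have N: "N > 0" using assms(1) by (simp add: N_def)
  note mm = unit_minmax_scaled_eigenvalue[OF n, of _ k, folded N_def]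
  have pos: "1 + signed_radius \<Theta> > 0" if "\<Theta> < pi" for \<Theta>
    using signed_radius_mono(1)[OF order_refl that] by linarith
  \<comment> \<open>This is \<open>K\<close> as a function of \<Theta>.\<close>
  have quot: "((1 + signed_radius \<Theta>)\<^sup>2 * ?\<mu> \<Theta> + N * signed_radius \<Theta>) / (1 + signed_radius \<Theta>)\<^sup>2
      = ?\<mu> \<Theta> + N * ((1 - (gen_cos \<Theta>)\<^sup>2) / 4)" if "\<Theta> < pi" for \<Theta>
    unfolding signed_radius_quotient[OF that, symmetric] using pos[OF that] by (simp add: add_divide_distrib)
  have left: "?\<mu> \<Theta>' < ?\<mu> \<Theta>" if "\<Theta> < \<Theta>'" "\<Theta>' \<le> pi / 2" for \<Theta> \<Theta>'
  proof -
    have lt: "\<Theta> < pi" "\<Theta>' < pi" "\<Theta> \<le> \<Theta>'" using that pi_gt_zero by linarith+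
    have "?\<mu> \<Theta>' + N * ((1 - (gen_cos \<Theta>')\<^sup>2) / 4) \<le> ?\<mu> \<Theta> + N * ((1 - (gen_cos \<Theta>)\<^sup>2) / 4)"
      using unit_minmax_mono[OF signed_radius_mono[OF lt(3,2)] mm[OF lt(1)] mm[OF lt(2)]]
      unfolding quot[OF lt(1)] quot[OF lt(2)] .
    \<comment> \<open>The bound \<open>pi / 2\<close> enters here: \<open>gen_cos\<close> is still
      nonnegative at \<Theta>', so its square decreases together with it.\<close>
    moreover have "gen_cos \<Theta>' \<ge> 0"
      using that cos_ge_zero[of \<Theta>'] cosh_real_pos[of \<Theta>'] by (auto simp: gen_cos_def)
    then have "(gen_cos \<Theta>')\<^sup>2 < (gen_cos \<Theta>)\<^sup>2"
      using gen_cos_strict_antimono[OF that(1) lt(2)] by (intro power_strict_mono) auto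
    then have "N * ((1 - (gen_cos \<Theta>)\<^sup>2) / 4) < N * ((1 - (gen_cos \<Theta>')\<^sup>2) / 4)"
      using N by (intro mult_strict_left_mono) auto
    ultimately show ?thesis by linarith
  qed
  have right: "?\<mu> \<Theta>' < ?\<mu> \<Theta>" if "pi / 2 \<le> \<Theta>" "\<Theta> < \<Theta>'" "\<Theta>' < pi" for \<Theta> \<Theta>'
  proof -
    have p: "0 < \<Theta>" "0 < \<Theta>'" "\<Theta> < pi" "\<Theta> \<le> \<Theta>'" using that pi_gt_zero by linarith+
    \<comment> \<open>The sine is the cosine shifted by \<open>pi / 2\<close>, hence decreasing on
      this interval.\<close>
    have "sin \<Theta>' < sin \<Theta>"
      using cos_mono_less_eq[of "\<Theta>' - pi / 2" "\<Theta> - pi / 2"] that p by (simp add: cos_diff)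
    then have s: "(sin \<Theta>')\<^sup>2 < (sin \<Theta>)\<^sup>2"
      using sin_gt_zero[OF p(2) that(3)] by (intro power_strict_mono) auto
    have "cap_eigenvalue TYPE('n) k \<Theta>' * (sin \<Theta>')\<^sup>2 < cap_eigenvalue TYPE('n) k \<Theta>' * (sin \<Theta>)\<^sup>2"
      by (rule mult_strict_left_mono[OF s cap_eigenvalue_pos[OF n p(2) that(3)]])
    also have "\<dots> \<le> cap_eigenvalue TYPE('n) k \<Theta> * (sin \<Theta>)\<^sup>2"
      by (intro mult_right_mono cap_eigenvalue_antimono[OF n p(1,4) that(3)]) simp
    finally show ?thesis using p by (simp add: scaled_eigenvalue_def)
  qed
  have "?\<mu> \<Theta>' < ?\<mu> \<Theta>" if "\<Theta> < \<Theta>'" "\<Theta>' < pi" for \<Theta> \<Theta>'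
  proof -
    consider "\<Theta>' \<le> pi / 2" | "pi / 2 \<le> \<Theta>" | "\<Theta> < pi / 2" "pi / 2 < \<Theta>'" by linarith
    then show ?thesis
    proof cases
      \<comment> \<open>The two regimes share the point \<open>pi / 2\<close>, through which the
        comparison passes.\<close>
      case 3
      then show ?thesis using left[of \<Theta> "pi / 2"] right[of "pi / 2" \<Theta>'] that by simp
    qed (use left right that in auto)
  qed
  then have anti: "strict_antimono_on {..<pi} ?\<mu>" by (auto intro!: monotone_onI)
  have bot: "filterlim ?\<mu> at_top at_bot"
  proof (rule filterlim_at_top_mono)
    have "filterlim (\<lambda>\<Theta> :: real. -1 + cosh \<Theta>) at_top at_bot"
      by (rule filterlim_tendsto_add_at_top[OF tendsto_const cosh_real_at_bot])
    then show "filterlim (\<lambda>\<Theta>. N / 4 * (-1 + cosh \<Theta>)) at_top at_bot"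
      using N by (intro filterlim_tendsto_pos_mult_at_top[OF tendsto_const]) auto
    \<comment> \<open>Nonnegativity of \<open>K\<close> gives the lower bound N / 4 sinh^2 \<Theta>;
      cosh \<Theta> - 1 is a smaller minorant with a known limit.\<close>
    have "N / 4 * (-1 + cosh \<Theta>) \<le> ?\<mu> \<Theta>" if "\<Theta> < 0" for \<Theta>
    proof -
      have lt: "\<Theta> < pi" using that pi_gt_zero by linarith
      have nn: "0 \<le> ((1 + signed_radius \<Theta>)\<^sup>2 * ?\<mu> \<Theta> + N * signed_radius \<Theta>) / (1 + signed_radius \<Theta>)\<^sup>2"
        using unit_minmax_nonneg[OF mm[OF lt]] by simp
      have "N / 4 * ((cosh \<Theta>)\<^sup>2 - 1) \<le> ?\<mu> \<Theta>"
      proof -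
        have "N * ((1 - (gen_cos \<Theta>)\<^sup>2) / 4) = - (N / 4 * ((cosh \<Theta>)\<^sup>2 - 1))"
          using that by (simp add: gen_cos_def field_simps)
        then show ?thesis using nn unfolding quot[OF lt] by linarith
      qed
      moreover have "cosh \<Theta> \<le> (cosh \<Theta>)\<^sup>2"
        using cosh_real_ge_1[of \<Theta>] by (simp add: power2_eq_square)
      then have "N / 4 * (-1 + cosh \<Theta>) \<le> N / 4 * ((cosh \<Theta>)\<^sup>2 - 1)"
        using N by (intro mult_left_mono) auto
      ultimately show ?thesis by linarith
    qed
    then show "\<forall>\<^sub>F \<Theta> in at_bot. N / 4 * (-1 + cosh \<Theta>) \<le> ?\<mu> \<Theta>"
      unfolding eventually_at_bot_dense by blast
  qed
  have "(?\<mu> \<longlongrightarrow> 0) (at_left pi)"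
  \<comment> \<open>Domain monotonicity bounds the eigenvalue beyond \<open>pi / 2\<close> by its
    value at \<open>pi / 2\<close>, so sin^2 \<Theta> alone drives the limit.\<close>
  proof (rule tendsto_sandwich[of "\<lambda>_. 0" _ _ "\<lambda>\<Theta>. cap_eigenvalue TYPE('n) k (pi / 2) * (sin \<Theta>)\<^sup>2"])
    have "((\<lambda>\<Theta>. cap_eigenvalue TYPE('n) k (pi / 2) * (sin \<Theta>)\<^sup>2) \<longlongrightarrow> cap_eigenvalue TYPE('n) k (pi / 2) * (sin pi)\<^sup>2) (at_left pi)"
      by (intro tendsto_intros)
    then show "((\<lambda>\<Theta>. cap_eigenvalue TYPE('n) k (pi / 2) * (sin \<Theta>)\<^sup>2) \<longlongrightarrow> 0) (at_left pi)" by simp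
    have bnd: "0 \<le> ?\<mu> \<Theta> \<and> ?\<mu> \<Theta> \<le> cap_eigenvalue TYPE('n) k (pi / 2) * (sin \<Theta>)\<^sup>2" if "pi / 2 < \<Theta>" "\<Theta> < pi" for \<Theta>
    proof -
      have p: "0 < \<Theta>" "0 < pi / 2" "pi / 2 \<le> \<Theta>" using that pi_gt_zero by linarith+
      have "?\<mu> \<Theta> = cap_eigenvalue TYPE('n) k \<Theta> * (sin \<Theta>)\<^sup>2"
        using p(1) by (simp add: scaled_eigenvalue_def)
      then show ?thesis
        using cap_eigenvalue_pos[OF n p(1) that(2), of k]
          mult_right_mono[OF cap_eigenvalue_antimono[OF n p(2,3) that(2), of k], of "(sin \<Theta>)\<^sup>2"]
        by simp
    qed
    have "pi / 2 < pi" using pi_gt_zero by linarith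
    then show "\<forall>\<^sub>F \<Theta> in at_left pi. 0 \<le> ?\<mu> \<Theta>"
      "\<forall>\<^sub>F \<Theta> in at_left pi. ?\<mu> \<Theta> \<le> cap_eigenvalue TYPE('n) k (pi / 2) * (sin \<Theta>)\<^sup>2"
      unfolding eventually_at_left_field using bnd by blast+
  qed (rule tendsto_const)
  then show ?thesis using anti bot by blast
qed

end
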